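(* Let $q$ be a prime power. For integers $n\geq 1$ and $e\geq 0$, the number of Heisenberg characters of $\mathbf{U}_{n+1}(\mathbb{F}_q)$ of degree $q^e$ is \[ q^{n-e-1}\left(\binom{n-e}{e}(q-1)^e + \binom{n-e-1}{e}(q-1)^{e+1}\right).\] Consequently, the total number of Heisenberg characters of $\mathbf{U}_{n+1}(\mathbb{F}_q)$ is a polynomial in $q-1$ with nonnegative integer coefficients and degree $n$, whose leading coefficient is the $n$th Fibonacci number $f_n$.
   Context: $\mathbb{F}_q$ is the finite field with $q$ elements and $\mathbf{U}_m(\mathbb{F}_q)$ is the group of $m\times m$ upper triangular matrices over $\mathbb{F}_q$ with all diagonal entries equal to $1$. A character $\chi$ of a finite group $G$ is Heisenberg if $\chi$ is irreducible and $\ker\chi\supseteq [G,[G,G]]$. The Fibonacci numbers are $f_0=0$, $f_1=f_2=1$, $f_{m+1}=f_m+f_{m-1}$. Binomial coefficients $\binom{m}{k}$ are taken to be $0$ unless $0\le k\le m$. *)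

theory Defs
  imports
    "Jordan_Normal_Form.VS_Connect"
    "HOL-Algebra.Generated_Groups"
    "HOL-Number_Theory.Fib"
    "HOL-Number_Theory.Prime_Powers"
begin

section \<open>Characters of groups\<close>

definition mat_trace :: "'a::comm_monoid_add mat \<Rightarrow> 'a" where
  "mat_trace A = (\<Sum>i<dim_row A. A $$ (i, i))"

definition representation :: "('g, 'b) monoid_scheme \<Rightarrow> nat \<Rightarrow> ('g \<Rightarrow> complex mat) \<Rightarrow> bool" where
  "representation G d \<rho> \<longleftrightarrow> \<rho> \<in> hom G (units_of (ring_mat TYPE(complex) d ()))"

definition irreducible_representation ::
  "('g, 'b) monoid_scheme \<Rightarrow> nat \<Rightarrow> ('g \<Rightarrow> complex mat) \<Rightarrow> bool" where
  "irreducible_representation G d \<rho> \<longleftrightarrow>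
     representation G d \<rho> \<and> d > 0 \<and>
     (\<forall>W. VectorSpace.subspace class_ring W (module_vec TYPE(complex) d) \<and>
          (\<forall>g \<in> carrier G. \<forall>w \<in> W. \<rho> g *\<^sub>v w \<in> W) \<longrightarrow>
          W = {0\<^sub>v d} \<or> W = carrier_vec d)"

text \<open>Characters are made \<open>undefined\<close> outside the carrier, so that equality of functions is
  equality of characters and \<open>card\<close> counts them correctly.\<close>

definition character_of :: "('g, 'b) monoid_scheme \<Rightarrow> ('g \<Rightarrow> complex mat) \<Rightarrow> 'g \<Rightarrow> complex" where
  "character_of G \<rho> = restrict (\<lambda>g. mat_trace (\<rho> g)) (carrier G)"

definition irreducible_characters :: "('g, 'b) monoid_scheme \<Rightarrow> ('g \<Rightarrow> complex) set" where
  "irreducible_characters G =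
     {character_of G \<rho> | d \<rho>. irreducible_representation G d \<rho>}"

definition character_degree :: "('g, 'b) monoid_scheme \<Rightarrow> ('g \<Rightarrow> complex) \<Rightarrow> complex" where
  "character_degree G \<chi> = \<chi> \<one>\<^bsub>G\<^esub>"

definition character_kernel :: "('g, 'b) monoid_scheme \<Rightarrow> ('g \<Rightarrow> complex) \<Rightarrow> 'g set" where
  "character_kernel G \<chi> = {g \<in> carrier G. \<chi> g = \<chi> \<one>\<^bsub>G\<^esub>}"

text \<open>The subgroup \<open>[H, K]\<close>, with the same commutator convention as \<^const>\<open>derived\<close>,
  to which it specializes for \<open>H = K\<close>.\<close>

definition commutator_subgroup :: "('g, 'b) monoid_scheme \<Rightarrow> 'g set \<Rightarrow> 'g set \<Rightarrow> 'g set" where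
  "commutator_subgroup G H K =
     generate G (\<Union>h \<in> H. \<Union>k \<in> K. {h \<otimes>\<^bsub>G\<^esub> k \<otimes>\<^bsub>G\<^esub> inv\<^bsub>G\<^esub> h \<otimes>\<^bsub>G\<^esub> inv\<^bsub>G\<^esub> k})"

definition heisenberg_characters :: "('g, 'b) monoid_scheme \<Rightarrow> ('g \<Rightarrow> complex) set" where
  "heisenberg_characters G =
     {\<chi> \<in> irreducible_characters G.
        commutator_subgroup G (carrier G) (commutator_subgroup G (carrier G) (carrier G))
          \<subseteq> character_kernel G \<chi>}"


section \<open>Unitriangular groups\<close>

text \<open>The base field is a record with explicit carrier rather than a type of class \<open>field\<close>, so
  that one formula can speak about all finite fields at once (every finite field has an isomorphic
  copy with carrier in \<open>nat\<close>). The type of matrices places no algebraic structure on the entries;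
  the ring operations used are those of \<open>F\<close>.\<close>

definition unitriangular_group :: "nat \<Rightarrow> ('a, 'b) ring_scheme \<Rightarrow> 'a mat monoid" where
  "unitriangular_group m F =
     \<lparr>carrier = {A \<in> carrier_mat m m.
        (\<forall>i<m. \<forall>j<m. A $$ (i, j) \<in> carrier F) \<and>
        (\<forall>i<m. A $$ (i, i) = \<one>\<^bsub>F\<^esub>) \<and>
        (\<forall>i<m. \<forall>j<i. A $$ (i, j) = \<zero>\<^bsub>F\<^esub>)},
      monoid.mult = (\<lambda>A B. mat m m (\<lambda>(i, j). \<Oplus>\<^bsub>F\<^esub>k\<in>{..<m}. A $$ (i, k) \<otimes>\<^bsub>F\<^esub> B $$ (k, j))),
      monoid.one = mat m m (\<lambda>(i, j). if i = j then \<one>\<^bsub>F\<^esub> else \<zero>\<^bsub>F\<^esub>)\<rparr>"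


section \<open>Binomial coefficients\<close>

text \<open>Zero unless \<open>0 \<le> k \<le> m\<close>; in particular zero for negative \<open>m\<close>, unlike the
  generalized binomial coefficient \<^const>\<open>gbinomial\<close>.\<close>

definition binom :: "int \<Rightarrow> int \<Rightarrow> nat" where
  "binom m k = (if 0 \<le> k \<and> k \<le> m then nat m choose nat k else 0)"

end

theory Submission
  imports Defs "Jordan_Normal_Form.Spectral_Radius" "Jordan_Normal_Form.DL_Rank"
begin

text \<open>The triple commutator subgroup of the unitriangular group consists of the matrices whose first
  two superdiagonals vanish, so a Heisenberg character only sees the first superdiagonal \<open>a\<close> and the
  second superdiagonal \<open>c\<close> of a matrix. On the matrices with \<open>a = 0\<close> an irreducible representation is
  scalar, given by \<open>c \<mapsto> \<theta> (\<Sum>i. z i * c i)\<close> for a fixed nontrivial additive character \<open>\<theta>\<close> and some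
  \<open>z \<in> F\<^sup>n\<^sup>-\<^sup>1\<close>. The commutator turns \<open>z\<close> into an alternating form on \<open>F\<^sup>n\<close>; the character is supported on the
  preimage of its radical, has degree the square root of the index of the radical, and is
  determined up to the characters \<open>\<theta> (\<Sum>i. u i * a i)\<close>. So \<open>z\<close> contributes as many characters as its
  radical has elements. The form of \<open>z\<close> is tridiagonal, and splitting off its last row gives a
  two-term recursion for the number of \<open>z\<close> of given rank.\<close>

section \<open>Linear algebra\<close>

text \<open>The coordinate \<open>c\<close> is not additive: the product of \<open>g\<close> and
  \<open>h\<close> adds the term \<open>a i g * a (i + 1) h\<close>. Hence \<theta> (\<Sum>i. z i *
  c i) is multiplicative only where \<open>a\<close> vanishes on one factor, and its defect
  \<open>cross\<close> on the whole group is the source of the alternating form. Two matching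
  problems arise: a character of the preimage of the radical has to be extended to a character in
  \<open>a\<close>, and a character of the matrices with \<open>a = 0\<close> has to come from some
  \<open>z\<close>. Both are solved by averaging: the correlations of the given character with all
  candidates add up to a nonzero number, so one correlation is nonzero, and orthogonality forces
  that candidate to agree with the given character. The same double sum counts the twists that
  coincide. Inner products use values at inverses, so no unitarity enters. Irreducible
  representations are cut out of the regular representation instead of being induced. The Fibonacci
  numbers stem from the recursion \<open>T (n + 2) = q * (T (n + 1) + (q - 1) * T n)\<close> for the
  totals: in \<open>t = q - 1\<close> both summands in the bracket have the same degree, so their
  leading coefficients add.\<close>

lemma subspace_class_ring_iff:
  "VectorSpace.subspace class_ring W (module_vec TYPE('a::field) d) \<longleftrightarrow>
     W \<subseteq> carrier_vec d \<and> 0\<^sub>v d \<in> W \<and> (\<forall>v\<in>W. \<forall>w\<in>W. v + w \<in> W) \<and> (\<forall>c. \<forall>v\<in>W. c \<cdot>\<^sub>v v \<in> W)"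
proof -
  interpret vec_space "TYPE('a)" d .
  show ?thesis
    using vectorspace_axioms module_axioms
    by (auto simp: VectorSpace.subspace_def submodule_def module_vec_simps)
qed

lemma mult_mat_vec_eq_0_imp_inj_on:
  fixes B :: "'a::comm_ring_1 mat"
  assumes B: "B \<in> carrier_mat d k"
    and ker: "\<And>v. v \<in> carrier_vec k \<Longrightarrow> B *\<^sub>v v = 0\<^sub>v d \<Longrightarrow> v = 0\<^sub>v k"
  shows "inj_on ((*\<^sub>v) B) (carrier_vec k)"
proof (rule inj_onI)
  fix v w assume v: "v \<in> carrier_vec k" and w: "w \<in> carrier_vec k" and eq: "B *\<^sub>v v = B *\<^sub>v w"
  have "B *\<^sub>v (v - w) = B *\<^sub>v v - B *\<^sub>v w"
    using B v w by (simp add: mult_minus_distrib_mat_vec)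
  also have "\<dots> = 0\<^sub>v d" using B v w eq by auto
  finally have "v - w = 0\<^sub>v k" using ker v w by auto
  then have "(v - w) $ i = 0" if "i < k" for i using that by simp
  then show "v = w" using v w by (intro eq_vecI) auto
qed

text \<open>Subspaces are handled as images of injective matrices, so that restricting a
  representation remains a matrix computation. The columns form a maximal independent subset of
  \<open>W\<close>. The last clause converts equal dimensions into equal spaces, which is what a
  minimality argument delivers.\<close>

lemma subspace_basis_mat:
  fixes W :: "'a::field vec set"
  assumes W: "VectorSpace.subspace class_ring W (module_vec TYPE('a) d)"
  obtains k B where "k \<le> d" "B \<in> carrier_mat d k" "inj_on ((*\<^sub>v) B) (carrier_vec k)"
    "W = (*\<^sub>v) B ` carrier_vec k" "k = d \<Longrightarrow> W = carrier_vec d"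
proof -
  interpret vec_space "TYPE('a)" d .
  have Wc: "W \<subseteq> carrier_vec d" using W by (simp add: subspace_class_ring_iff)
  have sm: "LinearCombinations.submodule class_ring W V" using W by (simp add: VectorSpace.subspace_def)
  have "\<exists>S. finite S \<and> maximal S (\<lambda>S. S \<subseteq> W \<and> lin_indpt S)"
  proof (rule maximal_exists)
    fix A assume "A \<subseteq> W \<and> lin_indpt A"
    then show "finite A \<and> card A \<le> d"
      using li_le_dim[OF fin_dim, of A] Wc dim_is_n by auto
  next
    show "{} \<subseteq> W \<and> lin_indpt {}" unfolding lin_dep_def by auto
  qed
  then obtain S where fS: "finite S" and max: "maximal S (\<lambda>S. S \<subseteq> W \<and> lin_indpt S)" by blast
  then have SW: "S \<subseteq> W" and li: "lin_indpt S" by (auto simp: maximal_def)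
  have Sc: "S \<subseteq> carrier_vec d" using SW Wc by auto
  have spanS: "span S = W"
  proof
    show "span S \<subseteq> W" using span_is_subset[OF SW sm] by simp
    show "W \<subseteq> span S"
    proof (rule ccontr)
      assume "\<not> W \<subseteq> span S"
      then obtain w where w: "w \<in> W" "w \<notin> span S" by blast
      have "w \<notin> S" using w in_own_span[of S] Sc by auto
      then have "lin_indpt (S \<union> {w})"
        using lin_dep_iff_in_span[OF Sc li _ \<open>w \<notin> S\<close>] w Wc by auto
      then have "S \<union> {w} = S" using max w SW unfolding maximal_def by blast
      then show False using \<open>w \<notin> S\<close> by auto
    qed
  qed
  obtain ws where ws: "set ws = S" "distinct ws" using finite_distinct_list[OF fS] by blast
  define B where "B = mat_of_cols d ws"
  have B: "B \<in> carrier_mat d (length ws)" by (simp add: B_def)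
  have cols: "cols B = ws" using ws Sc by (simp add: B_def)
  have len: "length ws = card S" using ws distinct_card by fastforce
  show ?thesis
  proof (rule that)
    show "length ws \<le> d" using li_le_dim[OF fin_dim Sc li] len dim_is_n by simp
    show "B \<in> carrier_mat d (length ws)" by fact
    show "inj_on ((*\<^sub>v) B) (carrier_vec (length ws))"
      using lin_depI[OF B] cols ws li by (intro mult_mat_vec_eq_0_imp_inj_on[OF B]) metis
    show "W = (*\<^sub>v) B ` carrier_vec (length ws)"
    proof -
      have "W = col_space B" unfolding col_space_def cols ws spanS ..
      also have "\<dots> = (*\<^sub>v) B ` carrier_vec (length ws)"
        unfolding col_space_eq[OF B] using B by auto
      finally show ?thesis .
    qed
    assume "length ws = d"
    then have "basis S" using dim_li_is_basis[OF fin_dim fS Sc li] len dim_is_n by simp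
    then show "W = carrier_vec d" using spanS by (simp add: basis_def)
  qed
qed

lemma mat_trace_comm:
  fixes A B :: "'a::comm_semiring_0 mat"
  assumes "A \<in> carrier_mat n m" "B \<in> carrier_mat m n"
  shows "mat_trace (A * B) = mat_trace (B * A)"
proof -
  have "mat_trace (A * B) = (\<Sum>i<n. \<Sum>j<m. A $$ (i,j) * B $$ (j,i))"
    using assms by (auto simp: mat_trace_def scalar_prod_def atLeast0LessThan intro!: sum.cong)
  also have "\<dots> = (\<Sum>j<m. \<Sum>i<n. B $$ (j,i) * A $$ (i,j))"
    by (subst sum.swap) (simp add: mult.commute)
  also have "\<dots> = mat_trace (B * A)"
    using assms by (auto simp: mat_trace_def scalar_prod_def atLeast0LessThan intro!: sum.cong)
  finally show ?thesis .
qed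

lemma mat_trace_smult: "mat_trace (c \<cdot>\<^sub>m A) = (c :: 'a::semiring_0) * mat_trace A"
  if "A \<in> carrier_mat n n"
  using that by (simp add: mat_trace_def sum_distrib_left)

lemma mat_trace_one: "mat_trace (1\<^sub>m n :: 'a::semiring_1 mat) = of_nat n"
  by (simp add: mat_trace_def)

text \<open>Matrices of all sizes share one type and have no common zero, so the size is an argument
  and the sum is taken entrywise.\<close>

definition msum :: "nat \<Rightarrow> ('i \<Rightarrow> 'a::comm_monoid_add mat) \<Rightarrow> 'i set \<Rightarrow> 'a mat" where
  "msum d f N = mat d d (\<lambda>(i, j). \<Sum>x\<in>N. f x $$ (i, j))"

lemma msum_carrier [simp]: "msum d f N \<in> carrier_mat d d"
  by (simp add: msum_def)

lemma index_msum: "i < d \<Longrightarrow> j < d \<Longrightarrow> msum d f N $$ (i, j) = (\<Sum>x\<in>N. f x $$ (i, j))"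
  by (simp add: msum_def)

lemma msum_cong: "(\<And>x. x \<in> N \<Longrightarrow> f x = g x) \<Longrightarrow> msum d f N = msum d g N"
  by (simp add: msum_def)

lemma msum_reindex: "bij_betw h N N' \<Longrightarrow> msum d f N' = msum d (\<lambda>x. f (h x)) N"
  unfolding msum_def by (subst sum.reindex_bij_betw[symmetric, of h N N']) simp_all

lemma mult_msum:
  fixes A :: "'a::comm_semiring_0 mat"
  assumes "A \<in> carrier_mat d d" "\<And>x. x \<in> N \<Longrightarrow> f x \<in> carrier_mat d d"
  shows "A * msum d f N = msum d (\<lambda>x. A * f x) N"
proof (rule eq_matI)
  fix i j assume ij: "i < dim_row (msum d (\<lambda>x. A * f x) N)" "j < dim_col (msum d (\<lambda>x. A * f x) N)"
  then have ij: "i < d" "j < d" by (auto simp: msum_def)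
  have "(A * msum d f N) $$ (i, j) = (\<Sum>k<d. \<Sum>x\<in>N. A $$ (i,k) * f x $$ (k, j))"
    using ij assms(1) by (auto simp: msum_def scalar_prod_def atLeast0LessThan sum_distrib_left intro!: sum.cong)
  also have "\<dots> = (\<Sum>x\<in>N. \<Sum>k<d. A $$ (i,k) * f x $$ (k, j))" by (rule sum.swap)
  also have "\<dots> = (\<Sum>x\<in>N. (A * f x) $$ (i, j))"
  proof (intro sum.cong refl)
    fix x assume "x \<in> N"
    then have "f x \<in> carrier_mat d d" using assms by auto
    then show "(\<Sum>k<d. A $$ (i,k) * f x $$ (k, j)) = (A * f x) $$ (i, j)"
      using ij assms(1) by (auto simp: scalar_prod_def atLeast0LessThan intro!: sum.cong)
  qed
  finally show "(A * msum d f N) $$ (i, j) = msum d (\<lambda>x. A * f x) N $$ (i, j)"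
    using ij by (simp add: index_msum)
qed (use assms in \<open>auto simp: msum_def\<close>)

lemma msum_mult:
  fixes A :: "'a::comm_semiring_0 mat"
  assumes "A \<in> carrier_mat d d" "\<And>x. x \<in> N \<Longrightarrow> f x \<in> carrier_mat d d"
  shows "msum d f N * A = msum d (\<lambda>x. f x * A) N"
proof (rule eq_matI)
  fix i j assume ij: "i < dim_row (msum d (\<lambda>x. f x * A) N)" "j < dim_col (msum d (\<lambda>x. f x * A) N)"
  then have ij: "i < d" "j < d" by (auto simp: msum_def)
  have "(msum d f N * A) $$ (i, j) = (\<Sum>k<d. \<Sum>x\<in>N. f x $$ (i, k) * A $$ (k,j))"
    using ij assms(1) by (auto simp: msum_def scalar_prod_def atLeast0LessThan sum_distrib_right intro!: sum.cong)
  also have "\<dots> = (\<Sum>x\<in>N. \<Sum>k<d. f x $$ (i, k) * A $$ (k,j))" by (rule sum.swap)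
  also have "\<dots> = (\<Sum>x\<in>N. (f x * A) $$ (i, j))"
  proof (intro sum.cong refl)
    fix x assume "x \<in> N"
    then have "f x \<in> carrier_mat d d" using assms by auto
    then show "(\<Sum>k<d. f x $$ (i, k) * A $$ (k,j)) = (f x * A) $$ (i, j)"
      using ij assms(1) by (auto simp: scalar_prod_def atLeast0LessThan intro!: sum.cong)
  qed
  finally show "(msum d f N * A) $$ (i, j) = msum d (\<lambda>x. f x * A) N $$ (i, j)"
    using ij by (simp add: index_msum)
qed (use assms in \<open>auto simp: msum_def\<close>)

lemma mat_trace_msum:
  "mat_trace (msum d f N) = (\<Sum>x\<in>N. mat_trace (f x))"
  if "\<And>x. x \<in> N \<Longrightarrow> f x \<in> carrier_mat d d"
proof -
  have "mat_trace (msum d f N) = (\<Sum>x\<in>N. \<Sum>i<d. f x $$ (i,i))"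
    unfolding mat_trace_def by (subst sum.swap) (auto simp: msum_def intro!: sum.cong)
  also have "\<dots> = (\<Sum>x\<in>N. mat_trace (f x))"
    using that by (auto simp: mat_trace_def intro!: sum.cong)
  finally show ?thesis .
qed

section \<open>Representations of finite groups\<close>

lemma mult_unit_vec_col:
  fixes A :: "'a::comm_semiring_1 mat"
  assumes "A \<in> carrier_mat n m" "j < m"
  shows "A *\<^sub>v unit_vec m j = col A j"
  using assms by (intro eq_vecI) auto

lemma eq_mat_by_vecs:
  fixes A B :: "'a::comm_ring_1 mat"
  assumes A: "A \<in> carrier_mat n m" and B: "B \<in> carrier_mat n m"
    and eq: "\<And>v. v \<in> carrier_vec m \<Longrightarrow> A *\<^sub>v v = B *\<^sub>v v"
  shows "A = B"
proof (rule mat_col_eqI)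
  fix i assume "i < dim_col B"
  then have i: "i < m" using B by simp
  show "col A i = col B i"
    using eq[of "unit_vec m i"] mult_unit_vec_col[OF A i] mult_unit_vec_col[OF B i] by simp
qed (use A B in auto)

lemma scalar_mat_mult_vec:
  fixes v :: "'a::comm_semiring_1 vec"
  assumes "v \<in> carrier_vec n"
  shows "(c \<cdot>\<^sub>m 1\<^sub>m n) *\<^sub>v v = c \<cdot>\<^sub>v v"
proof (rule eq_vecI)
  fix i assume "i < dim_vec (c \<cdot>\<^sub>v v)"
  then have i: "i < n" using assms by auto
  have "((c \<cdot>\<^sub>m 1\<^sub>m n) *\<^sub>v v) $ i = (\<Sum>j<n. c * (if j = i then 1 else 0) * v $ j)"
    using i assms by (auto simp: scalar_prod_def atLeast0LessThan intro!: sum.cong)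
  also have "\<dots> = (\<Sum>j<n. if j = i then c * v $ j else 0)"
    by (rule sum.cong) auto
  also have "\<dots> = (c \<cdot>\<^sub>v v) $ i"
    using i assms by simp
  finally show "((c \<cdot>\<^sub>m 1\<^sub>m n) *\<^sub>v v) $ i = (c \<cdot>\<^sub>v v) $ i" .
qed (use assms in auto)

lemma mult_left_cancel_inj_mat:
  fixes M :: "'a::comm_ring_1 mat"
  assumes M: "M \<in> carrier_mat n k" "inj_on ((*\<^sub>v) M) (carrier_vec k)"
    and A: "A \<in> carrier_mat k m" and B: "B \<in> carrier_mat k m" and eq: "M * A = M * B"
  shows "A = B"
proof (rule eq_mat_by_vecs[OF A B])
  fix v :: "'a vec" assume v: "v \<in> carrier_vec m"
  have "M *\<^sub>v (A *\<^sub>v v) = M *\<^sub>v (B *\<^sub>v v)"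
    using assoc_mult_mat_vec[OF M(1) A v] assoc_mult_mat_vec[OF M(1) B v] eq by simp
  then show "A *\<^sub>v v = B *\<^sub>v v"
    using M(2) A B v by (auto dest!: inj_onD)
qed

lemma carrier_vec_0: "carrier_vec 0 = {0\<^sub>v 0 :: 'a::zero vec}"
  by (auto intro!: eq_vecI)

lemma mat_factor_through_image:
  fixes M A :: "'a::comm_ring_1 mat"
  assumes M: "M \<in> carrier_mat n k" and A: "A \<in> carrier_mat n m"
    and im: "\<And>v. v \<in> carrier_vec m \<Longrightarrow> A *\<^sub>v v \<in> (*\<^sub>v) M ` carrier_vec k"
  shows "\<exists>R \<in> carrier_mat k m. A = M * R"
proof -
  have "\<exists>w. w \<in> carrier_vec k \<and> col A j = M *\<^sub>v w" if "j < m" for j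
    using im[of "unit_vec m j"] mult_unit_vec_col[OF A that] by auto
  then obtain w where w: "\<And>j. j < m \<Longrightarrow> w j \<in> carrier_vec k" "\<And>j. j < m \<Longrightarrow> col A j = M *\<^sub>v w j"
    by metis
  define R where "R = mat_of_cols k (map w [0..<m])"
  have R: "R \<in> carrier_mat k m" by (auto simp: R_def)
  have "A = M * R"
  proof (rule mat_col_eqI)
    fix j assume "j < dim_col (M * R)"
    then have j: "j < m" using R by simp
    have "col R j = w j" using j w(1) by (simp add: R_def)
    then show "col A j = col (M * R) j"
      using col_mult2[OF M R j] w(2)[OF j] by simp
  qed (use A M R in auto)
  then show ?thesis using R by blast
qed

lemma (in group) representationI:
  assumes "\<And>g. g \<in> carrier G \<Longrightarrow> \<rho> g \<in> carrier_mat d d"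
    and "\<And>g h. g \<in> carrier G \<Longrightarrow> h \<in> carrier G \<Longrightarrow> \<rho> (g \<otimes> h) = \<rho> g * \<rho> h"
    and "\<rho> \<one> = 1\<^sub>m d"
  shows "representation G d \<rho>"
proof -
  have "\<rho> g \<in> Units (ring_mat TYPE(complex) d ())" if g: "g \<in> carrier G" for g
  proof -
    have "\<rho> (inv g) * \<rho> g = 1\<^sub>m d" "\<rho> g * \<rho> (inv g) = 1\<^sub>m d"
      using assms(2)[of "inv g" g] assms(2)[of g "inv g"] assms(3) g by auto
    then show ?thesis using assms(1) g
      unfolding Units_def by (auto simp: ring_mat_simps intro!: bexI[of _ "\<rho> (inv g)"])
  qed
  then show ?thesis
    using assms(2) by (auto simp: representation_def hom_def units_of_def ring_mat_simps)
qed

section \<open>Irreducible matrix representations and Schur's lemma\<close>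

locale fin_group = group G for G (structure) +
  assumes finite_carrier [simp]: "finite (carrier G)"

locale matrix_rep = fin_group G for G (structure) +
  fixes d :: nat and \<rho>
  assumes rep: "representation G d \<rho>"
begin

lemma rep_carrier [simp]: "g \<in> carrier G \<Longrightarrow> \<rho> g \<in> carrier_mat d d"
  using rep by (auto simp: representation_def hom_def units_of_def Units_def ring_mat_simps)

lemma rep_dim [simp]:
  assumes "g \<in> carrier G"
  shows "dim_row (\<rho> g) = d" "dim_col (\<rho> g) = d"
  using rep_carrier[OF assms] by auto

lemma rep_mult: "g \<in> carrier G \<Longrightarrow> h \<in> carrier G \<Longrightarrow> \<rho> (g \<otimes> h) = \<rho> g * \<rho> h"
  using rep by (auto simp: representation_def hom_def units_of_def ring_mat_simps)

lemma rep_one [simp]: "\<rho> \<one> = 1\<^sub>m d"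
proof -
  have "\<rho> \<one> = \<one>\<^bsub>units_of (ring_mat TYPE(complex) d ())\<^esub>"
    by (rule hom_one[OF _ is_group])
      (use rep in \<open>auto simp: representation_def intro!: monoid.units_group ring.is_monoid[OF ring_mat]\<close>)
  then show ?thesis by (simp add: units_of_def ring_mat_simps)
qed

lemma rep_inv: "g \<in> carrier G \<Longrightarrow> \<rho> (inv g) * \<rho> g = 1\<^sub>m d" "g \<in> carrier G \<Longrightarrow> \<rho> g * \<rho> (inv g) = 1\<^sub>m d"
  using rep_mult[of "inv g" g] rep_mult[of g "inv g"] by auto

lemma trace_conj:
  assumes "g \<in> carrier G" "A \<in> carrier_mat d d"
  shows "mat_trace (\<rho> g * A * \<rho> (inv g)) = mat_trace A"
proof -
  have "mat_trace (\<rho> g * A * \<rho> (inv g)) = mat_trace (\<rho> (inv g) * (\<rho> g * A))"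
    using assms by (intro mat_trace_comm[of _ d d]) auto
  also have "\<rho> (inv g) * (\<rho> g * A) = (\<rho> (inv g) * \<rho> g) * A"
    using assms by (intro assoc_mult_mat[symmetric, of _ d d _ d _ d]) auto
  also have "\<dots> = A" using assms by (simp add: rep_inv)
  finally show ?thesis .
qed

lemma rep_scalar_mult:
  assumes x: "x \<in> carrier G" and y: "y \<in> carrier G" and scalar: "\<rho> x = \<alpha> \<cdot>\<^sub>m 1\<^sub>m d"
  shows "\<rho> (x \<otimes> y) = \<alpha> \<cdot>\<^sub>m \<rho> y"
    and "mat_trace (\<rho> (x \<otimes> y)) = \<alpha> * mat_trace (\<rho> y)"
proof -
  show "\<rho> (x \<otimes> y) = \<alpha> \<cdot>\<^sub>m \<rho> y"
    using rep_carrier[OF y] by (simp add: rep_mult[OF x y] scalar mult_smult_assoc_mat[of _ d d _ d])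
  then show "mat_trace (\<rho> (x \<otimes> y)) = \<alpha> * mat_trace (\<rho> y)"
    using mat_trace_smult[OF rep_carrier[OF y]] by simp
qed

text \<open>The invariant subspace of least dimension is cut out by an injective intertwiner \<open>M\<close>.\<close>

lemma irreducible_constituent:
  assumes W: "VectorSpace.subspace class_ring W (module_vec TYPE(complex) d)"
    and inv: "\<forall>g\<in>carrier G. \<forall>w\<in>W. \<rho> g *\<^sub>v w \<in> W"
    and nonzero: "W \<noteq> {0\<^sub>v d}"
  obtains k M \<sigma> where "irreducible_representation G k \<sigma>" "M \<in> carrier_mat d k"
    "inj_on ((*\<^sub>v) M) (carrier_vec k)" "(*\<^sub>v) M ` carrier_vec k \<subseteq> W"
    "\<And>g. g \<in> carrier G \<Longrightarrow> \<rho> g * M = M * \<sigma> g"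
proof -
  \<comment> \<open>\<open>P k\<close> stands for an invariant subspace of dimension
    \<open>k > 0\<close> inside \<open>W\<close>, given by a basis matrix; its existence is where
    \<open>W\<close> being nonzero is spent.\<close>
  define P where "P k \<longleftrightarrow> k > 0 \<and> (\<exists>M \<in> carrier_mat d k. inj_on ((*\<^sub>v) M) (carrier_vec k) \<and>
    (*\<^sub>v) M ` carrier_vec k \<subseteq> W \<and>
    (\<forall>g\<in>carrier G. \<forall>v\<in>carrier_vec k. \<rho> g *\<^sub>v (M *\<^sub>v v) \<in> (*\<^sub>v) M ` carrier_vec k))" for k
  have "\<exists>k. P k"
  proof -
    obtain k B where B: "B \<in> carrier_mat d k" "inj_on ((*\<^sub>v) B) (carrier_vec k)"
      "W = (*\<^sub>v) B ` carrier_vec k" using subspace_basis_mat[OF W] by metis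
    have "k \<noteq> 0"
    proof
      assume "k = 0"
      then have "W = {B *\<^sub>v 0\<^sub>v 0}" unfolding B(3) by (simp add: \<open>k = 0\<close> carrier_vec_0)
      moreover have "B *\<^sub>v 0\<^sub>v 0 = 0\<^sub>v d" using B(1) \<open>k = 0\<close> by (auto simp: scalar_prod_def)
      ultimately show False using nonzero by simp
    qed
    then have "P k" unfolding P_def using B inv by (intro conjI bexI[of _ B]) auto
    then show ?thesis ..
  qed
  then obtain k where Pk: "P k" and least: "\<And>k'. k' < k \<Longrightarrow> \<not> P k'"
    using exists_least_iff[of P] by blast
  from Pk[unfolded P_def] have k: "k > 0" by (rule conjunct1)
  from conjunct2[OF Pk[unfolded P_def]] obtain M where M: "M \<in> carrier_mat d k"
    and inj: "inj_on ((*\<^sub>v) M) (carrier_vec k)" and MW: "(*\<^sub>v) M ` carrier_vec k \<subseteq> W"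
    and Minv': "\<forall>g\<in>carrier G. \<forall>v\<in>carrier_vec k. \<rho> g *\<^sub>v (M *\<^sub>v v) \<in> (*\<^sub>v) M ` carrier_vec k"
    by (elim bexE conjE)
  note Minv = Minv'[rule_format]
  \<comment> \<open>Invariance puts the columns of \<open>\<rho> g * M\<close> into the image of
    \<open>M\<close>, so the action in the basis \<open>M\<close> is a matrix; cancelling the
    injective \<open>M\<close> then makes this matrix multiplicative in \<open>g\<close>.\<close>
  have "\<exists>R. R \<in> carrier_mat k k \<and> \<rho> g * M = M * R" if g: "g \<in> carrier G" for g
  proof -
    have "(\<rho> g * M) *\<^sub>v v \<in> (*\<^sub>v) M ` carrier_vec k" if "v \<in> carrier_vec k" for v
      using Minv[OF g that] assoc_mult_mat_vec[OF rep_carrier[OF g] M that] by simp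
    then show ?thesis
      using mat_factor_through_image[OF M, of "\<rho> g * M" k] rep_carrier[OF g] M by auto
  qed
  then obtain \<sigma> where \<sigma>: "\<And>g. g \<in> carrier G \<Longrightarrow> \<sigma> g \<in> carrier_mat k k"
    "\<And>g. g \<in> carrier G \<Longrightarrow> \<rho> g * M = M * \<sigma> g" by metis
  have "representation G k \<sigma>"
  proof (rule representationI)
    fix g h assume g: "g \<in> carrier G" and h: "h \<in> carrier G"
    have "M * \<sigma> (g \<otimes> h) = \<rho> (g \<otimes> h) * M" using \<sigma> g h by simp
    also have "\<dots> = \<rho> g * (\<rho> h * M)"
      using g h M rep_mult by (simp add: assoc_mult_mat[of _ d d _ d _ k])
    also have "\<dots> = \<rho> g * (M * \<sigma> h)" using \<sigma> h by simp
    also have "\<dots> = (\<rho> g * M) * \<sigma> h"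
      using g h M \<sigma> by (intro assoc_mult_mat[symmetric, of _ d d _ k _ k]) auto
    also have "\<dots> = (M * \<sigma> g) * \<sigma> h" using \<sigma> g by simp
    also have "\<dots> = M * (\<sigma> g * \<sigma> h)"
      using g h M \<sigma> by (intro assoc_mult_mat[of _ d k _ k _ k]) auto
    finally show "\<sigma> (g \<otimes> h) = \<sigma> g * \<sigma> h"
      by (rule mult_left_cancel_inj_mat[OF M inj \<sigma>(1)[OF m_closed[OF g h]]
            mult_carrier_mat[OF \<sigma>(1)[OF g] \<sigma>(1)[OF h]]])
  next
    have "M * \<sigma> \<one> = M * 1\<^sub>m k" using \<sigma>(2)[of \<one>] M by simp
    then show "\<sigma> \<one> = 1\<^sub>m k"
      by (rule mult_left_cancel_inj_mat[OF M inj \<sigma>(1)[OF one_closed] one_carrier_mat])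
  qed (use \<sigma> in auto)
  moreover have "U = {0\<^sub>v k} \<or> U = carrier_vec k"
    if U: "VectorSpace.subspace class_ring U (module_vec TYPE(complex) k)"
      and Uinv: "\<forall>g\<in>carrier G. \<forall>w\<in>U. \<sigma> g *\<^sub>v w \<in> U" for U
  proof -
    \<comment> \<open>A basis matrix \<open>B\<close> of an invariant \<open>U\<close> yields the
      basis matrix \<open>M * B\<close> of an invariant subspace of \<open>W\<close> of dimension
      \<open>k'\<close>; minimality of \<open>k\<close> leaves only \<open>k' = 0\<close> and
      \<open>k' = k\<close>.\<close>
    obtain k' B where B: "k' \<le> k" "B \<in> carrier_mat k k'" "inj_on ((*\<^sub>v) B) (carrier_vec k')"
      "U = (*\<^sub>v) B ` carrier_vec k'" "k' = k \<Longrightarrow> U = carrier_vec k"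
      using subspace_basis_mat[OF U] by metis
    have MB: "(M * B) *\<^sub>v v = M *\<^sub>v (B *\<^sub>v v)" if "v \<in> carrier_vec k'" for v
      using assoc_mult_mat_vec[OF M B(2) that] .
    have MBc: "M * B \<in> carrier_mat d k'" using M B by auto
    have MBinj: "inj_on ((*\<^sub>v) (M * B)) (carrier_vec k')"
      using inj B(2,3) by (auto simp: inj_on_def MB)
    have MBW: "(*\<^sub>v) (M * B) ` carrier_vec k' \<subseteq> W" using MW B(2) by (auto simp: MB)
    have MBinv: "\<rho> g *\<^sub>v ((M * B) *\<^sub>v v) \<in> (*\<^sub>v) (M * B) ` carrier_vec k'"
      if g: "g \<in> carrier G" and v: "v \<in> carrier_vec k'" for g v
    proof -
      have Bv: "B *\<^sub>v v \<in> carrier_vec k" using B v by auto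
      have "\<rho> g *\<^sub>v ((M * B) *\<^sub>v v) = (\<rho> g * M) *\<^sub>v (B *\<^sub>v v)"
        using assoc_mult_mat_vec[OF rep_carrier[OF g] M Bv] MB[OF v] by simp
      also have "\<dots> = M *\<^sub>v (\<sigma> g *\<^sub>v (B *\<^sub>v v))"
        using assoc_mult_mat_vec[OF M \<sigma>(1)[OF g] Bv] \<sigma>(2)[OF g] by simp
      finally have eq: "\<rho> g *\<^sub>v ((M * B) *\<^sub>v v) = M *\<^sub>v (\<sigma> g *\<^sub>v (B *\<^sub>v v))" .
      have "\<sigma> g *\<^sub>v (B *\<^sub>v v) \<in> U" using Uinv g v B(4) by auto
      then obtain w where w: "w \<in> carrier_vec k'" "\<sigma> g *\<^sub>v (B *\<^sub>v v) = B *\<^sub>v w" using B(4) by auto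
      then show ?thesis using eq MB by auto
    qed
    show ?thesis
    proof (cases "k' = 0")
      case True
      then have "U = {B *\<^sub>v 0\<^sub>v 0}" unfolding B(4) by (simp add: True carrier_vec_0)
      moreover have "B *\<^sub>v 0\<^sub>v 0 = 0\<^sub>v k" using B(2) True by (auto simp: scalar_prod_def)
      ultimately show ?thesis by simp
    next
      case False
      then have "P k'" unfolding P_def using MBc MBinj MBW MBinv by (intro conjI bexI[of _ "M * B"] ballI) simp_all
      then show ?thesis using least B(1,5) by force
    qed
  qed
  ultimately have "irreducible_representation G k \<sigma>"
    using k by (auto simp: irreducible_representation_def)
  then show ?thesis by (rule that[OF _ M inj MW \<sigma>(2)])
qed

end

locale irrep = fin_group G for G (structure) +
  fixes d :: nat and \<rho>
  assumes irrep: "irreducible_representation G d \<rho>"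

sublocale irrep \<subseteq> matrix_rep
  using irrep by unfold_locales (auto simp: irreducible_representation_def)

context irrep
begin

lemma deg_pos: "d > 0"
  using irrep by (auto simp: irreducible_representation_def)

lemma invariant_subspace:
  assumes "VectorSpace.subspace class_ring W (module_vec TYPE(complex) d)"
    and "\<And>g w. g \<in> carrier G \<Longrightarrow> w \<in> W \<Longrightarrow> \<rho> g *\<^sub>v w \<in> W"
  shows "W = {0\<^sub>v d} \<or> W = carrier_vec d"
  using irrep assms by (auto simp: irreducible_representation_def)

text \<open>An eigenspace of \<open>A\<close> is invariant because \<open>A\<close> commutes with
  the representation, and it is nonzero, so it is the whole space. An eigenvalue exists over the
  complex numbers since \<open>d > 0\<close>.\<close>

lemma schur:
  assumes A: "A \<in> carrier_mat d d"
    and comm: "\<And>g. g \<in> carrier G \<Longrightarrow> A * \<rho> g = \<rho> g * A"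
  obtains \<alpha> where "A = \<alpha> \<cdot>\<^sub>m 1\<^sub>m d"
proof -
  obtain \<alpha> v where "eigenvector A v \<alpha>"
    using spectrum_non_empty[OF A deg_pos] by (auto simp: spectrum_def eigenvalue_def)
  then have v: "v \<in> carrier_vec d" "v \<noteq> 0\<^sub>v d" "A *\<^sub>v v = \<alpha> \<cdot>\<^sub>v v"
    using A by (auto simp: eigenvector_def)
  define W where "W = {w \<in> carrier_vec d. A *\<^sub>v w = \<alpha> \<cdot>\<^sub>v w}"
  have "W = {0\<^sub>v d} \<or> W = carrier_vec d"
  proof (rule invariant_subspace)
    show "VectorSpace.subspace class_ring W (module_vec TYPE(complex) d)"
      unfolding subspace_class_ring_iff W_def using A
      by (auto simp: mult_add_distrib_mat_vec smult_add_distrib_vec mult_mat_vec smult_smult_assoc mult.commute)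
  next
    fix g w assume g: "g \<in> carrier G" and "w \<in> W"
    then have w: "w \<in> carrier_vec d" "A *\<^sub>v w = \<alpha> \<cdot>\<^sub>v w" by (auto simp: W_def)
    have "A *\<^sub>v (\<rho> g *\<^sub>v w) = (A * \<rho> g) *\<^sub>v w"
      using A g w by (simp add: assoc_mult_mat_vec[OF A rep_carrier])
    also have "\<dots> = \<rho> g *\<^sub>v (A *\<^sub>v w)"
      using A g w by (simp add: comm assoc_mult_mat_vec[OF rep_carrier A])
    also have "\<dots> = \<alpha> \<cdot>\<^sub>v (\<rho> g *\<^sub>v w)"
      using g w by (simp add: mult_mat_vec[OF rep_carrier])
    finally show "\<rho> g *\<^sub>v w \<in> W" using g w by (auto simp: W_def intro: mult_mat_vec_carrier[OF rep_carrier])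
  qed
  then have "W = carrier_vec d" using v by (auto simp: W_def)
  then have "A = \<alpha> \<cdot>\<^sub>m 1\<^sub>m d"
    using A by (intro eq_mat_by_vecs[OF A]) (auto simp: W_def scalar_mat_mult_vec)
  then show ?thesis using that by blast
qed

text \<open>By Schur's lemma the sum of \<open>\<rho>\<close> over \<open>N\<close> is a scalar matrix, and its trace shows that the scalar is
  not zero.\<close>

lemma kernel_from_trace:
  assumes N: "subgroup N G" and normal: "\<And>g x. g \<in> carrier G \<Longrightarrow> x \<in> N \<Longrightarrow> g \<otimes> x \<otimes> inv g \<in> N"
    and tr: "\<And>x. x \<in> N \<Longrightarrow> mat_trace (\<rho> x) = of_nat d"
    and x: "x \<in> N"
  shows "\<rho> x = 1\<^sub>m d"
proof -
  have Nc: "y \<in> carrier G" if "y \<in> N" for y using subgroup.mem_carrier[OF N that] .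
  have finN: "finite N" using Nc finite_carrier by (meson finite_subset subsetI)
  define P where "P = msum d \<rho> N"
  have P: "P \<in> carrier_mat d d" by (simp add: P_def)
  have "P * \<rho> g = \<rho> g * P" if g: "g \<in> carrier G" for g
  proof -
    have "bij_betw (\<lambda>x. g \<otimes> x \<otimes> inv g) N N"
    proof -
      have inj: "inj_on (\<lambda>x. g \<otimes> x \<otimes> inv g) N"
        using g Nc by (auto intro!: inj_onI)
      moreover have "(\<lambda>x. g \<otimes> x \<otimes> inv g) ` N = N"
        by (rule endo_inj_surj[OF finN _ inj]) (use normal g in auto)
      ultimately show ?thesis by (simp add: bij_betw_def)
    qed
    then have "P * \<rho> g = msum d (\<lambda>x. \<rho> (g \<otimes> x \<otimes> inv g)) N * \<rho> g"
      unfolding P_def by (subst msum_reindex) auto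
    also have "\<dots> = msum d (\<lambda>x. \<rho> (g \<otimes> x \<otimes> inv g) * \<rho> g) N"
      using g Nc by (intro msum_mult) auto
    also have "\<dots> = msum d (\<lambda>x. \<rho> g * \<rho> x) N"
      using g Nc by (intro msum_cong) (simp add: rep_mult[symmetric] m_assoc)
    also have "\<dots> = \<rho> g * P"
      unfolding P_def using g Nc by (intro mult_msum[symmetric]) auto
    finally show ?thesis .
  qed
  then obtain \<alpha> where \<alpha>: "P = \<alpha> \<cdot>\<^sub>m 1\<^sub>m d" using schur[OF P] by blast
  have "\<alpha> * of_nat d = mat_trace P" unfolding \<alpha> by (subst mat_trace_smult[of _ d]) (auto simp: mat_trace_one)
  also have "\<dots> = of_nat (card N) * of_nat d"
    unfolding P_def using Nc tr by (subst mat_trace_msum) auto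
  finally have \<alpha>0: "\<alpha> \<noteq> 0" using deg_pos finN x by auto
  \<comment> \<open>Left translation by \<open>x\<close> permutes \<open>N\<close>, so
    \<open>\<rho> x\<close> fixes the nonzero scalar matrix \<open>P\<close> and must be the
    identity.\<close>
  have "\<rho> x * P = msum d (\<lambda>y. \<rho> (x \<otimes> y)) N"
    unfolding P_def using Nc x by (subst mult_msum) (auto simp: rep_mult intro!: msum_cong)
  also have "\<dots> = P"
  proof -
    have inj: "inj_on ((\<otimes>) x) N" using Nc x by (auto intro!: inj_onI)
    then have "bij_betw ((\<otimes>) x) N N"
      using endo_inj_surj[OF finN _ inj] subgroup.m_closed[OF N x] by (auto simp: bij_betw_def)
    then show ?thesis unfolding P_def by (subst (2) msum_reindex) auto
  qed
  finally have "\<alpha> \<cdot>\<^sub>m \<rho> x = \<alpha> \<cdot>\<^sub>m 1\<^sub>m d"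
    unfolding \<alpha> using Nc[OF x] by (simp add: mult_smult_distrib[of _ d d _ d])
  then have eq: "(\<alpha> \<cdot>\<^sub>m \<rho> x) $$ (i, j) = (\<alpha> \<cdot>\<^sub>m 1\<^sub>m d) $$ (i, j)" for i j by simp
  then have "\<rho> x $$ (i, j) = 1\<^sub>m d $$ (i, j)" if "i < d" "j < d" for i j
  proof -
    have "\<alpha> * \<rho> x $$ (i, j) = \<alpha> * 1\<^sub>m d $$ (i, j)"
      using eq[of i j] that Nc[OF x] by (simp only: index_smult_mat rep_dim index_one_mat)
    then show ?thesis using \<alpha>0 by simp
  qed
  then show ?thesis using Nc[OF x] by (intro eq_matI) auto
qed

text \<open>Schur's lemma for the averages of the conjugates of the elementary matrices \<open>E\<close>.\<close>

lemma character_norm: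
  "(\<Sum>g\<in>carrier G. mat_trace (\<rho> g) * mat_trace (\<rho> (inv g))) = of_nat (card (carrier G))"
proof -
  have entry: "(\<Sum>g\<in>carrier G. \<rho> g $$ (i,i) * \<rho> (inv g) $$ (j,j))
      = (if i = j then of_nat (card (carrier G)) / of_nat d else 0)" if ij: "i < d" "j < d" for i j
  proof -
    define E :: "complex mat" where "E = mat d d (\<lambda>(k,l). if k = i \<and> l = j then 1 else 0)"
    have E: "E \<in> carrier_mat d d" by (simp add: E_def)
    \<comment> \<open>The \<open>(i, j)\<close> entry of \<open>M\<close> is the wanted sum. Schur's
      lemma makes \<open>M\<close> scalar, and its trace is \<open>card (carrier G)\<close> times
      the trace of \<open>E\<close>, which is 1 for \<open>i = j\<close> and 0 otherwise.\<close>
    define M where "M = msum d (\<lambda>g. \<rho> g * E * \<rho> (inv g)) (carrier G)"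
    have M: "M \<in> carrier_mat d d" by (simp add: M_def)
    have "M * \<rho> h = \<rho> h * M" if h: "h \<in> carrier G" for h
    proof -
      have "bij_betw ((\<otimes>) h) (carrier G) (carrier G)"
        using h by (intro bij_betwI[where g="(\<otimes>) (inv h)"]) (auto simp: m_assoc[symmetric])
      then have "M * \<rho> h = msum d (\<lambda>g. \<rho> (h \<otimes> g) * E * \<rho> (inv (h \<otimes> g))) (carrier G) * \<rho> h"
        unfolding M_def by (subst msum_reindex) auto
      also have "\<dots> = msum d (\<lambda>g. \<rho> (h \<otimes> g) * E * \<rho> (inv (h \<otimes> g)) * \<rho> h) (carrier G)"
        using h E by (intro msum_mult) (auto intro!: mult_carrier_mat)
      also have "\<dots> = msum d (\<lambda>g. \<rho> h * (\<rho> g * E * \<rho> (inv g))) (carrier G)"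
      proof (rule msum_cong)
        fix g assume g: "g \<in> carrier G"
        have "\<rho> (h \<otimes> g) * E * \<rho> (inv (h \<otimes> g)) * \<rho> h = \<rho> (h \<otimes> g) * E * (\<rho> (inv (h \<otimes> g)) * \<rho> h)"
          using g h E by (intro assoc_mult_mat[of _ d d _ d _ d]) (auto intro!: mult_carrier_mat)
        also have "\<rho> (inv (h \<otimes> g)) * \<rho> h = \<rho> (inv g)"
          using g h by (simp add: rep_mult[symmetric] inv_mult_group m_assoc)
        also have "\<rho> (h \<otimes> g) * E * \<rho> (inv g) = \<rho> h * (\<rho> g * E * \<rho> (inv g))"
          using g h E by (simp add: rep_mult assoc_mult_mat[of _ d d _ d _ d] mult_carrier_mat[of _ d d _ d])
        finally show "\<rho> (h \<otimes> g) * E * \<rho> (inv (h \<otimes> g)) * \<rho> h = \<rho> h * (\<rho> g * E * \<rho> (inv g))" .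
      qed
      also have "\<dots> = \<rho> h * M"
        unfolding M_def using h E by (intro mult_msum[symmetric]) (auto intro!: mult_carrier_mat)
      finally show ?thesis .
    qed
    then obtain \<alpha> where \<alpha>: "M = \<alpha> \<cdot>\<^sub>m 1\<^sub>m d" using schur[OF M] by blast
    have "\<alpha> * of_nat d = mat_trace M" unfolding \<alpha> by (subst mat_trace_smult[of _ d]) (auto simp: mat_trace_one)
    also have "\<dots> = (\<Sum>g\<in>carrier G. mat_trace (\<rho> g * E * \<rho> (inv g)))"
      unfolding M_def using E by (intro mat_trace_msum) (auto intro!: mult_carrier_mat)
    also have "\<dots> = of_nat (card (carrier G)) * mat_trace E"
      using E by (simp add: trace_conj)
    also have "mat_trace E = (if i = j then 1 else 0)"
      using ij by (auto simp: mat_trace_def E_def if_distrib cong: if_cong intro!: sum.neutral)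
    finally have al: "\<alpha> = (if i = j then of_nat (card (carrier G)) / of_nat d else 0)"
      using deg_pos by (auto simp: field_simps split: if_splits)
    have "(\<Sum>g\<in>carrier G. \<rho> g $$ (i,i) * \<rho> (inv g) $$ (j,j)) = M $$ (i, j)"
    proof -
      have "(\<rho> g * E * \<rho> (inv g)) $$ (i, j) = \<rho> g $$ (i,i) * \<rho> (inv g) $$ (j,j)" if g: "g \<in> carrier G" for g
      proof -
        have RE: "(\<rho> g * E) $$ (i, l) = (if l = j then \<rho> g $$ (i, i) else 0)" if "l < d" for l
        proof -
          have "(\<rho> g * E) $$ (i, l) = (\<Sum>k<d. \<rho> g $$ (i, k) * (if k = i \<and> l = j then 1 else 0))"
            using ij g that E by (simp add: scalar_prod_def atLeast0LessThan E_def)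
          also have "\<dots> = (\<Sum>k<d. if k = i then (if l = j then \<rho> g $$ (i, i) else 0) else 0)"
            by (rule sum.cong) auto
          finally show ?thesis using ij by simp
        qed
        have "(\<rho> g * E * \<rho> (inv g)) $$ (i, j) = (\<Sum>l<d. (\<rho> g * E) $$ (i, l) * \<rho> (inv g) $$ (l, j))"
          using ij g E by (auto simp: scalar_prod_def atLeast0LessThan intro!: sum.cong)
        also have "\<dots> = (\<Sum>l<d. if l = j then \<rho> g $$ (i,i) * \<rho> (inv g) $$ (l,j) else 0)"
          by (intro sum.cong) (auto simp: RE)
        finally show ?thesis using ij by simp
      qed
      then show ?thesis using ij by (simp add: M_def index_msum)
    qed
    then show ?thesis using al \<alpha> ij by simp
  qed
  have "(\<Sum>g\<in>carrier G. mat_trace (\<rho> g) * mat_trace (\<rho> (inv g)))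
      = (\<Sum>g\<in>carrier G. \<Sum>i<d. \<Sum>j<d. \<rho> g $$ (i,i) * \<rho> (inv g) $$ (j,j))"
    by (simp add: mat_trace_def sum_product)
  also have "\<dots> = (\<Sum>i<d. \<Sum>g\<in>carrier G. \<Sum>j<d. \<rho> g $$ (i,i) * \<rho> (inv g) $$ (j,j))"
    by (rule sum.swap)
  also have "\<dots> = (\<Sum>i<d. \<Sum>j<d. \<Sum>g\<in>carrier G. \<rho> g $$ (i,i) * \<rho> (inv g) $$ (j,j))"
    by (intro sum.cong refl sum.swap)
  also have "\<dots> = (\<Sum>i<d. \<Sum>j<d. if i = j then of_nat (card (carrier G)) / of_nat d else 0)"
    by (intro sum.cong refl) (auto simp: entry)
  also have "\<dots> = of_nat (card (carrier G))" using deg_pos by simp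
  finally show ?thesis .
qed

text \<open>Conjugating by \<open>h\<close> multiplies \<open>\<rho> g\<close> by \<omega> but does
  not change its trace.\<close>

lemma trace_zero_if_commute_up_to_scalar:
  assumes g: "g \<in> carrier G" and h: "h \<in> carrier G"
    and eq: "\<rho> (g \<otimes> h) = \<omega> \<cdot>\<^sub>m \<rho> (h \<otimes> g)" and \<omega>: "\<omega> \<noteq> 1"
  shows "mat_trace (\<rho> g) = 0"
proof -
  have "mat_trace (\<rho> g) = mat_trace (\<rho> (inv h) * \<rho> g * \<rho> (inv (inv h)))"
    using g h by (subst trace_conj) auto
  also have "\<rho> (inv h) * \<rho> g * \<rho> (inv (inv h)) = \<rho> (inv h) * \<rho> (g \<otimes> h)"
    using g h by (simp add: rep_mult assoc_mult_mat[of _ d d _ d _ d])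
  also have "\<dots> = \<omega> \<cdot>\<^sub>m (\<rho> (inv h) * \<rho> (h \<otimes> g))"
    unfolding eq using g h by (intro mult_smult_distrib) auto
  also have "\<rho> (inv h) * \<rho> (h \<otimes> g) = \<rho> g"
    using g h by (simp add: rep_mult[symmetric] m_assoc[symmetric])
  also have "mat_trace (\<omega> \<cdot>\<^sub>m \<rho> g) = \<omega> * mat_trace (\<rho> g)"
    using g by (intro mat_trace_smult) auto
  finally show ?thesis using \<omega> by simp
qed

lemma commuting_scalar:
  assumes g: "g \<in> carrier G" and comm: "\<And>h. h \<in> carrier G \<Longrightarrow> \<rho> (g \<otimes> h) = \<rho> (h \<otimes> g)"
  shows "\<rho> g = (mat_trace (\<rho> g) / of_nat d) \<cdot>\<^sub>m 1\<^sub>m d"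
proof -
  have "\<rho> g * \<rho> h = \<rho> h * \<rho> g" if "h \<in> carrier G" for h
    using comm[OF that] g that by (simp add: rep_mult)
  then obtain \<alpha> where \<alpha>: "\<rho> g = \<alpha> \<cdot>\<^sub>m 1\<^sub>m d" using schur[OF rep_carrier[OF g]] by blast
  then have "mat_trace (\<rho> g) = \<alpha> * of_nat d"
    by (simp add: mat_trace_smult[of _ d] mat_trace_one)
  then show ?thesis using \<alpha> deg_pos by simp
qed

text \<open>By Schur's lemma these are the elements that act as scalars. Commutation is used as the
  defining property because it can be tested on commutator scalars.\<close>

definition scalar_part :: "'a set" where
  "scalar_part = {g \<in> carrier G. \<forall>h\<in>carrier G. \<rho> (g \<otimes> h) = \<rho> (h \<otimes> g)}"

text \<open>When all commutators act as scalars, traces vanish off \<open>scalar_part\<close>, while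
  each of its elements contributes \<open>(\<alpha> * d) * (d / \<alpha>) = d^2\<close> to
  \<open>character_norm\<close>.\<close>

lemma degree_sq:
  assumes "\<And>g h. g \<in> carrier G \<Longrightarrow> h \<in> carrier G \<Longrightarrow> \<exists>\<omega>. \<rho> (g \<otimes> h) = \<omega> \<cdot>\<^sub>m \<rho> (h \<otimes> g)"
  shows "\<And>g. g \<in> carrier G \<Longrightarrow> g \<notin> scalar_part \<Longrightarrow> mat_trace (\<rho> g) = 0"
    and "d^2 * card scalar_part = card (carrier G)"
proof -
  show zero: "mat_trace (\<rho> g) = 0" if g: "g \<in> carrier G" and "g \<notin> scalar_part" for g
  proof -
    obtain h where h: "h \<in> carrier G" "\<rho> (g \<otimes> h) \<noteq> \<rho> (h \<otimes> g)"
      using g \<open>g \<notin> scalar_part\<close> by (auto simp: scalar_part_def)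
    obtain \<omega> where \<omega>: "\<rho> (g \<otimes> h) = \<omega> \<cdot>\<^sub>m \<rho> (h \<otimes> g)" using assms[OF g h(1)] by blast
    then have "\<omega> \<noteq> 1" using h by auto
    then show ?thesis using trace_zero_if_commute_up_to_scalar[OF g h(1) \<omega>] by simp
  qed
  have sub: "scalar_part \<subseteq> carrier G" by (auto simp: scalar_part_def)
  have prod: "mat_trace (\<rho> g) * mat_trace (\<rho> (inv g)) = of_nat (d^2)" if "g \<in> scalar_part" for g
  proof -
    have g: "g \<in> carrier G" using that sub by auto
    define \<alpha> where "\<alpha> = mat_trace (\<rho> g) / of_nat d"
    have \<alpha>: "\<rho> g = \<alpha> \<cdot>\<^sub>m 1\<^sub>m d"
      unfolding \<alpha>_def using that by (intro commuting_scalar) (auto simp: scalar_part_def)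
    have "1\<^sub>m d = \<alpha> \<cdot>\<^sub>m \<rho> (inv g)"
      using rep_inv(2)[OF g] g unfolding \<alpha> by (simp add: mult_smult_assoc_mat[of _ d d _ d])
    then have "of_nat d = \<alpha> * mat_trace (\<rho> (inv g))"
      using mat_trace_one[of d, where ?'a=complex] g mat_trace_smult[of "\<rho> (inv g)" d \<alpha>] by simp
    moreover have "mat_trace (\<rho> g) = \<alpha> * of_nat d" using deg_pos by (simp add: \<alpha>_def)
    ultimately show ?thesis by (simp add: power2_eq_square)
  qed
  have "of_nat (card (carrier G)) = (\<Sum>g\<in>carrier G. mat_trace (\<rho> g) * mat_trace (\<rho> (inv g)))"
    by (rule character_norm[symmetric])
  also have "\<dots> = (\<Sum>g\<in>scalar_part. mat_trace (\<rho> g) * mat_trace (\<rho> (inv g)))"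
    using sub by (intro sum.mono_neutral_right) (auto simp: zero)
  also have "\<dots> = of_nat (d^2 * card scalar_part)" by (simp add: prod)
  finally show "d^2 * card scalar_part = card (carrier G)" by (metis of_nat_eq_iff)
qed

end

hide_const (open) Polynomial.order

section \<open>The regular representation as a source of irreducible representations\<close>

context fin_group
begin

definition enum :: "nat \<Rightarrow> 'a" where
  "enum = (SOME e. bij_betw e {..<order G} (carrier G))"

lemma enum_bij: "bij_betw enum {..<order G} (carrier G)"
proof -
  have "\<exists>e. bij_betw e {..<order G} (carrier G)"
    using ex_bij_betw_nat_finite[OF finite_carrier] by (simp add: Coset.order_def atLeast0LessThan)
  then show ?thesis unfolding enum_def by (rule someI_ex)
qed

lemma enum_in [simp]: "i < order G \<Longrightarrow> enum i \<in> carrier G"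
  using enum_bij by (auto simp: bij_betw_def)

lemma sum_enum: "(\<Sum>i<order G. f (enum i)) = (\<Sum>x\<in>carrier G. f x)"
  using sum.reindex_bij_betw[OF enum_bij] .

definition regular :: "'a \<Rightarrow> complex mat" where
  "regular g = mat (order G) (order G) (\<lambda>(i, j). if enum i = g \<otimes> enum j then 1 else 0)"

text \<open>Vectors of the regular representation are read as functions on the group, on which
  \<open>g\<close> acts by translation, so that later arguments do not see the enumeration.\<close>

definition fun_vec :: "('a \<Rightarrow> complex) \<Rightarrow> complex vec" where
  "fun_vec f = vec (order G) (\<lambda>i. f (enum i))"

lemma regular_carrier [simp]: "regular g \<in> carrier_mat (order G) (order G)"
  by (simp add: regular_def)

lemma fun_vec_carrier [simp]: "fun_vec f \<in> carrier_vec (order G)"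
  by (simp add: fun_vec_def)

lemma fun_vec_eq_iff: "fun_vec f = fun_vec f' \<longleftrightarrow> (\<forall>x\<in>carrier G. f x = f' x)"
proof -
  have "fun_vec f = fun_vec f' \<longleftrightarrow> (\<forall>i<order G. f (enum i) = f' (enum i))"
    by (auto simp: fun_vec_def vec_eq_iff)
  also have "\<dots> \<longleftrightarrow> (\<forall>x\<in>carrier G. f x = f' x)"
  proof -
    have "carrier G = enum ` {..<order G}" using enum_bij by (simp add: bij_betw_def)
    then show ?thesis by (metis (mono_tags, lifting) enum_in image_iff lessThan_iff)
  qed
  finally show ?thesis .
qed

lemma fun_vec_surj:
  assumes "v \<in> carrier_vec (order G)"
  obtains f where "v = fun_vec f"
proof
  show "v = fun_vec (\<lambda>x. v $ (inv_into {..<order G} enum x))"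
    using assms enum_bij by (intro eq_vecI) (auto simp: fun_vec_def bij_betw_def)
qed

lemma zero_fun_vec: "0\<^sub>v (order G) = fun_vec (\<lambda>_. 0)"
  by (auto simp: fun_vec_def)

lemma smult_fun_vec: "c \<cdot>\<^sub>v fun_vec f = fun_vec (\<lambda>x. c * f x)"
  by (auto simp: fun_vec_def)

lemma regular_mult_fun_vec:
  assumes g: "g \<in> carrier G"
  shows "regular g *\<^sub>v fun_vec f = fun_vec (\<lambda>x. f (inv g \<otimes> x))"
proof (rule eq_vecI)
  fix i assume "i < dim_vec (fun_vec (\<lambda>x. f (inv g \<otimes> x)))"
  then have i: "i < order G" by (simp add: fun_vec_def)
  have "(regular g *\<^sub>v fun_vec f) $ i = (\<Sum>j<order G. (if enum i = g \<otimes> enum j then 1 else 0) * f (enum j))"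
    using i by (simp add: regular_def fun_vec_def scalar_prod_def atLeast0LessThan)
  also have "\<dots> = (\<Sum>y\<in>carrier G. (if enum i = g \<otimes> y then 1 else 0) * f y)" by (rule sum_enum)
  also have "\<dots> = (\<Sum>y\<in>carrier G. if y = inv g \<otimes> enum i then f y else 0)"
    using g i by (intro sum.cong refl) (auto simp: m_assoc[symmetric])
  also have "\<dots> = f (inv g \<otimes> enum i)" using g i by simp
  finally show "(regular g *\<^sub>v fun_vec f) $ i = fun_vec (\<lambda>x. f (inv g \<otimes> x)) $ i"
    using i by (simp add: fun_vec_def)
qed (simp add: regular_def fun_vec_def)

lemma eq_mat_by_fun_vecs:
  assumes "A \<in> carrier_mat (order G) (order G)" "B \<in> carrier_mat (order G) (order G)"
    and "\<And>f. A *\<^sub>v fun_vec f = B *\<^sub>v fun_vec f"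
  shows "A = B"
proof (rule eq_mat_by_vecs[OF assms(1,2)])
  fix v :: "complex vec" assume "v \<in> carrier_vec (order G)"
  then obtain f where "v = fun_vec f" by (rule fun_vec_surj)
  then show "A *\<^sub>v v = B *\<^sub>v v" by (simp add: assms(3))
qed

lemma regular_rep: "representation G (order G) regular"
proof (rule representationI)
  fix g h assume g: "g \<in> carrier G" and h: "h \<in> carrier G"
  show "regular (g \<otimes> h) = regular g * regular h"
    using g h by (intro eq_mat_by_fun_vecs mult_carrier_mat[OF regular_carrier regular_carrier] regular_carrier)
      (auto simp: assoc_mult_mat_vec[of _ "order G" "order G" _ "order G"] regular_mult_fun_vec
        fun_vec_eq_iff inv_mult_group m_assoc)
next
  show "regular \<one> = 1\<^sub>m (order G)"
    by (intro eq_mat_by_fun_vecs) (auto simp: regular_mult_fun_vec fun_vec_eq_iff)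
qed auto

sublocale regular: matrix_rep G "order G" regular
  by unfold_locales (rule regular_rep)

text \<open>This replaces inducing \<psi> from \<open>Z\<close>. The vectors of the regular
  representation on which \<open>Z\<close> acts through \<psi> form an invariant subspace, because
  \<psi> is unchanged by conjugation; any irreducible constituent of it inherits the scalar
  action.\<close>

lemma irreducible_with_central_character:
  assumes Z: "subgroup Z G" and normal: "\<And>g x. g \<in> carrier G \<Longrightarrow> x \<in> Z \<Longrightarrow> inv g \<otimes> x \<otimes> g \<in> Z"
    and mult: "\<And>x y. x \<in> Z \<Longrightarrow> y \<in> Z \<Longrightarrow> \<psi> (x \<otimes> y) = \<psi> x * \<psi> y" and one: "\<psi> \<one> = 1"
    and inv: "\<And>g x. g \<in> carrier G \<Longrightarrow> x \<in> Z \<Longrightarrow> \<psi> (inv g \<otimes> x \<otimes> g) = \<psi> x"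
  obtains d \<sigma> where "irreducible_representation G d \<sigma>" "\<And>x. x \<in> Z \<Longrightarrow> \<sigma> x = \<psi> x \<cdot>\<^sub>m 1\<^sub>m d"
proof -
  have Zc [simp]: "x \<in> carrier G" if "x \<in> Z" for x using subgroup.mem_carrier[OF Z that] .
  define W where "W = {v \<in> carrier_vec (order G). \<forall>x\<in>Z. regular x *\<^sub>v v = \<psi> x \<cdot>\<^sub>v v}"
  have W: "VectorSpace.subspace class_ring W (module_vec TYPE(complex) (order G))"
    unfolding subspace_class_ring_iff W_def
    by (auto simp: mult_add_distrib_mat_vec[OF regular_carrier] smult_add_distrib_vec
        mult_mat_vec[OF regular_carrier] smult_smult_assoc mult.commute)
  have "regular g *\<^sub>v w \<in> W" if g: "g \<in> carrier G" and w: "w \<in> W" for g w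
  proof -
    have wc: "w \<in> carrier_vec (order G)" and wx: "\<And>x. x \<in> Z \<Longrightarrow> regular x *\<^sub>v w = \<psi> x \<cdot>\<^sub>v w"
      using w by (auto simp: W_def)
    have "regular x *\<^sub>v (regular g *\<^sub>v w) = \<psi> x \<cdot>\<^sub>v (regular g *\<^sub>v w)" if x: "x \<in> Z" for x
    proof -
      have "regular x *\<^sub>v (regular g *\<^sub>v w) = regular (x \<otimes> g) *\<^sub>v w"
        using g x wc by (simp add: regular.rep_mult assoc_mult_mat_vec[of _ "order G" "order G" _ "order G"])
      also have "x \<otimes> g = g \<otimes> (inv g \<otimes> x \<otimes> g)" using g x by (simp add: m_assoc[symmetric])
      also have "regular \<dots> *\<^sub>v w = regular g *\<^sub>v (regular (inv g \<otimes> x \<otimes> g) *\<^sub>v w)"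
        using g x wc by (simp add: regular.rep_mult[of g] assoc_mult_mat_vec[of _ "order G" "order G" _ "order G"])
      also have "\<dots> = \<psi> x \<cdot>\<^sub>v (regular g *\<^sub>v w)"
        using g x wc by (simp add: wx normal inv mult_mat_vec[OF regular_carrier])
      finally show ?thesis .
    qed
    then show ?thesis using wc by (auto simp: W_def intro: mult_mat_vec_carrier[OF regular_carrier])
  qed
  then have Winv: "\<forall>g\<in>carrier G. \<forall>w\<in>W. regular g *\<^sub>v w \<in> W" by blast
  have "W \<noteq> {0\<^sub>v (order G)}"
  proof -
    \<comment> \<open>The value at \<open>inv x\<close> is forced: left translation by
      \<open>x\<close> has to multiply the function by \<open>\<psi> x\<close>.\<close>
    define f where "f x = (if x \<in> Z then \<psi> (inv x) else 0)" for x
    have Zi: "inv x \<in> Z" if "x \<in> Z" for x using subgroup.m_inv_closed[OF Z that] .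
    have "f (inv x \<otimes> y) = \<psi> x * f y" if x: "x \<in> Z" and y: "y \<in> carrier G" for x y
    proof (cases "y \<in> Z")
      case True
      have "inv (inv x \<otimes> y) = inv y \<otimes> x" using x True by (simp add: inv_mult_group)
      then show ?thesis using x True Zi
        by (simp add: f_def subgroup.m_closed[OF Z] mult mult.commute)
    next
      case False
      have "inv x \<otimes> y \<notin> Z"
      proof
        assume "inv x \<otimes> y \<in> Z"
        then have "x \<otimes> (inv x \<otimes> y) \<in> Z" by (rule subgroup.m_closed[OF Z x])
        then show False using False x y by (simp add: m_assoc[symmetric])
      qed
      then show ?thesis using False by (simp add: f_def)
    qed
    then have "fun_vec f \<in> W"
      by (auto simp: W_def regular_mult_fun_vec smult_fun_vec fun_vec_eq_iff)
    moreover have "fun_vec f \<noteq> 0\<^sub>v (order G)"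
    proof
      assume "fun_vec f = 0\<^sub>v (order G)"
      then have "f \<one> = 0" unfolding zero_fun_vec fun_vec_eq_iff by (rule bspec[OF _ one_closed])
      then show False using subgroup.one_closed[OF Z] one by (simp add: f_def)
    qed
    ultimately show ?thesis by (metis singletonD)
  qed
  then obtain k M \<sigma> where irr: "irreducible_representation G k \<sigma>" and M: "M \<in> carrier_mat (order G) k"
    and inj: "inj_on ((*\<^sub>v) M) (carrier_vec k)" and im: "(*\<^sub>v) M ` carrier_vec k \<subseteq> W"
    and tw: "\<And>g. g \<in> carrier G \<Longrightarrow> regular g * M = M * \<sigma> g"
    by (rule regular.irreducible_constituent[OF W Winv]) (rule that)
  interpret \<sigma>: irrep G k \<sigma> by unfold_locales (rule irr)
  have "\<sigma> x = \<psi> x \<cdot>\<^sub>m 1\<^sub>m k" if x: "x \<in> Z" for x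
  proof (rule mult_left_cancel_inj_mat[OF M inj])
    show "M * \<sigma> x = M * (\<psi> x \<cdot>\<^sub>m 1\<^sub>m k)"
    proof (rule eq_mat_by_vecs[of _ "order G" k])
      fix v :: "complex vec" assume v: "v \<in> carrier_vec k"
      then have Mv: "M *\<^sub>v v \<in> W" by (intro subsetD[OF im] imageI)
      have "(M * \<sigma> x) *\<^sub>v v = regular x *\<^sub>v (M *\<^sub>v v)"
        using tw[of x] x assoc_mult_mat_vec[OF regular_carrier M v, of x] by simp
      also have "\<dots> = \<psi> x \<cdot>\<^sub>v (M *\<^sub>v v)" using Mv x by (simp add: W_def)
      also have "\<dots> = M *\<^sub>v ((\<psi> x \<cdot>\<^sub>m 1\<^sub>m k) *\<^sub>v v)"
        using v by (simp add: scalar_mat_mult_vec mult_mat_vec[OF M])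
      also have "\<dots> = (M * (\<psi> x \<cdot>\<^sub>m 1\<^sub>m k)) *\<^sub>v v"
        by (rule assoc_mult_mat_vec[OF M _ v, symmetric]) simp
      finally show "(M * \<sigma> x) *\<^sub>v v = (M * (\<psi> x \<cdot>\<^sub>m 1\<^sub>m k)) *\<^sub>v v" .
    qed (use M x in \<open>auto intro!: mult_carrier_mat\<close>)
  qed (use x in auto)
  then show ?thesis by (rule that[OF irr])
qed

end

text \<open>An irreducible constituent of the functions with sum zero does the job. It acts by
  scalars since the group is commutative, and it cannot be trivial since a constant function with
  sum zero vanishes.\<close>

lemma (in comm_group) exists_nontrivial_linear_character:
  assumes fin: "finite (carrier G)" and x0: "x0 \<in> carrier G" "x0 \<noteq> \<one>"
  obtains \<psi> :: "'a \<Rightarrow> complex" where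
    "\<And>x y. x \<in> carrier G \<Longrightarrow> y \<in> carrier G \<Longrightarrow> \<psi> (x \<otimes> y) = \<psi> x * \<psi> y"
    "\<psi> \<one> = 1" "\<exists>x\<in>carrier G. \<psi> x \<noteq> 1"
proof -
  interpret fin_group G by unfold_locales (rule fin)
  define W where "W = {v \<in> carrier_vec (order G). (\<Sum>i<order G. v $ i) = (0::complex)}"
  have W: "VectorSpace.subspace class_ring W (module_vec TYPE(complex) (order G))"
    unfolding subspace_class_ring_iff W_def
    by (auto simp: sum.distrib sum_distrib_left[symmetric])
  have fun_vec_W: "fun_vec f \<in> W \<longleftrightarrow> (\<Sum>x\<in>carrier G. f x) = 0" for f
    by (simp add: W_def) (simp add: fun_vec_def sum_enum)
  have "regular g *\<^sub>v w \<in> W" if g: "g \<in> carrier G" and w: "w \<in> W" for g w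
  proof -
    obtain f where f: "w = fun_vec f" using fun_vec_surj[of w] w by (auto simp: W_def)
    have "bij_betw ((\<otimes>) (inv g)) (carrier G) (carrier G)"
      using g by (intro bij_betwI[where g="(\<otimes>) g"]) (auto simp: m_assoc[symmetric])
    then have "(\<Sum>x\<in>carrier G. f (inv g \<otimes> x)) = (\<Sum>x\<in>carrier G. f x)"
      by (rule sum.reindex_bij_betw)
    then show ?thesis using w g by (simp add: f regular_mult_fun_vec fun_vec_W)
  qed
  then have Winv: "\<forall>g\<in>carrier G. \<forall>w\<in>W. regular g *\<^sub>v w \<in> W" by blast
  have "W \<noteq> {0\<^sub>v (order G)}"
  proof -
    \<comment> \<open>The difference of two point masses has sum zero; this is where a second group
      element is required.\<close>
    define f :: "'a \<Rightarrow> complex" where "f x = (if x = \<one> then 1 else 0) - (if x = x0 then 1 else 0)" for x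
    have "fun_vec f \<in> W" using x0 by (simp add: fun_vec_W f_def sum_subtractf)
    moreover have "fun_vec f \<noteq> 0\<^sub>v (order G)"
    proof
      assume "fun_vec f = 0\<^sub>v (order G)"
      then have "f \<one> = 0" unfolding zero_fun_vec fun_vec_eq_iff by (rule bspec[OF _ one_closed])
      then show False using x0 by (simp add: f_def)
    qed
    ultimately show ?thesis by (metis singletonD)
  qed
  then obtain k M \<sigma> where irr: "irreducible_representation G k \<sigma>" and M: "M \<in> carrier_mat (order G) k"
    and inj: "inj_on ((*\<^sub>v) M) (carrier_vec k)" and im: "(*\<^sub>v) M ` carrier_vec k \<subseteq> W"
    and tw: "\<And>g. g \<in> carrier G \<Longrightarrow> regular g * M = M * \<sigma> g"
    by (rule regular.irreducible_constituent[OF W Winv]) (rule that)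
  interpret \<sigma>: irrep G k \<sigma> by unfold_locales (rule irr)
  define \<psi> where "\<psi> g = mat_trace (\<sigma> g) / of_nat k" for g
  have scalar: "\<sigma> g = \<psi> g \<cdot>\<^sub>m 1\<^sub>m k" if "g \<in> carrier G" for g
    unfolding \<psi>_def using that by (intro \<sigma>.commuting_scalar) (auto simp: m_comm)
  show ?thesis
  proof (rule that)
    fix x y assume x: "x \<in> carrier G" and y: "y \<in> carrier G"
    show "\<psi> (x \<otimes> y) = \<psi> x * \<psi> y"
      unfolding \<psi>_def[of "x \<otimes> y"] \<sigma>.rep_scalar_mult(2)[OF x y scalar[OF x]] by (simp add: \<psi>_def[of y])
  next
    show "\<psi> \<one> = 1" using \<sigma>.deg_pos by (simp add: \<psi>_def mat_trace_one)
  next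
    show "\<exists>x\<in>carrier G. \<psi> x \<noteq> 1"
    proof (rule ccontr)
      assume "\<not> ?thesis"
      \<comment> \<open>If the constituent were trivial, a vector in the image of \<open>M\<close>
        would be a translation invariant function with sum zero, hence zero, against injectivity of
        \<open>M\<close>.\<close>
      then have triv: "\<sigma> g = 1\<^sub>m k" if "g \<in> carrier G" for g 
        using scalar[OF that] that by (auto intro!: eq_matI)
      have v: "unit_vec k 0 \<in> carrier_vec k" by simp
      then have "M *\<^sub>v unit_vec k 0 \<in> W" using im by (intro subsetD[OF im] imageI)
      then obtain f where f: "M *\<^sub>v unit_vec k 0 = fun_vec f" "fun_vec f \<in> W"
        by (metis fun_vec_surj mult_mat_vec_carrier[OF M v])
      have const: "f x = f \<one>" if x: "x \<in> carrier G" for x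
      proof -
        have "regular (inv x) *\<^sub>v fun_vec f = (regular (inv x) * M) *\<^sub>v unit_vec k 0"
          using assoc_mult_mat_vec[OF regular_carrier M v, of "inv x"] f(1) by simp
        also have "\<dots> = fun_vec f" using tw[of "inv x"] x triv[of "inv x"] M f(1) by simp
        finally have "fun_vec (\<lambda>y. f (x \<otimes> y)) = fun_vec f" using x by (simp add: regular_mult_fun_vec)
        then have "f (x \<otimes> \<one>) = f \<one>" unfolding fun_vec_eq_iff by blast
        then show ?thesis using x by simp
      qed
      have "(\<Sum>x\<in>carrier G. f x) = (\<Sum>x\<in>carrier G. f \<one>)"
        by (rule sum.cong[OF refl const])
      then have "f \<one> = 0" using f(2) fin x0 by (auto simp: fun_vec_W)
      then have "fun_vec f = 0\<^sub>v (order G)"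
        unfolding zero_fun_vec fun_vec_eq_iff by (metis const)
      then have "M *\<^sub>v unit_vec k 0 = M *\<^sub>v 0\<^sub>v k" using f(1) M by auto
      then have "unit_vec k 0 = (0\<^sub>v k :: complex vec)" using inj by (auto dest: inj_onD)
      then show False using \<sigma>.deg_pos by simp
    qed
  qed
qed

section \<open>Characters of groups with Heisenberg coordinates\<close>

text \<open>Translating by \<open>x\<close> multiplies the sum by \<open>\<mu> x\<close>. The main
  use is the contrapositive: a nonzero sum shows that \<mu> is identically 1 on
  \<open>H\<close>.\<close>

lemma (in fin_group) hom_sum_zero:
  fixes \<mu> :: "'a \<Rightarrow> complex"
  assumes H: "subgroup H G" and mult: "\<And>x y. x \<in> H \<Longrightarrow> y \<in> H \<Longrightarrow> \<mu> (x \<otimes> y) = \<mu> x * \<mu> y"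
    and x: "x \<in> H" "\<mu> x \<noteq> 1"
  shows "(\<Sum>y\<in>H. \<mu> y) = 0"
proof -
  have Hc: "y \<in> carrier G" if "y \<in> H" for y using subgroup.mem_carrier[OF H that] .
  have "bij_betw ((\<otimes>) x) H H"
    using x(1) subgroup.m_closed[OF H] subgroup.m_inv_closed[OF H] Hc
    by (intro bij_betwI[where g="(\<otimes>) (inv x)"]) (auto simp: m_assoc[symmetric])
  then have "(\<Sum>y\<in>H. \<mu> y) = (\<Sum>y\<in>H. \<mu> (x \<otimes> y))" by (rule sum.reindex_bij_betw[symmetric])
  also have "\<dots> = \<mu> x * (\<Sum>y\<in>H. \<mu> y)" by (simp add: mult x sum_distrib_left)
  finally show ?thesis using x(2) by simp
qed

text \<open>The factors \<open>\<mu> g\<close> are nonzero, so both representations have the same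
  invariant subspaces.\<close>

lemma (in fin_group) irreducible_twist:
  fixes \<mu> :: "'a \<Rightarrow> complex"
  assumes irr: "irreducible_representation G d \<rho>"
    and mult: "\<And>x y. x \<in> carrier G \<Longrightarrow> y \<in> carrier G \<Longrightarrow> \<mu> (x \<otimes> y) = \<mu> x * \<mu> y"
    and one: "\<mu> \<one> = 1"
  shows "irreducible_representation G d (\<lambda>g. \<mu> g \<cdot>\<^sub>m \<rho> g)"
proof -
  interpret irrep G d \<rho> by unfold_locales (rule irr)
  have nz: "\<mu> g \<noteq> 0" if "g \<in> carrier G" for g
    using mult[of g "inv g"] one that by auto
  have "representation G d (\<lambda>g. \<mu> g \<cdot>\<^sub>m \<rho> g)"
  proof (rule representationI)
    fix g h assume g: "g \<in> carrier G" and h: "h \<in> carrier G"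
    have "(\<mu> g \<cdot>\<^sub>m \<rho> g) * (\<mu> h \<cdot>\<^sub>m \<rho> h) = \<mu> g \<cdot>\<^sub>m (\<mu> h \<cdot>\<^sub>m (\<rho> g * \<rho> h))"
      using g h by (subst mult_smult_assoc_mat[of _ d d _ d], simp, simp,
          subst mult_smult_distrib[of _ d d _ d]) auto
    then show "\<mu> (g \<otimes> h) \<cdot>\<^sub>m \<rho> (g \<otimes> h) = (\<mu> g \<cdot>\<^sub>m \<rho> g) * (\<mu> h \<cdot>\<^sub>m \<rho> h)"
      using g h by (intro eq_matI) (auto simp: rep_mult mult)
  next
    show "\<mu> \<one> \<cdot>\<^sub>m \<rho> \<one> = 1\<^sub>m d" using one by (auto intro!: eq_matI)
  qed auto
  moreover have "W = {0\<^sub>v d} \<or> W = carrier_vec d"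
    if W: "VectorSpace.subspace class_ring W (module_vec TYPE(complex) d)"
      and inv: "\<forall>g\<in>carrier G. \<forall>w\<in>W. (\<mu> g \<cdot>\<^sub>m \<rho> g) *\<^sub>v w \<in> W" for W
  proof (rule invariant_subspace[OF W])
    fix g w assume g: "g \<in> carrier G" and w: "w \<in> W"
    have wc: "w \<in> carrier_vec d" using W w by (auto simp: subspace_class_ring_iff)
    have "(\<mu> g \<cdot>\<^sub>m \<rho> g) *\<^sub>v w = \<mu> g \<cdot>\<^sub>v (\<rho> g *\<^sub>v w)"
      using g wc by (intro eq_vecI) (auto simp: scalar_prod_def sum_distrib_left mult.assoc)
    moreover have "(\<mu> g \<cdot>\<^sub>m \<rho> g) *\<^sub>v w \<in> W" using inv g w by blast
    ultimately have "\<mu> g \<cdot>\<^sub>v (\<rho> g *\<^sub>v w) \<in> W" by simp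
    then have "inverse (\<mu> g) \<cdot>\<^sub>v (\<mu> g \<cdot>\<^sub>v (\<rho> g *\<^sub>v w)) \<in> W"
      using W unfolding subspace_class_ring_iff by blast
    then show "\<rho> g *\<^sub>v w \<in> W" using nz[OF g] by (simp add: smult_smult_assoc)
  qed
  ultimately show ?thesis using deg_pos by (auto simp: irreducible_representation_def)
qed

text \<open>The radical of the alternating form \<open>(x, y) \<mapsto> \<Sum>i. z i * (x i * y (i + 1) - y i * x (i + 1))\<close>
  on \<open>F\<^sup>n\<close>; the equation for \<open>j\<close> says that \<open>x\<close> is orthogonal to the \<open>j\<close>-th unit vector.\<close>

definition path_left :: "('f, 'c) ring_scheme \<Rightarrow> (nat \<Rightarrow> 'f) \<Rightarrow> (nat \<Rightarrow> 'f) \<Rightarrow> nat \<Rightarrow> 'f" where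
  "path_left F z x j = (if j = 0 then \<zero>\<^bsub>F\<^esub> else z (j - 1) \<otimes>\<^bsub>F\<^esub> x (j - 1))"

definition path_right :: "('f, 'c) ring_scheme \<Rightarrow> nat \<Rightarrow> (nat \<Rightarrow> 'f) \<Rightarrow> (nat \<Rightarrow> 'f) \<Rightarrow> nat \<Rightarrow> 'f" where
  "path_right F n z x j = (if Suc j < n then z j \<otimes>\<^bsub>F\<^esub> x (Suc j) else \<zero>\<^bsub>F\<^esub>)"

definition path_radical :: "('f, 'c) ring_scheme \<Rightarrow> nat \<Rightarrow> (nat \<Rightarrow> 'f) \<Rightarrow> (nat \<Rightarrow> 'f) set" where
  "path_radical F n z =
     {x \<in> {..<n} \<rightarrow>\<^sub>E carrier F. \<forall>j<n. path_left F z x j = path_right F n z x j}"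

text \<open>The representation theory depends on the matrix group only through these axioms. The
  extra term in \<open>c_mult\<close> is the second-order part of matrix multiplication. The
  coordinates need not determine an element: their common kernel is the triple commutator subgroup.
  Fixing \<theta> makes field elements parametrize additive characters.\<close>

locale heis_coords = fin_group G + F: field F
  for G :: "('g, 'b) monoid_scheme" (structure) and F :: "('f, 'c) ring_scheme" +
  fixes n :: nat and a c :: "nat \<Rightarrow> 'g \<Rightarrow> 'f" and \<theta> :: "'f \<Rightarrow> complex"
  assumes finite_field [simp]: "finite (carrier F)"
    and a_in [simp]: "i < n \<Longrightarrow> g \<in> carrier G \<Longrightarrow> a i g \<in> carrier F"
    and c_in [simp]: "i < n - 1 \<Longrightarrow> g \<in> carrier G \<Longrightarrow> c i g \<in> carrier F"
    and a_mult: "i < n \<Longrightarrow> g \<in> carrier G \<Longrightarrow> h \<in> carrier G \<Longrightarrow> a i (g \<otimes> h) = a i g \<oplus>\<^bsub>F\<^esub> a i h"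
    and c_mult: "i < n - 1 \<Longrightarrow> g \<in> carrier G \<Longrightarrow> h \<in> carrier G \<Longrightarrow>
      c i (g \<otimes> h) = c i g \<oplus>\<^bsub>F\<^esub> c i h \<oplus>\<^bsub>F\<^esub> a i g \<otimes>\<^bsub>F\<^esub> a (Suc i) h"
    and coords_surj: "(\<And>i. i < n \<Longrightarrow> u i \<in> carrier F) \<Longrightarrow> (\<And>i. i < n - 1 \<Longrightarrow> v i \<in> carrier F) \<Longrightarrow>
      \<exists>g\<in>carrier G. (\<forall>i<n. a i g = u i) \<and> (\<forall>i<n - 1. c i g = v i)"
    and triple_commutators:
      "commutator_subgroup G (carrier G) (commutator_subgroup G (carrier G) (carrier G)) =
        {g \<in> carrier G. (\<forall>i<n. a i g = \<zero>\<^bsub>F\<^esub>) \<and> (\<forall>i<n - 1. c i g = \<zero>\<^bsub>F\<^esub>)}"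
    and \<theta>_add: "x \<in> carrier F \<Longrightarrow> y \<in> carrier F \<Longrightarrow> \<theta> (x \<oplus>\<^bsub>F\<^esub> y) = \<theta> x * \<theta> y"
    and \<theta>_zero [simp]: "\<theta> \<zero>\<^bsub>F\<^esub> = 1"
    and \<theta>_nontrivial: "\<exists>x\<in>carrier F. \<theta> x \<noteq> 1"
begin

lemma \<theta>_nonzero [simp]: "x \<in> carrier F \<Longrightarrow> \<theta> x \<noteq> 0"
  using \<theta>_add[of x "\<ominus>\<^bsub>F\<^esub> x"] by (auto simp: F.r_neg)

lemma sum_\<theta>:
  assumes y: "y \<in> carrier F"
  shows "(\<Sum>u\<in>carrier F. \<theta> (u \<otimes>\<^bsub>F\<^esub> y)) = (if y = \<zero>\<^bsub>F\<^esub> then of_nat (card (carrier F)) else 0)"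
proof (cases "y = \<zero>\<^bsub>F\<^esub>")
  case False
  obtain x0 where x0: "x0 \<in> carrier F" "\<theta> x0 \<noteq> 1" using \<theta>_nontrivial by blast
  have yU: "inv\<^bsub>F\<^esub> y \<in> carrier F" "inv\<^bsub>F\<^esub> y \<otimes>\<^bsub>F\<^esub> y = \<one>\<^bsub>F\<^esub>"
    using F.field_Units y False by (auto intro: F.Units_l_inv)
  \<comment> \<open>Multiplication by \<open>y\<close> is onto, so the shift can be chosen with
    \<open>u0 * y = x0\<close>, where \<theta> is not 1.\<close>
  define u0 where "u0 = x0 \<otimes>\<^bsub>F\<^esub> inv\<^bsub>F\<^esub> y"
  have u0: "u0 \<in> carrier F" "u0 \<otimes>\<^bsub>F\<^esub> y = x0"
    using x0 y yU by (auto simp: u0_def F.m_assoc)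
  have "bij_betw ((\<oplus>\<^bsub>F\<^esub>) u0) (carrier F) (carrier F)"
    using u0 by (intro bij_betwI[where g="(\<oplus>\<^bsub>F\<^esub>) (\<ominus>\<^bsub>F\<^esub> u0)"]) (auto simp: F.r_neg1 F.r_neg2)
  then have "(\<Sum>u\<in>carrier F. \<theta> (u \<otimes>\<^bsub>F\<^esub> y)) = (\<Sum>u\<in>carrier F. \<theta> ((u0 \<oplus>\<^bsub>F\<^esub> u) \<otimes>\<^bsub>F\<^esub> y))"
    by (rule sum.reindex_bij_betw[symmetric])
  also have "\<dots> = \<theta> x0 * (\<Sum>u\<in>carrier F. \<theta> (u \<otimes>\<^bsub>F\<^esub> y))"
    using u0 y x0(1) by (simp add: F.l_distr \<theta>_add sum_distrib_left)
  finally show ?thesis using x0 False by simp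
qed simp

text \<open>If two multiples of \<theta> coincide as functions, then \<theta> is 1 on all multiples
  of \<open>x - y\<close>; a nonzero difference would contradict the vanishing sum in
  \<open>sum_\<theta>\<close>.\<close>

lemma \<theta>_separates:
  assumes x: "x \<in> carrier F" and y: "y \<in> carrier F"
    and eq: "\<And>t. t \<in> carrier F \<Longrightarrow> \<theta> (x \<otimes>\<^bsub>F\<^esub> t) = \<theta> (y \<otimes>\<^bsub>F\<^esub> t)"
  shows "x = y"
proof (rule ccontr)
  assume "x \<noteq> y"
  then have ne: "x \<ominus>\<^bsub>F\<^esub> y \<noteq> \<zero>\<^bsub>F\<^esub>" using x y by simp
  have "\<theta> (t \<otimes>\<^bsub>F\<^esub> (x \<ominus>\<^bsub>F\<^esub> y)) = 1" if t: "t \<in> carrier F" for t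
  proof -
    have "t \<otimes>\<^bsub>F\<^esub> (x \<ominus>\<^bsub>F\<^esub> y) \<oplus>\<^bsub>F\<^esub> y \<otimes>\<^bsub>F\<^esub> t = x \<otimes>\<^bsub>F\<^esub> t"
      using t x y by algebra
    then have "\<theta> (t \<otimes>\<^bsub>F\<^esub> (x \<ominus>\<^bsub>F\<^esub> y)) * \<theta> (y \<otimes>\<^bsub>F\<^esub> t) = \<theta> (y \<otimes>\<^bsub>F\<^esub> t)"
      using t x y eq[OF t] \<theta>_add[of "t \<otimes>\<^bsub>F\<^esub> (x \<ominus>\<^bsub>F\<^esub> y)" "y \<otimes>\<^bsub>F\<^esub> t"] by simp
    then show ?thesis using t y by simp
  qed
  then have "(\<Sum>t\<in>carrier F. \<theta> (t \<otimes>\<^bsub>F\<^esub> (x \<ominus>\<^bsub>F\<^esub> y))) = of_nat (card (carrier F))" by simp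
  moreover have "card (carrier F) \<noteq> 0" using F.zero_closed by (auto simp: card_eq_0_iff)
  ultimately show False using sum_\<theta>[of "x \<ominus>\<^bsub>F\<^esub> y"] x y ne by simp
qed

lemma a_one [simp]: "i < n \<Longrightarrow> a i \<one> = \<zero>\<^bsub>F\<^esub>"
  using a_mult[of i \<one> \<one>] by simp

lemma c_one [simp]: "i < n - 1 \<Longrightarrow> c i \<one> = \<zero>\<^bsub>F\<^esub>"
  using c_mult[of i \<one> \<one>] a_one[of i] a_one[of "Suc i"] by simp

definition vecs :: "(nat \<Rightarrow> 'f) set" where "vecs = {..<n} \<rightarrow>\<^sub>E carrier F"
definition forms :: "(nat \<Rightarrow> 'f) set" where "forms = {..<n - 1} \<rightarrow>\<^sub>E carrier F"
definition coord :: "'g \<Rightarrow> nat \<Rightarrow> 'f" where "coord g = restrict (\<lambda>i. a i g) {..<n}"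
definition ker_a :: "'g set" where "ker_a = {g \<in> carrier G. \<forall>i<n. a i g = \<zero>\<^bsub>F\<^esub>}"
definition ker_ac :: "'g set" where "ker_ac = {g \<in> ker_a. \<forall>i<n - 1. c i g = \<zero>\<^bsub>F\<^esub>}"

definition lin_char :: "(nat \<Rightarrow> 'f) \<Rightarrow> 'g \<Rightarrow> complex" where
  "lin_char u g = (\<Prod>i<n. \<theta> (u i \<otimes>\<^bsub>F\<^esub> a i g))"
definition form_char :: "(nat \<Rightarrow> 'f) \<Rightarrow> 'g \<Rightarrow> complex" where
  "form_char z g = (\<Prod>i<n - 1. \<theta> (z i \<otimes>\<^bsub>F\<^esub> c i g))"
text \<open>The bimultiplicative factor by which \<open>form_char z\<close> fails to be
  multiplicative. Applying \<theta> to the alternating form of \<open>z\<close> gives the quotient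
  \<open>cross z g h / cross z h g\<close>.\<close>

definition cross :: "(nat \<Rightarrow> 'f) \<Rightarrow> 'g \<Rightarrow> 'g \<Rightarrow> complex" where
  "cross z g h = (\<Prod>i<n - 1. \<theta> (z i \<otimes>\<^bsub>F\<^esub> (a i g \<otimes>\<^bsub>F\<^esub> a (Suc i) h)))"

lemma vecs_in: "u \<in> vecs \<Longrightarrow> i < n \<Longrightarrow> u i \<in> carrier F"
  by (auto simp: vecs_def)
lemma forms_in: "z \<in> forms \<Longrightarrow> i < n - 1 \<Longrightarrow> z i \<in> carrier F"
  by (auto simp: forms_def)
lemma finite_vecs [simp]: "finite vecs" by (auto simp: vecs_def intro!: finite_PiE)
lemma finite_forms [simp]: "finite forms" by (auto simp: forms_def intro!: finite_PiE)
lemma card_vecs: "card vecs = card (carrier F) ^ n" by (simp add: vecs_def card_PiE)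
lemma coord_in [simp]: "g \<in> carrier G \<Longrightarrow> coord g \<in> vecs" by (auto simp: coord_def vecs_def)
lemma ker_aI: "g \<in> carrier G \<Longrightarrow> (\<And>i. i < n \<Longrightarrow> a i g = \<zero>\<^bsub>F\<^esub>) \<Longrightarrow> g \<in> ker_a"
  by (simp add: ker_a_def)
lemma ker_a_carrier [simp]: "x \<in> ker_a \<Longrightarrow> x \<in> carrier G" by (simp add: ker_a_def)
lemma ker_ac_ker_a: "x \<in> ker_ac \<Longrightarrow> x \<in> ker_a" by (simp add: ker_ac_def)
lemma ker_acI: "x \<in> ker_a \<Longrightarrow> (\<And>i. i < n - 1 \<Longrightarrow> c i x = \<zero>\<^bsub>F\<^esub>) \<Longrightarrow> x \<in> ker_ac"
  by (simp add: ker_ac_def)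
lemma c_ker_ac: "x \<in> ker_ac \<Longrightarrow> i < n - 1 \<Longrightarrow> c i x = \<zero>\<^bsub>F\<^esub>"
  by (simp add: ker_ac_def)
lemma a_ker_a [simp]: "x \<in> ker_a \<Longrightarrow> i < n \<Longrightarrow> a i x = \<zero>\<^bsub>F\<^esub>" by (simp add: ker_a_def del: ker_a_carrier)
lemma q_pos [simp]: "card (carrier F) > 0"
  using F.zero_closed by (auto simp: card_gt_0_iff)

lemma lin_char_mult:
  assumes "u \<in> vecs" "g \<in> carrier G" "h \<in> carrier G"
  shows "lin_char u (g \<otimes> h) = lin_char u g * lin_char u h"
  using assms by (simp add: vecs_in[OF assms(1)] lin_char_def a_mult F.r_distr \<theta>_add prod.distrib)

lemma lin_char_ker_a [simp]:
  assumes "u \<in> vecs" "x \<in> ker_a"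
  shows "lin_char u x = 1"
  using assms by (simp add: vecs_in[OF assms(1)] lin_char_def)

lemma one_ker_a [simp]: "\<one> \<in> ker_a" by (rule ker_aI) auto
lemma one_ker_ac [simp]: "\<one> \<in> ker_ac" by (simp add: ker_ac_def)

lemma lin_char_inv: "u \<in> vecs \<Longrightarrow> g \<in> carrier G \<Longrightarrow> lin_char u g * lin_char u (inv g) = 1"
  using lin_char_mult[of u g "inv g"] by simp

lemma form_char_mult:
  assumes "z \<in> forms" "g \<in> carrier G" "h \<in> carrier G"
  shows "form_char z (g \<otimes> h) = form_char z g * form_char z h * cross z g h"
  using assms by (simp add: forms_in[OF assms(1)] form_char_def cross_def c_mult F.r_distr \<theta>_add prod.distrib)

lemma cross_ker_a [simp]:
  assumes "z \<in> forms" "x \<in> ker_a" "h \<in> carrier G"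
  shows "cross z x h = 1" "cross z h x = 1"
  using assms by (simp_all add: forms_in[OF assms(1)] cross_def)

lemma form_char_nonzero [simp]:
  assumes "z \<in> forms" "g \<in> carrier G"
  shows "form_char z g \<noteq> 0"
  using assms by (simp add: forms_in[OF assms(1)] form_char_def)

lemma form_char_ker_ac [simp]:
  assumes "z \<in> forms" "x \<in> ker_ac"
  shows "form_char z x = 1"
  using assms by (simp add: forms_in[OF assms(1)] form_char_def ker_ac_def)

lemma a_inv: "i < n \<Longrightarrow> g \<in> carrier G \<Longrightarrow> a i (inv g) = \<ominus>\<^bsub>F\<^esub> a i g"
  using a_mult[of i "inv g" g] by (intro F.minus_equality[symmetric]) simp_all

lemma ker_a_subgroup: "subgroup ker_a G"
  by (rule subgroupI) (auto simp: a_mult a_inv intro!: ker_aI intro: one_ker_a)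

lemma c_ker_a_mult:
  assumes "i < n - 1" "x \<in> ker_a" "g \<in> carrier G"
  shows "c i (x \<otimes> g) = c i x \<oplus>\<^bsub>F\<^esub> c i g" "c i (g \<otimes> x) = c i x \<oplus>\<^bsub>F\<^esub> c i g"
  using assms by (simp_all add: c_mult F.a_comm)

lemma commutation:
  assumes g: "g \<in> carrier G" and h: "h \<in> carrier G"
  obtains w where "w \<in> ker_a" "g \<otimes> h = w \<otimes> (h \<otimes> g)"
proof
  define w where "w = g \<otimes> h \<otimes> inv (h \<otimes> g)"
  have "a i w = \<zero>\<^bsub>F\<^esub>" if i: "i < n" for i
  proof -
    have "a i w = (a i g \<oplus>\<^bsub>F\<^esub> a i h) \<oplus>\<^bsub>F\<^esub> (\<ominus>\<^bsub>F\<^esub> (a i h \<oplus>\<^bsub>F\<^esub> a i g))"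
      using i g h by (simp add: w_def a_mult a_inv del: inv_mult_group)
    also have "\<dots> = \<zero>\<^bsub>F\<^esub>"
      using a_in[OF i g] a_in[OF i h] by algebra
    finally show ?thesis .
  qed
  moreover have "w \<in> carrier G" using g h by (simp add: w_def)
  ultimately show "w \<in> ker_a" by (intro ker_aI)
  show "g \<otimes> h = w \<otimes> (h \<otimes> g)" using g h by (simp add: w_def m_assoc)
qed

text \<open>\<open>ker_a\<close> is central modulo \<open>ker_ac\<close>: the product term in
  \<open>c_mult\<close> vanishes as soon as one factor has \<open>a = 0\<close>, so \<open>c\<close>
  takes the same value on both orders of the product.\<close>

lemma commutation_ker_a:
  assumes x: "x \<in> ker_a" and h: "h \<in> carrier G"
  obtains w where "w \<in> ker_ac" "x \<otimes> h = w \<otimes> (h \<otimes> x)"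
proof -
  obtain w where w: "w \<in> ker_a" "x \<otimes> h = w \<otimes> (h \<otimes> x)" using commutation[of x h] x h by auto
  have "c i w = \<zero>\<^bsub>F\<^esub>" if i: "i < n - 1" for i
  proof -
    have "c i w \<oplus>\<^bsub>F\<^esub> c i (h \<otimes> x) = c i (h \<otimes> x)"
      using w c_ker_a_mult[OF i w(1), of "h \<otimes> x"] c_ker_a_mult[OF i x h] x h by simp
    then show ?thesis using w i x h by simp
  qed
  then show ?thesis using that w by (auto simp: ker_ac_def)
qed

lemma ker_ac_subgroup: "subgroup ker_ac G"
proof (rule subgroupI)
  show "ker_ac \<subseteq> carrier G" by (auto dest: ker_ac_ker_a)
  show "ker_ac \<noteq> {}" using one_ker_ac by (metis empty_iff)
next
  fix x assume x: "x \<in> ker_ac"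
  then have xZ: "x \<in> ker_a" by (rule ker_ac_ker_a)
  have ixZ: "inv x \<in> ker_a" by (rule subgroup.m_inv_closed[OF ker_a_subgroup xZ])
  show "inv x \<in> ker_ac"
  proof (rule ker_acI[OF ixZ])
    fix i assume i: "i < n - 1"
    show "c i (inv x) = \<zero>\<^bsub>F\<^esub>"
      using c_ker_a_mult(1)[OF i xZ, of "inv x"] c_ker_ac[OF x i] xZ i by simp
  qed
next
  fix x y assume x: "x \<in> ker_ac" and y: "y \<in> ker_ac"
  then have Z: "x \<in> ker_a" "y \<in> ker_a" by (auto intro: ker_ac_ker_a)
  show "x \<otimes> y \<in> ker_ac"
  proof (rule ker_acI)
    show "x \<otimes> y \<in> ker_a" by (rule subgroup.m_closed[OF ker_a_subgroup Z])
    fix i assume i: "i < n - 1"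
    show "c i (x \<otimes> y) = \<zero>\<^bsub>F\<^esub>"
      using c_ker_a_mult(1)[OF i Z(1), of y] c_ker_ac[OF x i] c_ker_ac[OF y i] Z by simp
  qed
qed

lemma ker_ac_normal:
  assumes g: "g \<in> carrier G" and x: "x \<in> ker_ac"
  shows "g \<otimes> x \<otimes> inv g \<in> ker_ac"
proof -
  have xZ: "x \<in> ker_a" using x by (rule ker_ac_ker_a)
  obtain w where w: "w \<in> ker_ac" "x \<otimes> g = w \<otimes> (g \<otimes> x)" by (rule commutation_ker_a[OF xZ g])
  have wc: "w \<in> carrier G" using w ker_ac_ker_a by auto
  have "g \<otimes> x \<otimes> inv g = inv w \<otimes> (w \<otimes> (g \<otimes> x)) \<otimes> inv g"
    using g xZ wc by (simp add: m_assoc[symmetric])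
  also have "\<dots> = inv w \<otimes> x"
    unfolding w(2)[symmetric] using g xZ wc by (simp add: m_assoc)
  finally show ?thesis
    using subgroup.m_closed[OF ker_ac_subgroup subgroup.m_inv_closed[OF ker_ac_subgroup w(1)] x] by simp
qed

lemma ker_a_normal:
  assumes g: "g \<in> carrier G" and x: "x \<in> ker_a"
  shows "inv g \<otimes> x \<otimes> g \<in> ker_a"
  using assms by (intro ker_aI) (simp_all add: a_mult a_inv F.l_neg)

text \<open>\<open>form_char z\<close> is multiplicative when one factor lies in
  \<open>ker_a\<close>; the two factorizations of \<open>x \<otimes> g\<close> then allow
  \<open>form_char z g\<close> to be cancelled.\<close>

lemma form_char_conj:
  assumes z: "z \<in> forms" and g: "g \<in> carrier G" and x: "x \<in> ker_a"
  shows "form_char z (inv g \<otimes> x \<otimes> g) = form_char z x"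
proof -
  have "form_char z (g \<otimes> (inv g \<otimes> x \<otimes> g)) = form_char z g * form_char z (inv g \<otimes> x \<otimes> g)"
    using ker_a_normal[OF g x] z g x by (simp add: form_char_mult)
  moreover have "g \<otimes> (inv g \<otimes> x \<otimes> g) = x \<otimes> g" using g x by (simp add: m_assoc[symmetric])
  moreover have "form_char z (x \<otimes> g) = form_char z x * form_char z g" using z g x by (simp add: form_char_mult)
  ultimately show ?thesis using z g by simp
qed

text \<open>The sum over all \<open>u\<close> factors into one sum over the field for each
  coordinate.\<close>

lemma sum_lin_char:
  assumes g: "g \<in> carrier G"
  shows "(\<Sum>u\<in>vecs. lin_char u g) = (if g \<in> ker_a then of_nat (card vecs) else 0)"
proof -
  have "(\<Sum>u\<in>vecs. lin_char u g) = (\<Prod>i<n. \<Sum>t\<in>carrier F. \<theta> (t \<otimes>\<^bsub>F\<^esub> a i g))"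
    unfolding vecs_def lin_char_def by (rule prod_sum_PiE[symmetric]) auto
  also have "\<dots> = (\<Prod>i<n. if a i g = \<zero>\<^bsub>F\<^esub> then of_nat (card (carrier F)) else 0)"
    using g by (intro prod.cong) (auto simp: sum_\<theta>)
  also have "\<dots> = (if g \<in> ker_a then of_nat (card vecs) else 0)"
    using ker_aI[OF g] by (auto simp: card_vecs)
  finally show ?thesis .
qed

lemma sum_form_char:
  assumes x: "x \<in> ker_a"
  shows "(\<Sum>z\<in>forms. form_char z x) = (if x \<in> ker_ac then of_nat (card forms) else 0)"
proof -
  have "(\<Sum>z\<in>forms. form_char z x) = (\<Prod>i<n - 1. \<Sum>t\<in>carrier F. \<theta> (t \<otimes>\<^bsub>F\<^esub> c i x))"
    unfolding forms_def form_char_def by (rule prod_sum_PiE[symmetric]) auto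
  also have "\<dots> = (\<Prod>i<n - 1. if c i x = \<zero>\<^bsub>F\<^esub> then of_nat (card (carrier F)) else 0)"
    using x by (intro prod.cong) (auto simp: sum_\<theta>)
  also have "\<dots> = (if x \<in> ker_ac then of_nat (card forms) else 0)"
    using ker_acI[OF x] c_ker_ac[of x] by (auto simp: forms_def card_PiE)
  finally show ?thesis .
qed

section \<open>Representations with a prescribed form on \<open>ker_a\<close>\<close>

definition central :: "nat \<Rightarrow> ('g \<Rightarrow> complex mat) \<Rightarrow> (nat \<Rightarrow> 'f) \<Rightarrow> bool" where
  "central d \<rho> z \<longleftrightarrow> irreducible_representation G d \<rho> \<and> (\<forall>x\<in>ker_a. \<rho> x = form_char z x \<cdot>\<^sub>m 1\<^sub>m d)"

text \<open>The centre of any character belonging to \<open>z\<close>, that is, the elements acting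
  as scalars. It is written through \<open>cross\<close> so that it visibly depends on
  \<open>z\<close> and not on a representation.\<close>

definition centre :: "(nat \<Rightarrow> 'f) \<Rightarrow> 'g set" where
  "centre z = {g \<in> carrier G. \<forall>h\<in>carrier G. cross z g h = cross z h g}"

lemma centre_carrier: "g \<in> centre z \<Longrightarrow> g \<in> carrier G" by (simp add: centre_def)

lemma finite_centre: "finite (centre z)" by (rule finite_subset[of _ "carrier G"]) (auto simp: centre_def)

lemma finite_ker_a: "finite ker_a" by (rule finite_subset[of _ "carrier G"]) auto

lemma card_ker_a_pos: "card ker_a > 0" by (metis card_gt_0_iff empty_iff finite_ker_a one_ker_a)

lemma cross_mult:
  assumes "z \<in> forms" "g \<in> carrier G" "g' \<in> carrier G" "h \<in> carrier G"
  shows "cross z (g \<otimes> g') h = cross z g h * cross z g' h"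
    and "cross z h (g \<otimes> g') = cross z h g * cross z h g'"
  using assms
  by (simp_all add: cross_def forms_in[OF assms(1)] a_mult F.l_distr F.r_distr \<theta>_add prod.distrib)

lemma ker_a_sub_centre: "z \<in> forms \<Longrightarrow> x \<in> ker_a \<Longrightarrow> x \<in> centre z"
  unfolding centre_def by simp

lemma centre_subgroup:
  assumes z: "z \<in> forms"
  shows "subgroup (centre z) G"
proof (rule subgroupI)
  show "centre z \<subseteq> carrier G" by (auto simp: centre_def)
  show "centre z \<noteq> {}" using ker_a_sub_centre[OF z one_ker_a] by auto
next
  fix g assume "g \<in> centre z"
  then have g: "g \<in> carrier G" and eq: "\<And>h. h \<in> carrier G \<Longrightarrow> cross z g h = cross z h g"
    by (auto simp: centre_def)
  have "cross z (inv g) h = cross z h (inv g)" if h: "h \<in> carrier G" for h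
  proof -
    have "cross z (inv g) h * cross z g h = 1" "cross z h (inv g) * cross z h g = 1"
      using cross_mult[OF z inv_closed[OF g] g h] z g h by simp_all
    then show ?thesis using eq[OF h] by (metis mult_cancel_right mult_zero_right zero_neq_one)
  qed
  then show "inv g \<in> centre z" using g by (simp add: centre_def)
next
  fix g g' assume "g \<in> centre z" "g' \<in> centre z"
  then show "g \<otimes> g' \<in> centre z" using z by (auto simp: centre_def cross_mult)
qed

lemma exists_central:
  assumes z: "z \<in> forms"
  shows "\<exists>d \<rho>. central d \<rho> z"
proof (rule irreducible_with_central_character[of ker_a "form_char z"])
  show "form_char z (x \<otimes> y) = form_char z x * form_char z y" if "x \<in> ker_a" "y \<in> ker_a" for x y
    using that z by (simp add: form_char_mult)
  show "form_char z \<one> = 1" using z by simp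
  show "\<exists>d \<rho>. central d \<rho> z" if "irreducible_representation G d \<sigma>"
    "\<And>x. x \<in> ker_a \<Longrightarrow> \<sigma> x = form_char z x \<cdot>\<^sub>m 1\<^sub>m d" for d \<sigma>
    using that unfolding central_def by blast
qed (use z form_char_conj ker_a_normal ker_a_subgroup in auto)

lemma central_twist:
  assumes cen: "central d \<rho> z" and u: "u \<in> vecs"
  shows "central d (\<lambda>g. lin_char u g \<cdot>\<^sub>m \<rho> g) z"
  unfolding central_def
proof (intro conjI ballI)
  show "irreducible_representation G d (\<lambda>g. lin_char u g \<cdot>\<^sub>m \<rho> g)"
    using cen u by (intro irreducible_twist) (auto simp: central_def lin_char_mult)
next
  fix x assume x: "x \<in> ker_a"
  then have "\<rho> x = form_char z x \<cdot>\<^sub>m 1\<^sub>m d" using cen by (simp add: central_def)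
  then show "lin_char u x \<cdot>\<^sub>m \<rho> x = form_char z x \<cdot>\<^sub>m 1\<^sub>m d" using u x by (auto intro!: eq_matI)
qed

text \<open>Evaluating \<open>form_char z\<close> on both sides of
  \<open>g \<otimes> h = w \<otimes> (h \<otimes> g)\<close> with \<open>w \<in> ker_a\<close> shows
  that \<open>w\<close> acts as \<open>cross z g h / cross z h g\<close>. So commutators act as
  scalars, \<open>scalar_part\<close> is \<open>centre z\<close>, and \<open>degree_sq\<close>
  applies.\<close>

lemma central_props:
  assumes z: "z \<in> forms" and cen: "central d \<rho> z"
  shows "d > 0"
    and "d^2 * card (centre z) = card (carrier G)"
    and "\<And>g. g \<in> carrier G \<Longrightarrow> g \<notin> centre z \<Longrightarrow> mat_trace (\<rho> g) = 0"
    and "\<And>g. g \<in> centre z \<Longrightarrow> \<rho> g = (mat_trace (\<rho> g) / of_nat d) \<cdot>\<^sub>m 1\<^sub>m d"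
    and "\<And>x. x \<in> ker_a \<Longrightarrow> mat_trace (\<rho> x) = form_char z x * of_nat d"
proof -
  interpret irrep G d \<rho> using cen by unfold_locales (simp add: central_def)
  show "d > 0" by (rule deg_pos)
  have comm: "\<rho> (g \<otimes> h) = (cross z g h / cross z h g) \<cdot>\<^sub>m \<rho> (h \<otimes> g)"
    and nz: "cross z h g \<noteq> 0"
    if g: "g \<in> carrier G" and h: "h \<in> carrier G" for g h
  proof -
    obtain w where w: "w \<in> ker_a" "g \<otimes> h = w \<otimes> (h \<otimes> g)" by (rule commutation[OF g h])
    show nz: "cross z h g \<noteq> 0" using g h z forms_in[OF z] by (simp add: cross_def)
    have "form_char z g * form_char z h * cross z g h = form_char z (w \<otimes> (h \<otimes> g))"
      using g h z w(2) form_char_mult[OF z g h] by simp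
    also have "\<dots> = form_char z w * (form_char z h * form_char z g * cross z h g)"
      using g h z w(1) by (simp add: form_char_mult)
    finally have "form_char z w = cross z g h / cross z h g"
      using nz form_char_nonzero[OF z g] form_char_nonzero[OF z h] by (simp add: field_simps)
    moreover have "\<rho> (g \<otimes> h) = form_char z w \<cdot>\<^sub>m \<rho> (h \<otimes> g)"
    proof -
      have "\<rho> w = form_char z w \<cdot>\<^sub>m 1\<^sub>m d" using cen w(1) by (simp add: central_def)
      then show ?thesis unfolding w(2) using w(1) g h by (intro rep_scalar_mult(1)) auto
    qed
    ultimately show "\<rho> (g \<otimes> h) = (cross z g h / cross z h g) \<cdot>\<^sub>m \<rho> (h \<otimes> g)" by simp
  qed
  have "scalar_part = centre z"
  proof -
    have "\<rho> (g \<otimes> h) = \<rho> (h \<otimes> g) \<longleftrightarrow> cross z g h = cross z h g"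
      if g: "g \<in> carrier G" and h: "h \<in> carrier G" for g h
    proof
      assume "cross z g h = cross z h g"
      then have "\<rho> (g \<otimes> h) = 1 \<cdot>\<^sub>m \<rho> (h \<otimes> g)" using comm[OF g h] nz[OF g h] by simp
      then show "\<rho> (g \<otimes> h) = \<rho> (h \<otimes> g)" by (auto intro!: eq_matI)
    next
      assume eq: "\<rho> (g \<otimes> h) = \<rho> (h \<otimes> g)"
      define \<omega> where "\<omega> = cross z g h / cross z h g"
      have hg: "h \<otimes> g \<in> carrier G" using g h by simp
      have "\<rho> (h \<otimes> g) = \<omega> \<cdot>\<^sub>m \<rho> (h \<otimes> g)" using comm[OF g h] eq by (simp add: \<omega>_def)
      \<comment> \<open>Since \<open>\<rho> (h \<otimes> g)\<close> is invertible, only a multiple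
        of the identity remains, and its trace determines \<omega> because
        \<open>d > 0\<close>.\<close>
      then have "\<rho> (h \<otimes> g) * \<rho> (inv (h \<otimes> g)) = (\<omega> \<cdot>\<^sub>m \<rho> (h \<otimes> g)) * \<rho> (inv (h \<otimes> g))"
        by (rule arg_cong[where f="\<lambda>A. A * \<rho> (inv (h \<otimes> g))"])
      also have "\<dots> = \<omega> \<cdot>\<^sub>m (\<rho> (h \<otimes> g) * \<rho> (inv (h \<otimes> g)))"
        by (rule mult_smult_assoc_mat[OF rep_carrier[OF hg] rep_carrier[OF inv_closed[OF hg]]])
      finally have "1\<^sub>m d = \<omega> \<cdot>\<^sub>m (1\<^sub>m d :: complex mat)" unfolding rep_inv(2)[OF hg] .
      then have "mat_trace (1\<^sub>m d) = mat_trace (\<omega> \<cdot>\<^sub>m (1\<^sub>m d :: complex mat))" by simp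
      then have "\<omega> = 1" using deg_pos by (simp add: mat_trace_smult[of _ d] mat_trace_one)
      then show "cross z g h = cross z h g" using nz[OF g h] by (simp add: \<omega>_def)
    qed
    then show ?thesis by (auto simp: scalar_part_def centre_def)
  qed
  moreover have ex: "\<exists>\<omega>. \<rho> (g \<otimes> h) = \<omega> \<cdot>\<^sub>m \<rho> (h \<otimes> g)"
    if "g \<in> carrier G" "h \<in> carrier G" for g h
    using comm[OF that] by blast
  ultimately show "d^2 * card (centre z) = card (carrier G)" 
    and "\<And>g. g \<in> carrier G \<Longrightarrow> g \<notin> centre z \<Longrightarrow> mat_trace (\<rho> g) = 0"
    using degree_sq[OF ex] by auto
  show "\<rho> g = (mat_trace (\<rho> g) / of_nat d) \<cdot>\<^sub>m 1\<^sub>m d" if "g \<in> centre z" for g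
    using that unfolding \<open>scalar_part = centre z\<close>[symmetric]
    by (intro commuting_scalar) (auto simp: scalar_part_def)
  show "mat_trace (\<rho> x) = form_char z x * of_nat d" if "x \<in> ker_a" for x
  proof -
    have "\<rho> x = form_char z x \<cdot>\<^sub>m 1\<^sub>m d" using cen that by (simp add: central_def)
    then show ?thesis by (simp add: mat_trace_smult[of _ d] mat_trace_one)
  qed
qed

text \<open>Summing over \<open>u\<close> annihilates every \<open>g\<close> outside
  \<open>ker_a\<close>. If the right side is nonzero, some \<open>u\<close> has a nonzero inner sum,
  which replaces extending a character from \<open>K\<close> to the group; if it is known exactly,
  it counts coinciding twists.\<close>

lemma sum_lin_char_inv:
  assumes K: "subgroup K G" "ker_a \<subseteq> K"
  shows "(\<Sum>u\<in>vecs. \<Sum>g\<in>K. f g * lin_char u (inv g)) = of_nat (card vecs) * (\<Sum>g\<in>ker_a. f g)"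
proof -
  have Kc: "g \<in> carrier G" if "g \<in> K" for g using subgroup.mem_carrier[OF K(1) that] .
  have finK: "finite K" using Kc finite_carrier by (meson finite_subset subsetI)
  have "(\<Sum>u\<in>vecs. \<Sum>g\<in>K. f g * lin_char u (inv g)) = (\<Sum>g\<in>K. f g * (\<Sum>u\<in>vecs. lin_char u (inv g)))"
    by (subst sum.swap) (simp add: sum_distrib_left)
  also have "\<dots> = (\<Sum>g\<in>K. if g \<in> ker_a then f g * of_nat (card vecs) else 0)"
  proof (rule sum.cong[OF refl])
    fix g assume "g \<in> K"
    then have g: "g \<in> carrier G" by (rule Kc)
    have "inv g \<in> ker_a \<longleftrightarrow> g \<in> ker_a"
      using subgroup.m_inv_closed[OF ker_a_subgroup, of g] subgroup.m_inv_closed[OF ker_a_subgroup, of "inv g"] g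
      by auto
    then show "f g * (\<Sum>u\<in>vecs. lin_char u (inv g)) = (if g \<in> ker_a then f g * of_nat (card vecs) else 0)"
      using sum_lin_char[OF inv_closed[OF g]] by simp
  qed
  also have "\<dots> = (\<Sum>g\<in>ker_a. f g * of_nat (card vecs))"
  proof -
    have "{g \<in> K. g \<in> ker_a} = ker_a" using K(2) by auto
    then show ?thesis using finK by (simp add: sum.inter_filter[symmetric])
  qed
  finally show ?thesis by (simp add: sum_distrib_left mult.commute)
qed

text \<open>The scalar by which \<open>centre z\<close> acts is a linear character of that subgroup
  extending \<open>form_char z\<close> from \<open>ker_a\<close>; together with traces vanishing
  elsewhere, it determines the whole character.\<close>

lemma central_scalar:
  assumes z: "z \<in> forms" and cen: "central d \<rho> z"
  defines "\<mu> \<equiv> \<lambda>g. mat_trace (\<rho> g) / of_nat d"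
  shows "\<And>g h. g \<in> centre z \<Longrightarrow> h \<in> centre z \<Longrightarrow> \<mu> (g \<otimes> h) = \<mu> g * \<mu> h"
    and "\<And>x. x \<in> ker_a \<Longrightarrow> \<mu> x = form_char z x"
    and "\<And>g. g \<in> centre z \<Longrightarrow> \<mu> g * \<mu> (inv g) = 1"
proof -
  interpret irrep G d \<rho> using cen by unfold_locales (simp add: central_def)
  show mult: "\<mu> (g \<otimes> h) = \<mu> g * \<mu> h" if g: "g \<in> centre z" and h: "h \<in> centre z" for g h
  proof -
    have "mat_trace (\<rho> (g \<otimes> h)) = \<mu> g * mat_trace (\<rho> h)"
      unfolding \<mu>_def by (rule rep_scalar_mult(2)[OF centre_carrier[OF g] centre_carrier[OF h] central_props(4)[OF z cen g]])
    then show ?thesis by (simp add: \<mu>_def)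
  qed
  show form_char: "\<mu> x = form_char z x" if "x \<in> ker_a" for x
    using central_props(5)[OF z cen that] deg_pos by (simp add: \<mu>_def)
  show "\<mu> g * \<mu> (inv g) = 1" if g: "g \<in> centre z" for g
  proof -
    have "\<mu> g * \<mu> (inv g) = \<mu> (g \<otimes> inv g)"
      using mult[OF g subgroup.m_inv_closed[OF centre_subgroup[OF z] g]] by simp
    also have "\<dots> = 1" using form_char[OF one_ker_a] z centre_carrier[OF g] by simp
    finally show ?thesis .
  qed
qed

text \<open>The central scalars of the two representations differ by a homomorphism \<open>f\<close>
  on \<open>centre z\<close> that is 1 on \<open>ker_a\<close>. Averaging gives a \<open>u\<close>
  that correlates with \<open>f\<close> on the centre, and \<open>hom_sum_zero\<close> upgrades the
  correlation to equality there. Outside the centre both traces vanish.\<close>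

lemma central_unique_up_to_lin_char:
  assumes z: "z \<in> forms" and cen: "central d \<rho> z" and cen': "central d' \<rho>' z"
  shows "\<exists>u\<in>vecs. \<forall>g\<in>carrier G. mat_trace (\<rho>' g) = lin_char u g * mat_trace (\<rho> g)"
proof -
  have "d^2 * card (centre z) = d'^2 * card (centre z)"
    using central_props(2)[OF z cen] central_props(2)[OF z cen'] by simp
  moreover have "card (centre z) > 0"
    using finite_centre ker_a_sub_centre[OF z one_ker_a] by (auto simp: card_gt_0_iff)
  ultimately have dd: "d' = d" by simp
  have d: "d > 0" by (rule central_props(1)[OF z cen])
  \<comment> \<open>The equation for the squared degree involves only \<open>z\<close>, which has
    forced \<open>d' = d\<close>; so comparing the scalars compares the traces.\<close>
  define \<mu> where "\<mu> g = mat_trace (\<rho> g) / of_nat d" for g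
  define \<mu>' where "\<mu>' g = mat_trace (\<rho>' g) / of_nat d'" for g
  have m: "g \<in> centre z \<Longrightarrow> h \<in> centre z \<Longrightarrow> \<mu> (g \<otimes> h) = \<mu> g * \<mu> h"
    "x \<in> ker_a \<Longrightarrow> \<mu> x = form_char z x" "g \<in> centre z \<Longrightarrow> \<mu> g * \<mu> (inv g) = 1" for g h x
    unfolding \<mu>_def by (rule central_scalar[OF z cen]; assumption)+
  have m': "g \<in> centre z \<Longrightarrow> h \<in> centre z \<Longrightarrow> \<mu>' (g \<otimes> h) = \<mu>' g * \<mu>' h"
    "x \<in> ker_a \<Longrightarrow> \<mu>' x = form_char z x" for g h x
    unfolding \<mu>'_def by (rule central_scalar[OF z cen']; assumption)+
  define f where "f g = \<mu>' g * \<mu> (inv g)" for g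
  note K = centre_subgroup[OF z]
  note Ki = subgroup.m_inv_closed[OF K]
  have "(\<Sum>u\<in>vecs. \<Sum>g\<in>centre z. f g * lin_char u (inv g)) = of_nat (card vecs) * (\<Sum>g\<in>ker_a. f g)"
    using ker_a_sub_centre[OF z] by (intro sum_lin_char_inv[OF K]) auto
  also have "(\<Sum>g\<in>ker_a. f g) = (\<Sum>g\<in>ker_a. 1)"
  proof (rule sum.cong[OF refl])
    fix g assume g: "g \<in> ker_a"
    have "f g = \<mu> g * \<mu> (inv g)" using m(2)[OF g] m'(2)[OF g] by (simp add: f_def)
    then show "f g = 1" using m(3)[OF ker_a_sub_centre[OF z g]] by simp
  qed
  also have "of_nat (card vecs) * \<dots> \<noteq> (0::complex)"
    using card_ker_a_pos F.zero_closed by (auto simp: card_vecs)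
  finally obtain u where u: "u \<in> vecs" "(\<Sum>g\<in>centre z. f g * lin_char u (inv g)) \<noteq> 0"
    by (meson sum.not_neutral_contains_not_neutral)
  have one: "f g * lin_char u (inv g) = 1" if g: "g \<in> centre z" for g
  proof (rule ccontr)
    assume ne: "f g * lin_char u (inv g) \<noteq> 1"
    have "(\<Sum>y\<in>centre z. f y * lin_char u (inv y)) = 0"
    proof (rule hom_sum_zero[where \<mu>="\<lambda>y. f y * lin_char u (inv y)" and x=g, OF K _ g ne])
      fix x y assume x: "x \<in> centre z" and y: "y \<in> centre z"
      have xc: "x \<in> carrier G" and yc: "y \<in> carrier G" using x y centre_carrier by auto
      have "inv (x \<otimes> y) = inv y \<otimes> inv x" using xc yc by (rule inv_mult_group)
      then show "f (x \<otimes> y) * lin_char u (inv (x \<otimes> y)) = f x * lin_char u (inv x) * (f y * lin_char u (inv y))"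
        using x y xc yc Ki[OF x] Ki[OF y] u(1) by (simp add: f_def m m' lin_char_mult)
    qed
    then show False using u(2) by simp
  qed
  have "mat_trace (\<rho>' g) = lin_char u g * mat_trace (\<rho> g)" if g: "g \<in> carrier G" for g
  proof (cases "g \<in> centre z")
    case True
    have "\<mu>' g = \<mu>' g * (\<mu> g * \<mu> (inv g)) * (lin_char u g * lin_char u (inv g))"
      using m(3)[OF True] lin_char_inv[OF u(1) g] by simp
    also have "\<dots> = lin_char u g * \<mu> g * (f g * lin_char u (inv g))" by (simp add: f_def algebra_simps)
    also have "\<dots> = lin_char u g * \<mu> g" using one[OF True] by simp
    finally show ?thesis using d dd by (simp add: \<mu>_def \<mu>'_def)
  next
    case False
    then show ?thesis using central_props(3)[OF z cen g] central_props(3)[OF z cen' g] by simp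
  qed
  then show ?thesis using u(1) by blast
qed

text \<open>Elements of \<open>ker_a\<close> commute with everything up to \<open>ker_ac\<close>,
  where the representation is trivial, so they act by scalars \<zeta>. The correlations of \<zeta>
  with all forms add up to \<open>card ker_ac * card forms\<close>; hence some
  \<open>form_char z\<close> correlates with \<zeta> and, by orthogonality, equals it on
  \<open>ker_a\<close>.\<close>

lemma exists_form:
  assumes irr: "irreducible_representation G d \<rho>" and triv: "\<And>x. x \<in> ker_ac \<Longrightarrow> \<rho> x = 1\<^sub>m d"
  shows "\<exists>z\<in>forms. central d \<rho> z"
proof -
  interpret irrep G d \<rho> by unfold_locales (rule irr)
  define \<zeta> where "\<zeta> = (\<lambda>g. mat_trace (\<rho> g) / of_nat d)"
  have scalar: "\<rho> x = \<zeta> x \<cdot>\<^sub>m 1\<^sub>m d" if x: "x \<in> ker_a" for x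
    unfolding \<zeta>_def
  proof (rule commuting_scalar)
    fix h assume h: "h \<in> carrier G"
    obtain w where w: "w \<in> ker_ac" "x \<otimes> h = w \<otimes> (h \<otimes> x)" by (rule commutation_ker_a[OF x h])
    have hx: "h \<otimes> x \<in> carrier G" using h x by simp
    have "\<rho> (x \<otimes> h) = \<rho> w * \<rho> (h \<otimes> x)"
      unfolding w(2) by (rule rep_mult[OF ker_a_carrier[OF ker_ac_ker_a[OF w(1)]] hx])
    then show "\<rho> (x \<otimes> h) = \<rho> (h \<otimes> x)" using triv[OF w(1)] rep_carrier[OF hx] by simp
  qed (use x in simp)
  have mult: "\<zeta> (x \<otimes> y) = \<zeta> x * \<zeta> y" if x: "x \<in> ker_a" and y: "y \<in> ker_a" for x y
  proof -
    have "mat_trace (\<rho> (x \<otimes> y)) = \<zeta> x * mat_trace (\<rho> y)"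
      by (rule rep_scalar_mult(2)[OF ker_a_carrier[OF x] ker_a_carrier[OF y] scalar[OF x]])
    then show ?thesis by (simp add: \<zeta>_def)
  qed
  have N1: "\<zeta> x = 1" if "x \<in> ker_ac" for x
    using triv[OF that] deg_pos by (simp add: \<zeta>_def mat_trace_one)
  note Zi = subgroup.m_inv_closed[OF ker_a_subgroup]
  have inv1: "\<zeta> x * \<zeta> (inv x) = 1" if "x \<in> ker_a" for x
    using mult[OF that Zi[OF that]] N1[OF one_ker_ac] that by simp
  have "(\<Sum>z\<in>forms. \<Sum>x\<in>ker_a. \<zeta> (inv x) * form_char z x) = (\<Sum>x\<in>ker_a. \<zeta> (inv x) * (\<Sum>z\<in>forms. form_char z x))"
    by (subst sum.swap) (simp add: sum_distrib_left)
  also have "\<dots> = (\<Sum>x\<in>ker_a. if x \<in> ker_ac then of_nat (card forms) else 0)"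
  proof (rule sum.cong[OF refl])
    fix x assume x: "x \<in> ker_a"
    show "\<zeta> (inv x) * (\<Sum>z\<in>forms. form_char z x) = (if x \<in> ker_ac then of_nat (card forms) else 0)"
      using N1[OF subgroup.m_inv_closed[OF ker_ac_subgroup, of x]] by (simp add: sum_form_char[OF x])
  qed
  also have "\<dots> = of_nat (card {x \<in> ker_a. x \<in> ker_ac} * card forms)"
    using finite_ker_a by (simp add: sum.inter_filter[symmetric])
  also have "\<dots> \<noteq> (0::complex)"
  proof -
    have "card {x \<in> ker_a. x \<in> ker_ac} > 0"
      using finite_ker_a one_ker_ac one_ker_a by (auto simp: card_gt_0_iff intro!: exI[of _ \<one>])
    then show ?thesis using F.zero_closed by (auto simp: forms_def card_PiE)
  qed
  finally obtain z where z: "z \<in> forms" "(\<Sum>x\<in>ker_a. \<zeta> (inv x) * form_char z x) \<noteq> 0"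
    by (meson sum.not_neutral_contains_not_neutral)
  have one: "\<zeta> (inv x) * form_char z x = 1" if x: "x \<in> ker_a" for x
  proof (rule ccontr)
    assume ne: "\<zeta> (inv x) * form_char z x \<noteq> 1"
    have "(\<Sum>y\<in>ker_a. \<zeta> (inv y) * form_char z y) = 0"
    proof (rule hom_sum_zero[where \<mu>="\<lambda>y. \<zeta> (inv y) * form_char z y" and x=x, OF ker_a_subgroup _ x ne])
      fix x y assume x: "x \<in> ker_a" and y: "y \<in> ker_a"
      have "inv (x \<otimes> y) = inv y \<otimes> inv x" using x y by (intro inv_mult_group) auto
      then show "\<zeta> (inv (x \<otimes> y)) * form_char z (x \<otimes> y) = \<zeta> (inv x) * form_char z x * (\<zeta> (inv y) * form_char z y)"
        using mult[OF Zi[OF y] Zi[OF x]] x y z(1) by (simp add: form_char_mult)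
    qed
    then show False using z(2) by simp
  qed
  have "\<zeta> x = form_char z x" if x: "x \<in> ker_a" for x
  proof -
    have "\<zeta> x = \<zeta> x * (\<zeta> (inv x) * form_char z x)" using one[OF x] by simp
    also have "\<dots> = form_char z x" using inv1[OF x] by simp
    finally show ?thesis .
  qed
  then have "central d \<rho> z" using irr scalar by (simp add: central_def)
  then show ?thesis using z(1) by blast
qed

section \<open>The radical of the form and the degree\<close>

lemma coord_fibre_card:
  assumes x: "x \<in> vecs"
  shows "card {g \<in> carrier G. coord g = x} = card ker_a"
proof -
  obtain g0 where g0: "g0 \<in> carrier G" "\<And>i. i < n \<Longrightarrow> a i g0 = x i"
    using coords_surj[of x "\<lambda>_. \<zero>\<^bsub>F\<^esub>"] vecs_in[OF x] by auto
  have coord_iff: "coord g = x \<longleftrightarrow> (\<forall>i<n. a i g = x i)" for g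
    using x by (auto simp: coord_def vecs_def fun_eq_iff PiE_def extensional_def)
  have "bij_betw ((\<otimes>) g0) ker_a {g \<in> carrier G. coord g = x}"
  proof (rule bij_betwI[where g="(\<otimes>) (inv g0)"])
    show "(\<otimes>) g0 \<in> ker_a \<rightarrow> {g \<in> carrier G. coord g = x}"
      using g0 vecs_in[OF x] by (auto simp: coord_iff a_mult)
    show "(\<otimes>) (inv g0) \<in> {g \<in> carrier G. coord g = x} \<rightarrow> ker_a"
    proof
      fix g assume "g \<in> {g \<in> carrier G. coord g = x}"
      then have g: "g \<in> carrier G" "\<And>i. i < n \<Longrightarrow> a i g = x i" by (auto simp: coord_iff)
      show "inv g0 \<otimes> g \<in> ker_a"
        using g g0 vecs_in[OF x] by (intro ker_aI) (auto simp: a_mult a_inv F.l_neg)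
    qed
  qed (use g0 in \<open>auto simp: m_assoc[symmetric]\<close>)
  then show ?thesis by (rule bij_betw_same_card[symmetric])
qed

lemma coord_preimage_card:
  assumes T: "T \<subseteq> vecs"
  shows "card {g \<in> carrier G. coord g \<in> T} = card T * card ker_a"
proof -
  have finT: "finite T" using T finite_vecs by (rule finite_subset)
  have "{g \<in> carrier G. coord g \<in> T} = (\<Union>x\<in>T. {g \<in> carrier G. coord g = x})" by auto
  also have "card \<dots> = (\<Sum>x\<in>T. card {g \<in> carrier G. coord g = x})"
    using finT by (intro card_UN_disjoint) auto
  also have "\<dots> = (\<Sum>x\<in>T. card ker_a)" using T by (intro sum.cong refl coord_fibre_card) auto
  finally show ?thesis by simp
qed

lemma card_carrier: "card (carrier G) = card vecs * card ker_a"
proof -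
  have "{g \<in> carrier G. coord g \<in> vecs} = carrier G" by auto
  then show ?thesis using coord_preimage_card[of vecs] by simp
qed

lemma path_left_in: "z \<in> forms \<Longrightarrow> x \<in> vecs \<Longrightarrow> j < n \<Longrightarrow> path_left F z x j \<in> carrier F"
  using forms_in[of z "j - 1"] vecs_in[of x "j - 1"] by (auto simp: path_left_def)

lemma path_right_in: "z \<in> forms \<Longrightarrow> x \<in> vecs \<Longrightarrow> j < n \<Longrightarrow> path_right F n z x j \<in> carrier F"
  using forms_in[of z j] vecs_in[of x "Suc j"] by (auto simp: path_right_def)

text \<open>Both pairings are sorted by the coordinate \<open>a j h\<close>. In
  \<open>cross z g h\<close> the coordinate of \<open>h\<close> is shifted, so the product starts at
  \<open>j = 1\<close>; in \<open>cross z h g\<close> it is not, so the last \<open>j\<close> drops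
  out. These two ends are the zero cases of \<open>path_left\<close> and
  \<open>path_right\<close>.\<close>

lemma cross_eq_path:
  assumes z: "z \<in> forms" and g: "g \<in> carrier G" and h: "h \<in> carrier G"
  shows "cross z g h = (\<Prod>j<n. \<theta> (path_left F z (coord g) j \<otimes>\<^bsub>F\<^esub> a j h))"
    and "cross z h g = (\<Prod>j<n. \<theta> (path_right F n z (coord g) j \<otimes>\<^bsub>F\<^esub> a j h))"
proof -
  have coord: "coord g i = a i g" if "i < n" for i using that by (simp add: coord_def)
  show "cross z g h = (\<Prod>j<n. \<theta> (path_left F z (coord g) j \<otimes>\<^bsub>F\<^esub> a j h))"
  proof (cases n)
    case 0
    then show ?thesis unfolding cross_def by simp
  next
    case (Suc m)
    have "(\<Prod>j<Suc m. \<theta> (path_left F z (coord g) j \<otimes>\<^bsub>F\<^esub> a j h)) =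
        (\<Prod>j<m. \<theta> (path_left F z (coord g) (Suc j) \<otimes>\<^bsub>F\<^esub> a (Suc j) h))"
      using h Suc by (subst prod.lessThan_Suc_shift) (simp add: path_left_def)
    also have "\<dots> = cross z g h"
      using g h Suc forms_in[OF z] coord unfolding cross_def
      by (intro prod.cong) (auto simp: path_left_def F.m_assoc)
    finally show ?thesis by (simp add: Suc)
  qed
  show "cross z h g = (\<Prod>j<n. \<theta> (path_right F n z (coord g) j \<otimes>\<^bsub>F\<^esub> a j h))"
  proof (cases n)
    case 0
    then show ?thesis unfolding cross_def by simp
  next
    case (Suc m)
    have "(\<Prod>j<Suc m. \<theta> (path_right F n z (coord g) j \<otimes>\<^bsub>F\<^esub> a j h)) =
        (\<Prod>j<m. \<theta> (path_right F n z (coord g) j \<otimes>\<^bsub>F\<^esub> a j h))"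
      unfolding prod.lessThan_Suc using h Suc a_in[of m h] by (simp add: path_right_def)
    also have "\<dots> = cross z h g"
      using g h Suc forms_in[OF z] coord unfolding cross_def
      by (intro prod.cong) (auto simp: path_right_def F.m_ac(1) F.m_comm[of "a (Suc _) g"])
    finally show ?thesis by (simp add: Suc)
  qed
qed

text \<open>The condition on all \<open>h\<close> splits into one linear equation per coordinate:
  testing with an \<open>h\<close> having a single nonzero coordinate \<open>t\<close> isolates the
  \<open>j\<close>-th factor, and varying \<open>t\<close> removes \<theta> by
  \<open>\<theta>_separates\<close>.\<close>

lemma centre_eq:
  assumes z: "z \<in> forms"
  shows "centre z = {g \<in> carrier G. coord g \<in> path_radical F n z}"
proof -
  have "(\<forall>h\<in>carrier G. cross z g h = cross z h g) \<longleftrightarrow> coord g \<in> path_radical F n z"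
    if g: "g \<in> carrier G" for g
  proof
    assume "coord g \<in> path_radical F n z"
    then have "path_left F z (coord g) j = path_right F n z (coord g) j" if "j < n" for j
      using that by (simp add: path_radical_def)
    then show "\<forall>h\<in>carrier G. cross z g h = cross z h g"
      using cross_eq_path[OF z g] by auto
  next
    assume eq: "\<forall>h\<in>carrier G. cross z g h = cross z h g"
    have "path_left F z (coord g) j = path_right F n z (coord g) j" if j: "j < n" for j
    proof (rule \<theta>_separates)
      show inl: "path_left F z (coord g) j \<in> carrier F" and inr: "path_right F n z (coord g) j \<in> carrier F"
        using z g j by (auto intro: path_left_in path_right_in)
      fix t assume t: "t \<in> carrier F"
      have "\<exists>h\<in>carrier G. (\<forall>i<n. a i h = (if i = j then t else \<zero>\<^bsub>F\<^esub>)) \<and> (\<forall>i<n - 1. c i h = \<zero>\<^bsub>F\<^esub>)"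
        by (rule coords_surj) (use t in auto)
      then obtain h where h: "h \<in> carrier G" "\<And>i. i < n \<Longrightarrow> a i h = (if i = j then t else \<zero>\<^bsub>F\<^esub>)"
        by blast
      have single: "(\<Prod>i<n. \<theta> (p i \<otimes>\<^bsub>F\<^esub> a i h)) = \<theta> (p j \<otimes>\<^bsub>F\<^esub> t)"
        if p: "\<And>i. i < n \<Longrightarrow> p i \<in> carrier F" for p
      proof -
        have "(\<Prod>i<n. \<theta> (p i \<otimes>\<^bsub>F\<^esub> a i h)) = (\<Prod>i<n. if i = j then \<theta> (p j \<otimes>\<^bsub>F\<^esub> t) else 1)"
          using p by (intro prod.cong) (auto simp: h)
        then show ?thesis using j by simp
      qed
      have "\<theta> (path_left F z (coord g) j \<otimes>\<^bsub>F\<^esub> t) = cross z g h"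
        unfolding cross_eq_path(1)[OF z g h(1)]
        by (rule single[symmetric]) (use z g in \<open>auto intro: path_left_in\<close>)
      also have "\<dots> = cross z h g" using eq h by blast
      also have "\<dots> = \<theta> (path_right F n z (coord g) j \<otimes>\<^bsub>F\<^esub> t)"
        unfolding cross_eq_path(2)[OF z g h(1)]
        by (rule single) (use z g in \<open>auto intro: path_right_in\<close>)
      finally show "\<theta> (path_left F z (coord g) j \<otimes>\<^bsub>F\<^esub> t) = \<theta> (path_right F n z (coord g) j \<otimes>\<^bsub>F\<^esub> t)" .
    qed
    then show "coord g \<in> path_radical F n z"
      using coord_in[OF g] by (simp add: path_radical_def vecs_def)
  qed
  then show ?thesis by (auto simp: centre_def)
qed

lemma path_radical_sub: "path_radical F n z \<subseteq> vecs"
  by (auto simp: path_radical_def vecs_def)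

lemma card_centre: "z \<in> forms \<Longrightarrow> card (centre z) = card (path_radical F n z) * card ker_a"
  by (simp add: centre_eq coord_preimage_card path_radical_sub)

lemma central_degree:
  assumes z: "z \<in> forms" and cen: "central d \<rho> z"
  shows "d^2 * card (path_radical F n z) = card (carrier F) ^ n"
proof -
  have "(d^2 * card (path_radical F n z)) * card ker_a = card vecs * card ker_a"
    using central_props(2)[OF z cen] card_centre[OF z] card_carrier by (simp add: mult.assoc)
  then show ?thesis using card_ker_a_pos by (simp add: card_vecs)
qed

section \<open>Enumeration of the Heisenberg characters\<close>

definition form_deg :: "(nat \<Rightarrow> 'f) \<Rightarrow> nat" where
  "form_deg z = (SOME d. \<exists>\<rho>. central d \<rho> z)"
definition form_rep :: "(nat \<Rightarrow> 'f) \<Rightarrow> 'g \<Rightarrow> complex mat" where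
  "form_rep z = (SOME \<rho>. central (form_deg z) \<rho> z)"
definition heis_char :: "(nat \<Rightarrow> 'f) \<Rightarrow> (nat \<Rightarrow> 'f) \<Rightarrow> 'g \<Rightarrow> complex" where
  "heis_char z u = restrict (\<lambda>g. lin_char u g * mat_trace (form_rep z g)) (carrier G)"

lemma central_form_rep: "z \<in> forms \<Longrightarrow> central (form_deg z) (form_rep z) z"
proof -
  assume "z \<in> forms"
  then have "\<exists>\<rho>. central (form_deg z) \<rho> z"
    unfolding form_deg_def by (intro someI_ex[of "\<lambda>d. \<exists>\<rho>. central d \<rho> z"] exists_central)
  then show ?thesis unfolding form_rep_def by (rule someI_ex)
qed

lemmas form_deg_props = central_props[OF _ central_form_rep] central_degree[OF _ central_form_rep]

lemma triple_commutators_ker_ac: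
  "commutator_subgroup G (carrier G) (commutator_subgroup G (carrier G) (carrier G)) = ker_ac"
  unfolding triple_commutators ker_ac_def ker_a_def by auto

lemma heis_char_one:
  assumes "z \<in> forms" "u \<in> vecs"
  shows "heis_char z u \<one> = of_nat (form_deg z)"
  using form_deg_props(5)[OF assms(1) assms(1) one_ker_a] assms by (simp add: heis_char_def)

text \<open>The kernel condition concerns character values only; \<open>kernel_from_trace\<close>
  turns it into triviality of the representation on \<open>ker_ac\<close>, after which a form exists
  and the character is a twist of the chosen one. Twists are trivial on \<open>ker_a\<close>, so
  conversely the kernel condition survives twisting.\<close>

lemma heisenberg_characters_eq:
  "heisenberg_characters G = (\<Union>z\<in>forms. heis_char z ` vecs)"
proof (intro equalityI subsetI)
  fix \<chi> assume "\<chi> \<in> heisenberg_characters G"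
  then obtain d \<rho> where irr: "irreducible_representation G d \<rho>" and \<chi>: "\<chi> = character_of G \<rho>"
    and ker: "ker_ac \<subseteq> character_kernel G \<chi>"
    by (auto simp: heisenberg_characters_def irreducible_characters_def triple_commutators_ker_ac)
  interpret irrep G d \<rho> by unfold_locales (rule irr)
  have tr: "mat_trace (\<rho> x) = of_nat d" if x: "x \<in> ker_ac" for x
  proof -
    have "x \<in> carrier G" "\<chi> x = \<chi> \<one>" using ker x by (auto simp: character_kernel_def)
    then show ?thesis by (simp add: \<chi> character_of_def mat_trace_one)
  qed
  have "\<rho> x = 1\<^sub>m d" if x: "x \<in> ker_ac" for x
  proof (rule kernel_from_trace[OF ker_ac_subgroup _ _ x])
  qed (use ker_ac_normal tr in auto)
  then obtain z where z: "z \<in> forms" and cen: "central d \<rho> z" using exists_form[OF irr] by blast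
  obtain u where u: "u \<in> vecs" "\<forall>g\<in>carrier G. mat_trace (\<rho> g) = lin_char u g * mat_trace (form_rep z g)"
    using central_unique_up_to_lin_char[OF z central_form_rep[OF z] cen] by blast
  then have "\<chi> = heis_char z u" unfolding \<chi> character_of_def heis_char_def by (auto intro!: restrict_ext)
  then show "\<chi> \<in> (\<Union>z\<in>forms. heis_char z ` vecs)" using z u by blast
next
  fix \<chi> assume "\<chi> \<in> (\<Union>z\<in>forms. heis_char z ` vecs)"
  then obtain z u where z: "z \<in> forms" and u: "u \<in> vecs" and \<chi>: "\<chi> = heis_char z u" by blast
  define \<sigma> where "\<sigma> = (\<lambda>g. lin_char u g \<cdot>\<^sub>m form_rep z g)"
  have cen: "central (form_deg z) \<sigma> z" unfolding \<sigma>_def by (rule central_twist[OF central_form_rep[OF z] u])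
  interpret R: irrep G "form_deg z" "form_rep z" using central_form_rep[OF z] by unfold_locales (simp add: central_def)
  have "\<chi> = character_of G \<sigma>"
    unfolding \<chi> heis_char_def character_of_def \<sigma>_def
    using mat_trace_smult[OF R.rep_carrier] by (auto intro!: restrict_ext)
  then have "\<chi> \<in> irreducible_characters G"
    using cen unfolding irreducible_characters_def central_def by blast
  moreover have "ker_ac \<subseteq> character_kernel G \<chi>"
  proof
    fix x assume x: "x \<in> ker_ac"
    then have xZ: "x \<in> ker_a" by (rule ker_ac_ker_a)
    have "\<chi> x = of_nat (form_deg z)"
      using form_deg_props(5)[OF z z xZ] u z x xZ by (simp add: \<chi> heis_char_def)
    then show "x \<in> character_kernel G \<chi>" using xZ heis_char_one[OF z u] by (simp add: character_kernel_def \<chi>)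
  qed
  ultimately show "\<chi> \<in> heisenberg_characters G"
    by (simp add: heisenberg_characters_def triple_commutators_ker_ac)
qed

text \<open>The form is read off from the values on \<open>ker_a\<close>, where twists are
  invisible: the value at the identity gives the degree, and elements with a single nonzero
  \<open>c\<close> coordinate give the entries of \<open>z\<close>.\<close>

lemma heis_char_form_unique:
  assumes z: "z \<in> forms" "z' \<in> forms" and u: "u \<in> vecs" "u' \<in> vecs" and eq: "heis_char z u = heis_char z' u'"
  shows "z = z'"
proof -
  have form_deg: "form_deg z = form_deg z'" using heis_char_one[of z u] heis_char_one[of z' u'] z u eq by simp
  have form_char: "form_char z x = form_char z' x" if x: "x \<in> ker_a" for x
  proof -
    have "form_char z x * of_nat (form_deg z) = form_char z' x * of_nat (form_deg z')"
      using fun_cong[OF eq, of x] form_deg_props(5)[OF z(1) z(1) x] form_deg_props(5)[OF z(2) z(2) x] u x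
      by (simp add: heis_char_def)
    then show ?thesis using form_deg form_deg_props(1)[OF z(1) z(1)] by simp
  qed
  have "z i = z' i" if i: "i < n - 1" for i
  proof (rule \<theta>_separates)
    show "z i \<in> carrier F" "z' i \<in> carrier F" using z i by (auto intro: forms_in)
    fix t assume t: "t \<in> carrier F"
    have "\<exists>x\<in>carrier G. (\<forall>j<n. a j x = \<zero>\<^bsub>F\<^esub>) \<and> (\<forall>j<n - 1. c j x = (if j = i then t else \<zero>\<^bsub>F\<^esub>))"
      by (rule coords_surj) (use t in auto)
    then obtain x where x: "x \<in> carrier G" "\<And>j. j < n \<Longrightarrow> a j x = \<zero>\<^bsub>F\<^esub>"
      "\<And>j. j < n - 1 \<Longrightarrow> c j x = (if j = i then t else \<zero>\<^bsub>F\<^esub>)"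
      by blast
    have single: "form_char y x = \<theta> (y i \<otimes>\<^bsub>F\<^esub> t)" if y: "y \<in> forms" for y
    proof -
      have "form_char y x = (\<Prod>j<n - 1. if j = i then \<theta> (y i \<otimes>\<^bsub>F\<^esub> t) else 1)"
        unfolding form_char_def using forms_in[OF y] by (intro prod.cong) (auto simp: x)
      then show ?thesis using i by simp
    qed
    have "x \<in> ker_a" using x by (intro ker_aI) auto
    then show "\<theta> (z i \<otimes>\<^bsub>F\<^esub> t) = \<theta> (z' i \<otimes>\<^bsub>F\<^esub> t)"
      using form_char single[OF z(1)] single[OF z(2)] by metis
  qed
  then show ?thesis using z unfolding forms_def by (intro PiE_ext) auto
qed

text \<open>Traces are nonzero on \<open>centre z\<close> and vanish outside, so two twists agree
  exactly when the twisting characters agree on \<open>centre z\<close>. Computing the sum of their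
  correlations in two ways gives fibre size times \<open>card (centre z)\<close> on one side and the
  group order, \<open>(form_deg z)^2 * card (centre z)\<close>, on the other.\<close>

lemma heis_char_fibre_card:
  assumes z: "z \<in> forms" and u0: "u0 \<in> vecs"
  shows "card {u \<in> vecs. heis_char z u = heis_char z u0} = (form_deg z)^2"
proof -
  note K = centre_subgroup[OF z]
  have same: "heis_char z u = heis_char z u0 \<longleftrightarrow> (\<forall>g\<in>centre z. lin_char u0 g * lin_char u (inv g) = 1)" if u: "u \<in> vecs" for u
  proof -
    have lin_char_iff: "lin_char u0 g * lin_char u (inv g) = 1 \<longleftrightarrow> lin_char u g = lin_char u0 g" if g: "g \<in> carrier G" for g
      using lin_char_inv[OF u g] by (metis mult.commute mult_cancel_right mult_zero_left zero_neq_one)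
    have nz: "mat_trace (form_rep z g) \<noteq> 0" if g: "g \<in> centre z" for g
      using central_scalar(3)[OF z central_form_rep[OF z] g] by auto
    show ?thesis
    proof
      assume eq: "heis_char z u = heis_char z u0"
      show "\<forall>g\<in>centre z. lin_char u0 g * lin_char u (inv g) = 1"
      proof
        fix g assume g: "g \<in> centre z"
        then have gc: "g \<in> carrier G" by (rule centre_carrier)
        have "lin_char u g = lin_char u0 g" using fun_cong[OF eq, of g] gc nz[OF g] by (simp add: heis_char_def)
        then show "lin_char u0 g * lin_char u (inv g) = 1" using lin_char_iff[OF gc] by simp
      qed
    next
      assume one: "\<forall>g\<in>centre z. lin_char u0 g * lin_char u (inv g) = 1"
      have "lin_char u g * mat_trace (form_rep z g) = lin_char u0 g * mat_trace (form_rep z g)" if g: "g \<in> carrier G" for g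
      proof (cases "g \<in> centre z")
        case True
        then show ?thesis using one lin_char_iff[OF g] by simp
      next
        case False
        then show ?thesis using form_deg_props(3)[OF z z g] by simp
      qed
      then show "heis_char z u = heis_char z u0" unfolding heis_char_def by (auto intro!: restrict_ext)
    qed
  qed
  have inner: "(\<Sum>g\<in>centre z. lin_char u0 g * lin_char u (inv g)) = (if heis_char z u = heis_char z u0 then of_nat (card (centre z)) else 0)"
    if u: "u \<in> vecs" for u
  proof (cases "\<forall>g\<in>centre z. lin_char u0 g * lin_char u (inv g) = 1")
    case True
    then show ?thesis using same[OF u] by simp
  next
    case False
    then obtain g where g: "g \<in> centre z" "lin_char u0 g * lin_char u (inv g) \<noteq> 1" by blast
    have "(\<Sum>g\<in>centre z. lin_char u0 g * lin_char u (inv g)) = 0"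
    proof (rule hom_sum_zero[where \<mu>="\<lambda>g. lin_char u0 g * lin_char u (inv g)" and x=g, OF K _ g])
      fix x y assume "x \<in> centre z" "y \<in> centre z"
      then have xc: "x \<in> carrier G" and yc: "y \<in> carrier G" by (auto intro: centre_carrier)
      show "lin_char u0 (x \<otimes> y) * lin_char u (inv (x \<otimes> y)) = lin_char u0 x * lin_char u (inv x) * (lin_char u0 y * lin_char u (inv y))"
        using xc yc u u0 by (simp add: inv_mult_group lin_char_mult)
    qed
    then show ?thesis by (simp only: same[OF u] False if_False)
  qed
  have "of_nat (card {u \<in> vecs. heis_char z u = heis_char z u0} * card (centre z)) =
      (\<Sum>u\<in>vecs. if heis_char z u = heis_char z u0 then of_nat (card (centre z)) else (0::complex))"
    by (simp add: sum.inter_filter[symmetric])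
  also have "\<dots> = (\<Sum>u\<in>vecs. \<Sum>g\<in>centre z. lin_char u0 g * lin_char u (inv g))"
    by (rule sum.cong[OF refl inner[symmetric]])
  also have "\<dots> = of_nat (card vecs) * (\<Sum>g\<in>ker_a. lin_char u0 g)"
    using ker_a_sub_centre[OF z] by (intro sum_lin_char_inv[OF K]) auto
  also have "\<dots> = of_nat (card vecs * card ker_a)" using u0 by simp
  also have "card vecs * card ker_a = (form_deg z)^2 * card (centre z)"
    using form_deg_props(2)[OF z z] card_carrier by simp
  finally have "card {u \<in> vecs. heis_char z u = heis_char z u0} * card (centre z) = (form_deg z)^2 * card (centre z)"
    unfolding of_nat_eq_iff .
  moreover have "card (centre z) \<noteq> 0"
    using finite_centre[of z] ker_a_sub_centre[OF z one_ker_a] by auto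
  ultimately show ?thesis by simp
qed

text \<open>The \<open>q^n\<close> parameters fall into fibres of size
  \<open>(form_deg z)^2\<close>, and by \<open>central_degree\<close> the quotient is the size of
  the radical.\<close>

lemma card_heis_char_image:
  assumes z: "z \<in> forms"
  shows "card (heis_char z ` vecs) = card (path_radical F n z)"
proof -
  have "card vecs = (\<Sum>y\<in>heis_char z ` vecs. \<Sum>u\<in>{u \<in> vecs. heis_char z u = y}. 1)"
    using sum.image_gen[OF finite_vecs, of "\<lambda>_. 1::nat" "heis_char z"] by simp
  also have "\<dots> = (\<Sum>y\<in>heis_char z ` vecs. (form_deg z)^2)"
    using heis_char_fibre_card[OF z] by (intro sum.cong) auto
  finally have "(form_deg z)^2 * card (heis_char z ` vecs) = (form_deg z)^2 * card (path_radical F n z)"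
    using form_deg_props(6)[OF z z] by (auto simp: card_vecs mult.commute)
  then show ?thesis using form_deg_props(1)[OF z z] by auto
qed

lemma card_heis_char_union:
  assumes A: "A \<subseteq> forms"
  shows "card (\<Union>z\<in>A. heis_char z ` vecs) = (\<Sum>z\<in>A. card (path_radical F n z))"
proof -
  have "card (\<Union>z\<in>A. heis_char z ` vecs) = (\<Sum>z\<in>A. card (heis_char z ` vecs))"
  proof (rule card_UN_disjoint)
    show "finite A" using A finite_forms by (rule finite_subset)
    show "\<forall>i\<in>A. \<forall>j\<in>A. i \<noteq> j \<longrightarrow> heis_char i ` vecs \<inter> heis_char j ` vecs = {}"
      using heis_char_form_unique A by blast
  qed auto
  also have "\<dots> = (\<Sum>z\<in>A. card (path_radical F n z))"
    using A by (intro sum.cong refl card_heis_char_image) auto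
  finally show ?thesis .
qed

lemma finite_heisenberg_characters: "finite (heisenberg_characters G)"
  unfolding heisenberg_characters_eq by auto

lemma card_heisenberg_characters:
  "card (heisenberg_characters G) = (\<Sum>z\<in>{..<n - 1} \<rightarrow>\<^sub>E carrier F. card (path_radical F n z))"
  unfolding heisenberg_characters_eq using card_heis_char_union[of forms] by (simp add: forms_def)

text \<open>All characters with form \<open>z\<close> have the same degree, and its square is the
  index of the radical; this expresses the degree condition without mentioning
  representations.\<close>

lemma card_heisenberg_characters_degree:
  "card {\<chi> \<in> heisenberg_characters G. character_degree G \<chi> = of_nat m} =
    (\<Sum>z | z \<in> {..<n - 1} \<rightarrow>\<^sub>E carrier F \<and> m^2 * card (path_radical F n z) = card (carrier F) ^ n.
      card (path_radical F n z))"
proof -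
  have form_deg: "form_deg z = m \<longleftrightarrow> m^2 * card (path_radical F n z) = card (carrier F) ^ n" if z: "z \<in> forms" for z
  proof -
    have d: "(form_deg z)^2 * card (path_radical F n z) = card (carrier F) ^ n" by (rule form_deg_props(6)[OF z z])
    moreover have "card (path_radical F n z) \<noteq> 0" using d q_pos by (metis mult_zero_right power_not_zero less_numeral_extra(3))
    ultimately show ?thesis by (metis mult_cancel_right power2_eq_iff_nonneg zero_le)
  qed
  have "{\<chi> \<in> heisenberg_characters G. character_degree G \<chi> = of_nat m} =
      (\<Union>z\<in>{z \<in> forms. form_deg z = m}. heis_char z ` vecs)"
    unfolding heisenberg_characters_eq by (auto simp: character_degree_def heis_char_one)
  also have "card \<dots> = (\<Sum>z\<in>{z \<in> forms. form_deg z = m}. card (path_radical F n z))"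
    by (rule card_heis_char_union) auto
  also have "{z \<in> forms. form_deg z = m} =
      {z. z \<in> {..<n - 1} \<rightarrow>\<^sub>E carrier F \<and> m^2 * card (path_radical F n z) = card (carrier F) ^ n}"
    using form_deg by (auto simp: forms_def)
  finally show ?thesis .
qed

end

section \<open>Counting forms by rank\<close>

text \<open>Half the rank of the alternating form of \<open>z\<close>: a nonzero last entry \<open>z n\<close> splits off a
  hyperbolic plane spanned by the last two unit vectors.\<close>

fun half_rank :: "('f, 'c) ring_scheme \<Rightarrow> nat \<Rightarrow> (nat \<Rightarrow> 'f) \<Rightarrow> nat" where
  "half_rank F 0 z = 0"
| "half_rank F (Suc 0) z = 0"
| "half_rank F (Suc (Suc n)) z =
     (if z n = \<zero>\<^bsub>F\<^esub> then half_rank F (Suc n) z else Suc (half_rank F n z))"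

lemma mem_PiE_lessThan:
  "x \<in> {..<n} \<rightarrow>\<^sub>E A \<longleftrightarrow> (\<forall>i<n. x i \<in> A) \<and> (\<forall>i. \<not> i < n \<longrightarrow> x i = undefined)"
  for n :: nat
  by (simp add: PiE_iff extensional_def Ball_def)

lemma half_rank_cong:
  assumes "\<And>i. i < n - 1 \<Longrightarrow> z i = z' i"
  shows "half_rank F n z = half_rank F n z'"
  using assms
proof (induction F n z rule: half_rank.induct)
  case (3 F n z)
  have "z n = z' n" by (rule "3.prems") simp
  moreover have "half_rank F (Suc n) z = half_rank F (Suc n) z'" if "z n = \<zero>\<^bsub>F\<^esub>"
    by (rule "3.IH"(1)[OF that]) (rule "3.prems", simp)
  moreover have "half_rank F n z = half_rank F n z'" if "z n \<noteq> \<zero>\<^bsub>F\<^esub>"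
    by (rule "3.IH"(2)[OF that]) (rule "3.prems", simp)
  ultimately show ?case by simp
qed simp_all

lemma half_rank_le: "2 * half_rank F n z \<le> n"
proof (induction F n z rule: half_rank.induct)
  case (3 F n z)
  then show ?case by (cases "z n = \<zero>\<^bsub>F\<^esub>") simp_all
qed simp_all

context field
begin

text \<open>The entry \<open>z n\<close> is the only link between the coordinates \<open>n\<close>
  and \<open>Suc n\<close>. When it vanishes, the last equation is empty and equation
  \<open>n\<close> loses its right side, so the last coordinate is free and the others form the
  smaller radical.\<close>

lemma path_radical_Suc_zero:
  assumes z: "\<And>i. i < Suc n \<Longrightarrow> z i \<in> carrier R" and zn: "z n = \<zero>"
  shows "bij_betw (\<lambda>(x, t). x(Suc n := t)) (path_radical R (Suc n) z \<times> carrier R)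
    (path_radical R (Suc (Suc n)) z)"
proof (rule bij_betwI[where g="\<lambda>x. (x(Suc n := undefined), x (Suc n))"])
  show "(\<lambda>(x, t). x(Suc n := t)) \<in> path_radical R (Suc n) z \<times> carrier R \<rightarrow> path_radical R (Suc (Suc n)) z"
  proof (clarify)
    fix x t assume x: "x \<in> path_radical R (Suc n) z" and t: "t \<in> carrier R"
    let ?y = "x(Suc n := t)"
    have xc: "x i \<in> carrier R" if "i < Suc n" for i using x that by (auto simp: path_radical_def)
    have "path_left R z ?y j = path_right R (Suc (Suc n)) z ?y j" if j: "j < Suc (Suc n)" for j
    proof -
      consider "j < n" | "j = n" | "j = Suc n" using j by linarith
      then show ?thesis
      proof cases
        case 1
        then have "path_left R z x j = path_right R (Suc n) z x j" using x by (simp add: path_radical_def)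
        then show ?thesis using 1 by (auto simp: path_left_def path_right_def)
      next
        case 2
        have "path_left R z x n = path_right R (Suc n) z x n" using x by (simp add: path_radical_def)
        then show ?thesis using 2 t zn by (auto simp: path_left_def path_right_def)
      next
        case 3
        then show ?thesis using zn xc[of n] by (simp add: path_left_def path_right_def)
      qed
    qed
    moreover have "?y \<in> {..<Suc (Suc n)} \<rightarrow>\<^sub>E carrier R"
      using x t by (auto simp: path_radical_def mem_PiE_lessThan less_Suc_eq)
    ultimately show "?y \<in> path_radical R (Suc (Suc n)) z" by (simp add: path_radical_def)
  qed
next
  show "(\<lambda>x. (x(Suc n := undefined), x (Suc n))) \<in> path_radical R (Suc (Suc n)) z \<rightarrow> path_radical R (Suc n) z \<times> carrier R"
  proof
    fix y assume y: "y \<in> path_radical R (Suc (Suc n)) z"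
    let ?x = "y(Suc n := undefined)"
    have yc: "y i \<in> carrier R" if "i < Suc (Suc n)" for i using y that by (auto simp: path_radical_def)
    have "path_left R z ?x j = path_right R (Suc n) z ?x j" if j: "j < Suc n" for j
    proof -
      have "path_left R z y j = path_right R (Suc (Suc n)) z y j" using y j by (simp add: path_radical_def)
      then show ?thesis using j zn yc[of "Suc n"]
        by (cases "j = n") (auto simp: path_left_def path_right_def)
    qed
    moreover have "?x \<in> {..<Suc n} \<rightarrow>\<^sub>E carrier R"
      using y by (auto simp: path_radical_def mem_PiE_lessThan less_Suc_eq)
    ultimately show "(?x, y (Suc n)) \<in> path_radical R (Suc n) z \<times> carrier R"
      using yc[of "Suc n"] by (simp add: path_radical_def)
  qed
next
  fix p assume "p \<in> path_radical R (Suc n) z \<times> carrier R"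
  then obtain x t where p: "p = (x, t)" and x: "x \<in> path_radical R (Suc n) z" by blast
  have "x (Suc n) = undefined" using x by (simp add: path_radical_def mem_PiE_lessThan)
  then show "(\<lambda>x. (x(Suc n := undefined), x (Suc n))) ((\<lambda>(x, t). x(Suc n := t)) p) = p"
    by (simp add: p fun_upd_idem)
next
  fix y assume "y \<in> path_radical R (Suc (Suc n)) z"
  show "(\<lambda>(x, t). x(Suc n := t)) ((\<lambda>x. (x(Suc n := undefined), x (Suc n))) y) = y" by simp
qed

text \<open>The last equation reads \<open>z n * x n = 0\<close> and forces \<open>x n = 0\<close>;
  equation \<open>n\<close> then determines the last coordinate. In equation \<open>n - 1\<close>
  the zero at \<open>n\<close> acts as the end of the shorter path, so the first \<open>n\<close>
  coordinates range exactly over the radical of size \<open>n\<close>.\<close>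

lemma path_radical_Suc_nonzero:
  assumes z: "\<And>i. i < Suc n \<Longrightarrow> z i \<in> carrier R" and zn: "z n \<noteq> \<zero>"
  shows "bij_betw (\<lambda>x. x(n := \<zero>, Suc n := inv (z n) \<otimes> path_left R z x n)) (path_radical R n z)
    (path_radical R (Suc (Suc n)) z)"
proof (rule bij_betwI[where g="\<lambda>x. x(n := undefined, Suc n := undefined)"])
  have zc: "z n \<in> carrier R" using z by simp
  have iz: "inv (z n) \<in> carrier R" "z n \<otimes> inv (z n) = \<one>" "inv (z n) \<otimes> z n = \<one>"
    using zc zn field_Units by (auto intro: Units_r_inv Units_l_inv)
  have solve: "z n \<otimes> s = p \<longleftrightarrow> s = inv (z n) \<otimes> p" if "s \<in> carrier R" "p \<in> carrier R" for s p
    using that iz zc by (metis m_assoc l_one)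
  show "(\<lambda>x. x(n := \<zero>, Suc n := inv (z n) \<otimes> path_left R z x n)) \<in> path_radical R n z \<rightarrow> path_radical R (Suc (Suc n)) z"
  proof
    fix x assume x: "x \<in> path_radical R n z"
    let ?p = "path_left R z x n"
    let ?y = "x(n := \<zero>, Suc n := inv (z n) \<otimes> ?p)"
    have xc: "x i \<in> carrier R" if "i < n" for i using x that by (auto simp: path_radical_def)
    have p: "?p \<in> carrier R" using xc[of "n - 1"] z[of "n - 1"] by (auto simp: path_left_def)
    have "path_left R z ?y j = path_right R (Suc (Suc n)) z ?y j" if j: "j < Suc (Suc n)" for j
    proof -
      consider "j < n" | "j = n" | "j = Suc n" using j by linarith
      then show ?thesis
      proof cases
        case 1
        then have "path_left R z x j = path_right R n z x j" using x by (simp add: path_radical_def)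
        then show ?thesis using 1 z[of j] by (cases "Suc j = n") (auto simp: path_left_def path_right_def)
      next
        case 2
        have "path_left R z ?y n = ?p" by (auto simp: path_left_def)
        moreover have "path_right R (Suc (Suc n)) z ?y n = z n \<otimes> (inv (z n) \<otimes> ?p)"
          by (simp add: path_right_def)
        moreover have "\<dots> = ?p" using solve[of "inv (z n) \<otimes> ?p" ?p] p iz by simp
        ultimately show ?thesis using 2 by simp
      next
        case 3
        then show ?thesis using zc by (simp add: path_left_def path_right_def)
      qed
    qed
    moreover have "?y \<in> {..<Suc (Suc n)} \<rightarrow>\<^sub>E carrier R"
      using x p iz by (auto simp: path_radical_def mem_PiE_lessThan less_Suc_eq)
    ultimately show "?y \<in> path_radical R (Suc (Suc n)) z" by (simp add: path_radical_def)
  qed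
  have last: "y n = \<zero>" "y (Suc n) = inv (z n) \<otimes> path_left R z y n"
    if y: "y \<in> path_radical R (Suc (Suc n)) z" for y
  proof -
    have yc: "y i \<in> carrier R" if "i < Suc (Suc n)" for i using y that by (auto simp: path_radical_def)
    have eq: "path_left R z y j = path_right R (Suc (Suc n)) z y j" if "j < Suc (Suc n)" for j
      using y that by (simp add: path_radical_def)
    show "y n = \<zero>"
      using eq[of "Suc n"] zc zn yc[of n] integral by (auto simp: path_left_def path_right_def)
    have p: "path_left R z y n \<in> carrier R"
      using yc[of "n - 1"] z[of "n - 1"] by (auto simp: path_left_def)
    show "y (Suc n) = inv (z n) \<otimes> path_left R z y n"
      using eq[of n] solve[OF yc[of "Suc n"] p] by (simp add: path_right_def)
  qed
  show "(\<lambda>x. x(n := undefined, Suc n := undefined)) \<in> path_radical R (Suc (Suc n)) z \<rightarrow> path_radical R n z"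
  proof
    fix y assume y: "y \<in> path_radical R (Suc (Suc n)) z"
    let ?x = "y(n := undefined, Suc n := undefined)"
    have "path_left R z ?x j = path_right R n z ?x j" if j: "j < n" for j
    proof -
      have "path_left R z y j = path_right R (Suc (Suc n)) z y j" using y j by (simp add: path_radical_def)
      then show ?thesis using j last(1)[OF y] z[of j]
        by (cases "Suc j = n") (auto simp: path_left_def path_right_def)
    qed
    moreover have "?x \<in> {..<n} \<rightarrow>\<^sub>E carrier R"
      using y by (auto simp: path_radical_def mem_PiE_lessThan less_Suc_eq)
    ultimately show "?x \<in> path_radical R n z" by (simp add: path_radical_def)
  qed
  fix y assume y: "y \<in> path_radical R (Suc (Suc n)) z"
  have "path_left R z (y(n := undefined, Suc n := undefined)) n = path_left R z y n"
    by (auto simp: path_left_def)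
  then show "(y(n := undefined, Suc n := undefined))(n := \<zero>,
      Suc n := inv (z n) \<otimes> path_left R z (y(n := undefined, Suc n := undefined)) n) = y"
    using last[OF y] by (simp add: fun_eq_iff)
next
  fix x assume x: "x \<in> path_radical R n z"
  have "x n = undefined" "x (Suc n) = undefined"
    using x by (simp_all add: path_radical_def mem_PiE_lessThan)
  then show "(x(n := \<zero>, Suc n := inv (z n) \<otimes> path_left R z x n))(n := undefined, Suc n := undefined) = x"
    by (simp add: fun_eq_iff)
qed

lemma card_path_radical:
  assumes fin: "finite (carrier R)" and z: "\<And>i. i < n - 1 \<Longrightarrow> z i \<in> carrier R"
  shows "card (path_radical R n z) = card (carrier R) ^ (n - 2 * half_rank R n z)"
  using z
proof (induction n rule: less_induct)
  case (less n)
  consider "n = 0" | "n = 1" | m where "n = Suc (Suc m)" by (metis One_nat_def not0_implies_Suc)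
  then show ?case
  proof cases
    case 1
    then show ?thesis by (simp add: path_radical_def)
  next
    case 2
    have "path_radical R (Suc 0) z = {..<Suc 0} \<rightarrow>\<^sub>E carrier R"
      by (auto simp: path_radical_def path_left_def path_right_def)
    then show ?thesis using 2 by (simp add: card_PiE)
  next
    case (3 m)
    have z: "z i \<in> carrier R" if "i < Suc m" for i using less.prems 3 that by simp
    show ?thesis
    proof (cases "z m = \<zero>")
      case True
      have "card (path_radical R n z) = card (path_radical R (Suc m) z \<times> carrier R)"
        unfolding 3 by (rule bij_betw_same_card[symmetric, OF path_radical_Suc_zero[of m z, OF z True]])
      also have "\<dots> = card (carrier R) ^ (Suc m - 2 * half_rank R (Suc m) z) * card (carrier R)"
        using less.IH[of "Suc m"] z 3 by (simp add: card_cartesian_product)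
      also have "\<dots> = card (carrier R) ^ Suc (Suc m - 2 * half_rank R (Suc m) z)" by simp
      also have "Suc (Suc m - 2 * half_rank R (Suc m) z) = n - 2 * half_rank R n z"
        using half_rank_le[of R "Suc m" z] True 3 by simp
      finally show ?thesis .
    next
      case False
      have "card (path_radical R n z) = card (path_radical R m z)"
        unfolding 3 by (rule bij_betw_same_card[symmetric, OF path_radical_Suc_nonzero[of m z, OF z False]])
      then show ?thesis using less.IH[of m] z 3 False by simp
    qed
  qed
qed

text \<open>Since \<open>P\<close> sees only the first \<open>m\<close> entries, the last entry is
  independent of it. With \<open>Q\<close> always true this accounts for a free last entry.\<close>

lemma card_PiE_last:
  assumes fin: "finite (carrier R)"
    and P: "\<And>z z'. (\<And>i. i < m \<Longrightarrow> z i = z' i) \<Longrightarrow> P z \<longleftrightarrow> P z'"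
  shows "card {z \<in> {..<Suc m} \<rightarrow>\<^sub>E carrier R. P z \<and> Q (z m)} =
    card {z \<in> {..<m} \<rightarrow>\<^sub>E carrier R. P z} * card {t \<in> carrier R. Q t}"
proof -
  have "bij_betw (\<lambda>(z, t). z(m := t)) ({z \<in> {..<m} \<rightarrow>\<^sub>E carrier R. P z} \<times> {t \<in> carrier R. Q t})
      {z \<in> {..<Suc m} \<rightarrow>\<^sub>E carrier R. P z \<and> Q (z m)}"
  proof (rule bij_betwI[where g="\<lambda>z. (z(m := undefined), z m)"])
    have upd: "P (z(m := t)) \<longleftrightarrow> P z" for z t by (rule P) simp
    show "(\<lambda>(z, t). z(m := t)) \<in> {z \<in> {..<m} \<rightarrow>\<^sub>E carrier R. P z} \<times> {t \<in> carrier R. Q t}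
        \<rightarrow> {z \<in> {..<Suc m} \<rightarrow>\<^sub>E carrier R. P z \<and> Q (z m)}"
      by (auto simp: upd mem_PiE_lessThan less_Suc_eq)
    show "(\<lambda>z. (z(m := undefined), z m)) \<in> {z \<in> {..<Suc m} \<rightarrow>\<^sub>E carrier R. P z \<and> Q (z m)}
        \<rightarrow> {z \<in> {..<m} \<rightarrow>\<^sub>E carrier R. P z} \<times> {t \<in> carrier R. Q t}"
      by (auto simp: upd mem_PiE_lessThan less_Suc_eq)
  qed (auto simp: mem_PiE_lessThan)
  then show ?thesis by (simp add: bij_betw_same_card[symmetric] card_cartesian_product)
qed

section \<open>Recursion and closed form for the number of forms of given rank\<close>

definition form_count :: "nat \<Rightarrow> nat \<Rightarrow> nat" where
  "form_count n e = card {z \<in> {..<n - 1} \<rightarrow>\<^sub>E carrier R. half_rank R n z = e}"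

lemma form_count_1: "form_count (Suc 0) e = (if e = 0 then 1 else 0)"
  by (simp add: form_count_def)

lemma form_count_eq_0: "n < 2 * e \<Longrightarrow> form_count n e = 0"
proof -
  assume "n < 2 * e"
  then have "half_rank R n z \<noteq> e" for z using half_rank_le[of R n z] by linarith
  then show ?thesis by (simp add: form_count_def)
qed

text \<open>The second term stays a cardinality because its \<open>z\<close> has \<open>m\<close>
  entries whereas \<open>half_rank R m\<close> reads \<open>m - 1\<close> of them: for
  \<open>m \<ge> 1\<close> one entry is free and contributes a factor \<open>q\<close>, for
  \<open>m = 0\<close> there is no such entry.\<close>

lemma form_count_split:
  assumes fin: "finite (carrier R)"
  shows "form_count (Suc (Suc m)) e = form_count (Suc m) e +
    card {z \<in> {..<m} \<rightarrow>\<^sub>E carrier R. Suc (half_rank R m z) = e} * (card (carrier R) - 1)"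
proof -
  have "{z \<in> {..<Suc m} \<rightarrow>\<^sub>E carrier R. half_rank R (Suc (Suc m)) z = e} =
      {z \<in> {..<Suc m} \<rightarrow>\<^sub>E carrier R. half_rank R (Suc m) z = e \<and> z m = \<zero>} \<union>
      {z \<in> {..<Suc m} \<rightarrow>\<^sub>E carrier R. Suc (half_rank R m z) = e \<and> z m \<noteq> \<zero>}" (is "_ = ?A \<union> ?B")
    by auto
  moreover have "card (?A \<union> ?B) = card ?A + card ?B"
    using finite_PiE[of "{..<Suc m}" "\<lambda>_. carrier R"] fin by (intro card_Un_disjoint) auto
  moreover have "card ?A = form_count (Suc m) e * card {t \<in> carrier R. t = \<zero>}"
    unfolding form_count_def diff_Suc_1
    by (rule card_PiE_last[OF fin], rule arg_cong[where f="\<lambda>r. r = e"], rule half_rank_cong) simp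
  moreover have "{t \<in> carrier R. t = \<zero>} = {\<zero>}" by auto
  moreover have "card ?B = card {z \<in> {..<m} \<rightarrow>\<^sub>E carrier R. Suc (half_rank R m z) = e} * card {t \<in> carrier R. t \<noteq> \<zero>}"
    by (rule card_PiE_last[OF fin], rule arg_cong[where f="\<lambda>r. Suc r = e"], rule half_rank_cong) simp
  moreover have "{t \<in> carrier R. t \<noteq> \<zero>} = carrier R - {\<zero>}" by auto
  moreover have "card (carrier R - {\<zero>}) = card (carrier R) - 1" by simp
  ultimately show ?thesis by (simp add: form_count_def)
qed

lemma form_count_2:
  assumes fin: "finite (carrier R)"
  shows "form_count 2 e = (if e = 0 then 1 else if e = 1 then card (carrier R) - 1 else 0)"
  using form_count_split[OF fin, of 0 e] by (auto simp: form_count_1 numeral_2_eq_2)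

lemma form_count_Suc_Suc:
  assumes fin: "finite (carrier R)" and m: "m \<ge> 1"
  shows "form_count (Suc (Suc m)) 0 = form_count (Suc m) 0"
    and "form_count (Suc (Suc m)) (Suc e) = form_count (Suc m) (Suc e) +
      (card (carrier R) - 1) * card (carrier R) * form_count m e"
proof -
  show "form_count (Suc (Suc m)) 0 = form_count (Suc m) 0"
    using form_count_split[OF fin, of m 0] by simp
  obtain k where k: "m = Suc k" using m by (cases m) auto
  have "card {z \<in> {..<m} \<rightarrow>\<^sub>E carrier R. Suc (half_rank R m z) = Suc e} =
      card {z \<in> {..<Suc k} \<rightarrow>\<^sub>E carrier R. half_rank R m z = e \<and> True}" by (simp add: k)
  also have "\<dots> = card {z \<in> {..<k} \<rightarrow>\<^sub>E carrier R. half_rank R m z = e} * card {t \<in> carrier R. True}"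
    by (rule card_PiE_last[OF fin], rule arg_cong[where f="\<lambda>r. r = e"], rule half_rank_cong) (simp add: k)
  also have "\<dots> = form_count m e * card (carrier R)" by (simp add: form_count_def k)
  finally show "form_count (Suc (Suc m)) (Suc e) = form_count (Suc m) (Suc e) +
      (card (carrier R) - 1) * card (carrier R) * form_count m e"
    using form_count_split[OF fin, of m "Suc e"] by simp
qed

lemma sum_path_radical_rank:
  assumes fin: "finite (carrier R)"
  shows "(\<Sum>z | z \<in> {..<n - 1} \<rightarrow>\<^sub>E carrier R \<and> half_rank R n z = e. card (path_radical R n z)) =
    card (carrier R) ^ (n - 2 * e) * form_count n e"
proof -
  have "(\<Sum>z | z \<in> {..<n - 1} \<rightarrow>\<^sub>E carrier R \<and> half_rank R n z = e. card (path_radical R n z)) =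
      (\<Sum>z | z \<in> {..<n - 1} \<rightarrow>\<^sub>E carrier R \<and> half_rank R n z = e. card (carrier R) ^ (n - 2 * e))"
    using card_path_radical[OF fin] by (intro sum.cong refl) auto
  then show ?thesis by (simp add: form_count_def)
qed

definition radical_total :: "nat \<Rightarrow> nat" where
  "radical_total n = (\<Sum>z\<in>{..<n - 1} \<rightarrow>\<^sub>E carrier R. card (path_radical R n z))"

text \<open>The upper limit is arbitrary from \<open>n\<close> on, so that totals of different sizes
  can be written over the matching ranges that the recursion produces.\<close>

lemma radical_total_eq:
  assumes fin: "finite (carrier R)" and N: "N \<ge> n"
  shows "radical_total n = (\<Sum>e\<le>N. card (carrier R) ^ (n - 2 * e) * form_count n e)"
proof -
  let ?S = "{..<n - 1} \<rightarrow>\<^sub>E carrier R"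
  have finS: "finite ?S" using fin by (intro finite_PiE) auto
  have "radical_total n = (\<Sum>e\<in>{..N}. \<Sum>z | z \<in> ?S \<and> half_rank R n z = e. card (path_radical R n z))"
    unfolding radical_total_def
  proof (rule sum.group[symmetric, OF finS])
    have "half_rank R n z \<le> N" for z using half_rank_le[of R n z] N by linarith
    then show "half_rank R n ` ?S \<subseteq> {..N}" by auto
  qed simp
  then show ?thesis by (simp only: sum_path_radical_rank[OF fin])
qed

text \<open>A zero last entry gives the radical a free coordinate, hence a factor \<open>q\<close>.
  A nonzero last entry has \<open>q - 1\<close> values, leaves the radical of size \<open>m\<close>,
  and frees the entry before it, which supplies the other \<open>q\<close>.\<close>

lemma radical_total_rec:
  assumes fin: "finite (carrier R)" and m: "m \<ge> 1"
  shows "radical_total (Suc (Suc m)) =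
    card (carrier R) * (radical_total (Suc m) + (card (carrier R) - 1) * radical_total m)"
proof -
  let ?q = "card (carrier R)"
  define S where "S n e = ?q ^ (n - 2 * e) * form_count n e" for n e
  have S0: "S (Suc (Suc m)) 0 = ?q * S (Suc m) 0"
    using form_count_Suc_Suc(1)[OF fin m] by (simp add: S_def)
  have S1: "S (Suc (Suc m)) (Suc e) = ?q * S (Suc m) (Suc e) + (?q - 1) * ?q * S m e" for e
  proof -
    \<comment> \<open>The exponents differ by one unless \<open>Suc m - 2 * Suc e\<close> truncates,
      and then the form count vanishes.\<close>
    have shift: "?q ^ (m - 2 * e) * form_count (Suc m) (Suc e) = ?q * (?q ^ (Suc m - 2 * Suc e) * form_count (Suc m) (Suc e))"
    proof (cases "2 * Suc e \<le> Suc m")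
      case True
      then have "m - 2 * e = Suc (Suc m - 2 * Suc e)" by arith
      then show ?thesis by simp
    next
      case False
      then show ?thesis by (simp add: form_count_eq_0)
    qed
    have "S (Suc (Suc m)) (Suc e) =
        ?q ^ (m - 2 * e) * (form_count (Suc m) (Suc e) + (?q - 1) * ?q * form_count m e)"
      using form_count_Suc_Suc(2)[OF fin m, of e] by (simp add: S_def)
    also have "\<dots> = ?q ^ (m - 2 * e) * form_count (Suc m) (Suc e) + (?q - 1) * ?q * (?q ^ (m - 2 * e) * form_count m e)"
      by (simp only: distrib_left mult.assoc mult.left_commute)
    also have "\<dots> = ?q * S (Suc m) (Suc e) + (?q - 1) * ?q * S m e"
      unfolding shift S_def ..
    finally show ?thesis .
  qed
  have "radical_total (Suc (Suc m)) = (\<Sum>e\<le>Suc (Suc m). S (Suc (Suc m)) e)"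
    unfolding S_def by (rule radical_total_eq[OF fin]) simp
  also have "\<dots> = ?q * S (Suc m) 0 + (\<Sum>e\<le>Suc m. ?q * S (Suc m) (Suc e) + (?q - 1) * ?q * S m e)"
    by (subst sum.atMost_Suc_shift) (simp only: S0 S1)
  also have "\<dots> = ?q * (S (Suc m) 0 + (\<Sum>e\<le>Suc m. S (Suc m) (Suc e))) + (?q - 1) * ?q * (\<Sum>e\<le>Suc m. S m e)"
    by (simp only: sum.distrib sum_distrib_left distrib_left add.assoc)
  also have "S (Suc m) 0 + (\<Sum>e\<le>Suc m. S (Suc m) (Suc e)) = (\<Sum>e\<le>Suc (Suc m). S (Suc m) e)"
    by (rule sum.atMost_Suc_shift[symmetric])
  also have "\<dots> = radical_total (Suc m)"
    unfolding S_def by (rule radical_total_eq[OF fin, symmetric]) simp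
  also have "(\<Sum>e\<le>Suc m. S m e) = radical_total m"
    unfolding S_def by (rule radical_total_eq[OF fin, symmetric]) simp
  finally show ?thesis by (simp add: algebra_simps)
qed

text \<open>The factor \<open>Suc t\<close>, which is \<open>q\<close>, avoids the exponent
  \<open>e - 1\<close>, and \<open>t\<close> avoids the subtraction \<open>q - 1\<close>. The
  recursion is Pascal's rule applied to both binomials at once.\<close>

lemma form_count_closed_form:
  assumes fin: "finite (carrier R)" and n: "n \<ge> 1" and q: "card (carrier R) = Suc t"
  shows "Suc t * form_count n e =
    Suc t ^ e * (((n - e) choose e) * t ^ e + ((n - e - 1) choose e) * t ^ (e + 1))"
  using n
proof (induction n arbitrary: e rule: less_induct)
  case (less n)
  consider "n = 1" | "n = 2" | m where "n = Suc (Suc m)" "m \<ge> 1"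
    using less.prems by (metis One_nat_def Suc_1 Suc_le_eq not0_implies_Suc not_gr0 not_less_eq_eq zero_less_Suc)
  then show ?case
  proof cases
    case 1
    then show ?thesis by (cases e) (auto simp: form_count_1)
  next
    case 2
    consider "e = 0" | "e = 1" | k where "e = Suc (Suc k)" by (metis One_nat_def not0_implies_Suc)
    then show ?thesis by cases (auto simp: 2 form_count_2[OF fin] q)
  next
    case (3 m)
    show ?thesis
    proof (cases e)
      case 0
      then show ?thesis using less.IH[of "Suc m" 0] form_count_Suc_Suc(1)[OF fin 3(2)] 3 by simp
    next
      case (Suc k)
      \<comment> \<open>Pascal's rule. For \<open>k > m\<close> the truncated differences are 0, and
        all three terms vanish because the lower indices are positive.\<close>
      have A: "(n - e) choose e = ((Suc m - e) choose e) + ((m - k) choose k)"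
      proof (cases "k \<le> m")
        case True
        then have "n - e = Suc (m - k)" using 3 Suc by simp
        then show ?thesis using Suc by simp
      next
        case False
        then show ?thesis using 3 Suc by (cases k) auto
      qed
      \<comment> \<open>Pascal's rule again, with the boundary now at \<open>k = m\<close>; there
        \<open>m \<ge> 1\<close> keeps the lower index \<open>k\<close> positive.\<close>
      have B: "(n - e - 1) choose e = ((Suc m - e - 1) choose e) + ((m - k - 1) choose k)"
      proof (cases "k < m")
        case True
        then have "n - e - 1 = Suc (m - k - 1)" "Suc m - e - 1 = m - k - 1" using 3 Suc by auto
        then show ?thesis using Suc by simp
      next
        case False
        then show ?thesis using 3 Suc by (cases k) auto
      qed
      have "Suc t * form_count n e = Suc t * form_count (Suc m) e + t * Suc t * (Suc t * form_count m k)"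
        using form_count_Suc_Suc(2)[OF fin 3(2), of k] 3 Suc q by (simp add: algebra_simps)
      also have "\<dots> = Suc t ^ e * (((Suc m - e) choose e) * t ^ e + ((Suc m - e - 1) choose e) * t ^ (e + 1)) +
          t * Suc t * (Suc t ^ k * (((m - k) choose k) * t ^ k + ((m - k - 1) choose k) * t ^ (k + 1)))"
        using less.IH[of "Suc m" e] less.IH[of m k] 3 by simp
      also have "\<dots> = Suc t ^ e * (((n - e) choose e) * t ^ e + ((n - e - 1) choose e) * t ^ (e + 1))"
        unfolding A B unfolding Suc by (simp add: algebra_simps del: binomial_Suc_Suc)
      finally show ?thesis .
    qed
  qed
qed

end

section \<open>The counting polynomial\<close>

text \<open>The variable is \<open>q - 1\<close>, so \<open>[:1, 1:]\<close> is \<open>q\<close> and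
  the last equation is \<open>radical_total_rec\<close>. That recursion requires
  \<open>m \<ge> 1\<close>, which makes 3 the first recursive index; the values at 1 and 2 are
  \<open>q\<close> and \<open>q^2 + q - 1\<close>.\<close>

fun heis_poly :: "nat \<Rightarrow> int poly" where
  "heis_poly 0 = 1"
| "heis_poly (Suc 0) = [:1, 1:]"
| "heis_poly (Suc (Suc 0)) = [:1, 3, 1:]"
| "heis_poly (Suc (Suc (Suc n))) = [:1, 1:] * (heis_poly (Suc (Suc n)) + [:0, 1:] * heis_poly (Suc n))"

lemma coeff_heis_poly_nonneg: "coeff (heis_poly n) i \<ge> 0"
proof (induction n arbitrary: i rule: heis_poly.induct)
  case 1
  then show ?case by (simp add: coeff_1)
next
  case 2
  then show ?case by (simp add: coeff_pCons split: nat.split)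
next
  case 3
  then show ?case by (simp add: coeff_pCons split: nat.split)
next
  case (4 n)
  have shift: "coeff (pCons 0 r) i \<ge> 0" if "\<And>i. coeff r i \<ge> 0" for r :: "int poly" and i
    using that by (cases i) simp_all
  define r where "r = heis_poly (Suc (Suc n)) + pCons 0 (heis_poly (Suc n))"
  have r: "coeff r i \<ge> 0" for i unfolding r_def coeff_add by (intro add_nonneg_nonneg 4 shift)
  have "heis_poly (Suc (Suc (Suc n))) = r + pCons 0 r" by (simp add: r_def)
  then show ?case using r shift[OF r] by simp
qed

text \<open>Bounding the degree and fixing coefficient \<open>n\<close> separately keeps
  nonvanishing out of the induction. The two summands in the bracket share their top degree, so
  their coefficients add to the next Fibonacci number; the factor \<open>[:1, 1:]\<close> raises the
  degree by one and preserves the top coefficient.\<close>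

lemma heis_poly_lead:
  assumes "n \<ge> 1"
  shows "degree (heis_poly n) \<le> n \<and> coeff (heis_poly n) n = int (fib n)"
  using assms
proof (induction n rule: heis_poly.induct)
  case (4 n)
  define r where "r = heis_poly (Suc (Suc n)) + [:0, 1:] * heis_poly (Suc n)"
  have IH: "degree (heis_poly (Suc (Suc n))) \<le> Suc (Suc n)" "coeff (heis_poly (Suc (Suc n))) (Suc (Suc n)) = int (fib (Suc (Suc n)))"
    "degree (heis_poly (Suc n)) \<le> Suc n" "coeff (heis_poly (Suc n)) (Suc n) = int (fib (Suc n))"
    using 4 by auto
  have "degree ([:0, 1:] * heis_poly (Suc n)) \<le> Suc (Suc n)"
    using IH(3) degree_pCons_le[of 0 "heis_poly (Suc n)"] by simp
  then have deg: "degree r \<le> Suc (Suc n)"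
    unfolding r_def using IH(1) by (intro degree_add_le)
  have c: "coeff r (Suc (Suc n)) = int (fib (Suc (Suc (Suc n))))"
    unfolding r_def coeff_add using IH(2,4) by simp
  have eq: "heis_poly (Suc (Suc (Suc n))) = r + pCons 0 r" by (simp add: r_def)
  have "degree (r + pCons 0 r) \<le> Suc (Suc (Suc n))"
    using deg degree_pCons_le[of 0 r] by (intro degree_add_le) linarith+
  moreover have "coeff (r + pCons 0 r) (Suc (Suc (Suc n))) = int (fib (Suc (Suc (Suc n))))"
    using c coeff_eq_0[of r "Suc (Suc (Suc n))"] deg by (simp del: fib.simps)
  ultimately show ?case unfolding eq by blast
next
  case 3
  then show ?case by simp
qed simp_all

lemma degree_heis_poly:
  assumes "n \<ge> 1"
  shows "degree (heis_poly n) = n"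
proof -
  have "fib n > 0" using assms by (simp add: fib_neq_0_nat)
  then have "coeff (heis_poly n) n \<noteq> 0" using heis_poly_lead[OF assms] by simp
  then show ?thesis using heis_poly_lead[OF assms] le_degree by (metis le_antisym)
qed

lemma (in field) radical_total_poly:
  assumes fin: "finite (carrier R)" and n: "n \<ge> 1"
  shows "int (radical_total n) = poly (heis_poly n) (int (card (carrier R)) - 1)"
  using n
proof (induction n rule: heis_poly.induct)
  case 1
  then show ?case by simp
next
  case 2
  have "path_radical R (Suc 0) z = {..<Suc 0} \<rightarrow>\<^sub>E carrier R" for z
    by (auto simp: path_radical_def path_left_def path_right_def)
  then show ?case by (simp add: radical_total_def card_PiE)
next
  case 3
  have q: "card (carrier R) \<ge> 1" using fin zero_closed by (metis One_nat_def Suc_leI card_gt_0_iff empty_iff)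
  \<comment> \<open>The zero form contributes \<open>q^2\<close>; each of the \<open>q - 1\<close>
    nonzero forms is nondegenerate and contributes 1.\<close>
  have "radical_total 2 = (card (carrier R))^2 + (card (carrier R) - 1)"
    by (subst radical_total_eq[OF fin order_refl]) (simp add: form_count_2[OF fin, unfolded numeral_2_eq_2] numeral_2_eq_2)
  then show ?case using q by (simp add: numeral_2_eq_2 of_nat_diff algebra_simps power2_eq_square)
next
  case (4 n)
  have q: "card (carrier R) \<ge> 1" using fin zero_closed by (metis One_nat_def Suc_leI card_gt_0_iff empty_iff)
  then obtain t where t: "card (carrier R) = Suc t" by (cases "card (carrier R)") auto
  show ?case
    using 4 radical_total_rec[OF fin, of "Suc n"] by (simp add: t algebra_simps)
qed

section \<open>Unitriangular groups\<close>

locale unitriangular = field F for F :: "('f, 'c) ring_scheme" (structure) +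
  fixes m :: nat
  assumes finite_field: "finite (carrier F)"
begin

abbreviation U :: "'f mat monoid" where "U \<equiv> unitriangular_group m F"
abbreviation U_mult (infixl \<open>\<star>\<close> 70) where "A \<star> B \<equiv> A \<otimes>\<^bsub>U\<^esub> B"

lemma U_D:
  assumes "A \<in> carrier U"
  shows "dim_row A = m" "dim_col A = m"
    and "\<And>i j. i < m \<Longrightarrow> j < m \<Longrightarrow> A $$ (i, j) \<in> carrier F"
    and "\<And>i. i < m \<Longrightarrow> A $$ (i, i) = \<one>"
    and "\<And>i j. i < m \<Longrightarrow> j < i \<Longrightarrow> A $$ (i, j) = \<zero>"
  using assms by (auto simp: unitriangular_group_def)

lemma U_I:
  assumes "A \<in> carrier_mat m m" "\<And>i j. i < m \<Longrightarrow> j < m \<Longrightarrow> A $$ (i, j) \<in> carrier F"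
    "\<And>i. i < m \<Longrightarrow> A $$ (i, i) = \<one>" "\<And>i j. i < m \<Longrightarrow> j < i \<Longrightarrow> A $$ (i, j) = \<zero>"
  shows "A \<in> carrier U"
  using assms by (simp add: unitriangular_group_def)

lemma U_eqI:
  assumes A: "A \<in> carrier U" and B: "B \<in> carrier U"
    and eq: "\<And>i j. i < j \<Longrightarrow> j < m \<Longrightarrow> A $$ (i, j) = B $$ (i, j)"
  shows "A = B"
proof (rule eq_matI)
  fix i j assume "i < dim_row B" "j < dim_col B"
  then have ij: "i < m" "j < m" using U_D[OF B] by auto
  consider "i < j" | "i = j" | "j < i" by linarith
  then show "A $$ (i, j) = B $$ (i, j)"
    using ij eq U_D(4)[OF A, of i] U_D(4)[OF B, of i] U_D(5)[OF A, of i j] U_D(5)[OF B, of i j] by cases auto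
qed (use U_D[OF A] U_D[OF B] in auto)

lemma finsum_support:
  assumes "finite K" "S \<subseteq> K" "\<And>k. k \<in> K \<Longrightarrow> f k \<in> carrier F" "\<And>k. k \<in> K - S \<Longrightarrow> f k = \<zero>"
  shows "(\<Oplus>k\<in>K. f k) = (\<Oplus>k\<in>S. f k)"
  by (rule add.finprod_mono_neutral_cong_right) (use assms in auto)

lemma mult_entry:
  assumes "i < m" "j < m"
  shows "(A \<star> B) $$ (i, j) = (\<Oplus>k\<in>{..<m}. A $$ (i, k) \<otimes> B $$ (k, j))"
  using assms by (simp add: unitriangular_group_def)

lemma mult_entry_support:
  assumes A: "A \<in> carrier U" and B: "B \<in> carrier U" and ij: "i < m" "j < m"
    and S: "S \<subseteq> {..<m}" "\<And>k. k < m \<Longrightarrow> k \<notin> S \<Longrightarrow> A $$ (i, k) = \<zero> \<or> B $$ (k, j) = \<zero>"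
  shows "(A \<star> B) $$ (i, j) = (\<Oplus>k\<in>S. A $$ (i, k) \<otimes> B $$ (k, j))"
  unfolding mult_entry[OF ij]
proof (rule finsum_support)
  fix k assume "k \<in> {..<m} - S"
  then have k: "k < m" "k \<notin> S" by auto
  then show "A $$ (i, k) \<otimes> B $$ (k, j) = \<zero>"
    using S(2)[OF k] U_D(3)[OF A ij(1) k(1)] U_D(3)[OF B k(1) ij(2)] by auto
qed (use S U_D(3)[OF A ij(1)] U_D(3)[OF B _ ij(2)] in auto)

lemma mult_entry_interval:
  assumes A: "A \<in> carrier U" and B: "B \<in> carrier U" and ij: "i < m" "j < m"
  shows "(A \<star> B) $$ (i, j) = (\<Oplus>k\<in>{i..j}. A $$ (i, k) \<otimes> B $$ (k, j))"
proof (rule mult_entry_support[OF A B ij])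
  fix k assume k: "k < m" "k \<notin> {i..j}"
  then consider "k < i" | "j < k" by fastforce
  then show "A $$ (i, k) = \<zero> \<or> B $$ (k, j) = \<zero>"
    using U_D(5)[OF A ij(1), of k] U_D(5)[OF B k(1), of j] by cases auto
qed (use ij in auto)

lemma mult_entry_closed:
  assumes A: "A \<in> carrier U" and B: "B \<in> carrier U" and ij: "i < m" "j < m"
  shows "(A \<star> B) $$ (i, j) \<in> carrier F"
  unfolding mult_entry[OF ij] using U_D(3)[OF A ij(1)] U_D(3)[OF B _ ij(2)]
  by (intro finsum_closed) auto

lemma U_mult_closed:
  assumes A: "A \<in> carrier U" and B: "B \<in> carrier U"
  shows "A \<star> B \<in> carrier U"
proof (rule U_I)
  show "A \<star> B \<in> carrier_mat m m" by (simp add: unitriangular_group_def)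
  show "(A \<star> B) $$ (i, j) \<in> carrier F" if "i < m" "j < m" for i j
    by (rule mult_entry_closed[OF A B that])
  show "(A \<star> B) $$ (i, i) = \<one>" if i: "i < m" for i
    unfolding mult_entry_interval[OF A B i i] using U_D(4)[OF A i] U_D(4)[OF B i] by simp
  show "(A \<star> B) $$ (i, j) = \<zero>" if "i < m" "j < i" for i j
    using that mult_entry_interval[OF A B, of i j] by simp
qed

lemma U_one_closed: "\<one>\<^bsub>U\<^esub> \<in> carrier U"
  by (simp add: unitriangular_group_def)

lemma one_entry: "i < m \<Longrightarrow> j < m \<Longrightarrow> \<one>\<^bsub>U\<^esub> $$ (i, j) = (if i = j then \<one> else \<zero>)"
  by (simp add: unitriangular_group_def)

lemma U_assoc:
  assumes A: "A \<in> carrier U" and B: "B \<in> carrier U" and C: "C \<in> carrier U"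
  shows "A \<star> B \<star> C = A \<star> (B \<star> C)"
proof (rule U_eqI)
  show "A \<star> B \<star> C \<in> carrier U" "A \<star> (B \<star> C) \<in> carrier U"
    using assms by (auto intro: U_mult_closed)
  fix i j assume "i < j" "j < m"
  then have i: "i < m" and j: "j < m" by auto
  note cA = U_D(3)[OF A] and cB = U_D(3)[OF B] and cC = U_D(3)[OF C]
  have "(A \<star> B \<star> C) $$ (i, j) = (\<Oplus>k\<in>{..<m}. (\<Oplus>l\<in>{..<m}. A $$ (i, l) \<otimes> B $$ (l, k)) \<otimes> C $$ (k, j))"
    unfolding mult_entry[OF i j]
    by (rule finsum_cong') (use i j cA cB cC mult_entry in \<open>auto intro!: finsum_closed m_closed\<close>)
  also have "\<dots> = (\<Oplus>k\<in>{..<m}. \<Oplus>l\<in>{..<m}. A $$ (i, l) \<otimes> B $$ (l, k) \<otimes> C $$ (k, j))"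
    using i j cA cB cC
    by (intro finsum_cong' refl) (auto intro!: finsum_closed m_closed finsum_ldistr)
  also have "\<dots> = (\<Oplus>l\<in>{..<m}. \<Oplus>k\<in>{..<m}. A $$ (i, l) \<otimes> B $$ (l, k) \<otimes> C $$ (k, j))"
    using i j cA cB cC by (intro finsum_finsum_swap) auto
  also have "\<dots> = (\<Oplus>l\<in>{..<m}. \<Oplus>k\<in>{..<m}. A $$ (i, l) \<otimes> (B $$ (l, k) \<otimes> C $$ (k, j)))"
    using i j cA cB cC by (intro finsum_cong' refl) (auto intro!: finsum_closed m_closed m_assoc)
  also have "\<dots> = (\<Oplus>l\<in>{..<m}. A $$ (i, l) \<otimes> (\<Oplus>k\<in>{..<m}. B $$ (l, k) \<otimes> C $$ (k, j)))"
    using i j cA cB cC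
    by (intro finsum_cong' refl) (auto intro!: finsum_closed m_closed finsum_rdistr[symmetric])
  also have "\<dots> = (A \<star> (B \<star> C)) $$ (i, j)"
    unfolding mult_entry[OF i j]
    by (rule finsum_cong') (use i j cA cB cC mult_entry in \<open>auto intro!: finsum_closed m_closed\<close>)
  finally show "(A \<star> B \<star> C) $$ (i, j) = (A \<star> (B \<star> C)) $$ (i, j)" .
qed

lemma U_l_one:
  assumes A: "A \<in> carrier U"
  shows "\<one>\<^bsub>U\<^esub> \<star> A = A"
proof (rule U_eqI[OF U_mult_closed[OF U_one_closed A] A])
  fix i j assume "i < j" "j < m"
  then have ij: "i < m" "j < m" by auto
  have "(\<one>\<^bsub>U\<^esub> \<star> A) $$ (i, j) = (\<Oplus>k\<in>{i}. \<one>\<^bsub>U\<^esub> $$ (i, k) \<otimes> A $$ (k, j))"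
    using ij by (intro mult_entry_support[OF U_one_closed A ij]) (auto simp: one_entry)
  then show "(\<one>\<^bsub>U\<^esub> \<star> A) $$ (i, j) = A $$ (i, j)"
    using ij U_D(3)[OF A ij] by (simp add: one_entry)
qed

lemma finite_U: "finite (carrier U)"
proof -
  have "carrier U \<subseteq> (\<lambda>f. mat m m f) ` (({..<m} \<times> {..<m}) \<rightarrow>\<^sub>E carrier F)"
  proof
    fix A assume A: "A \<in> carrier U"
    have "A = mat m m (restrict (\<lambda>ij. A $$ ij) ({..<m} \<times> {..<m}))"
      using U_D(1,2)[OF A] by (intro eq_matI) auto
    moreover have "restrict (\<lambda>ij. A $$ ij) ({..<m} \<times> {..<m}) \<in> ({..<m} \<times> {..<m}) \<rightarrow>\<^sub>E carrier F"
      using U_D(3)[OF A] by auto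
    ultimately show "A \<in> (\<lambda>f. mat m m f) ` (({..<m} \<times> {..<m}) \<rightarrow>\<^sub>E carrier F)" by blast
  qed
  moreover have "finite (({..<m} \<times> {..<m}) \<rightarrow>\<^sub>E carrier F)"
    using finite_field by (intro finite_PiE) auto
  ultimately show ?thesis by (blast intro: finite_subset)
qed

text \<open>With finiteness this provides inverses without a formula: right multiplication is
  injective on a finite set, hence onto. As \<open>A\<close> has ones on its diagonal, column
  \<open>j\<close> of a row of the product is the entry of \<open>X\<close> plus a combination of
  earlier entries of that row, so the row is recovered from left to right.\<close>

lemma U_right_cancel:
  assumes X: "X \<in> carrier U" and Y: "Y \<in> carrier U" and A: "A \<in> carrier U"
    and eq: "X \<star> A = Y \<star> A"
  shows "X = Y"
proof (rule U_eqI[OF X Y])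
  fix i j :: nat assume "i < j" "j < m"
  then have "i \<le> j" by simp
  then show "X $$ (i, j) = Y $$ (i, j)" using \<open>j < m\<close>
  proof (induction j rule: less_induct)
    case (less j)
    then have j: "j < m" and i: "i < m" by auto
    have split: "(Z \<star> A) $$ (i, j) = Z $$ (i, j) \<oplus> (\<Oplus>k\<in>{i..<j}. Z $$ (i, k) \<otimes> A $$ (k, j))"
      if Z: "Z \<in> carrier U" for Z
    proof -
      have "{i..j} = insert j {i..<j}" using less.prems by auto
      then show ?thesis
        unfolding mult_entry_interval[OF Z A i j]
        using U_D(3)[OF Z i] U_D(3)[OF A _ j] U_D(4)[OF A j] j by (simp add: Pi_def)
    qed
    have "(\<Oplus>k\<in>{i..<j}. X $$ (i, k) \<otimes> A $$ (k, j)) = (\<Oplus>k\<in>{i..<j}. Y $$ (i, k) \<otimes> A $$ (k, j))"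
      using less.IH j U_D(3)[OF Y i] U_D(3)[OF A _ j] by (intro finsum_cong' refl) auto
    moreover have "(\<Oplus>k\<in>{i..<j}. Y $$ (i, k) \<otimes> A $$ (k, j)) \<in> carrier F"
      using j U_D(3)[OF Y i] U_D(3)[OF A _ j] by (intro finsum_closed) auto
    ultimately show ?case
      using split[OF X] split[OF Y] eq U_D(3)[OF X i j] U_D(3)[OF Y i j] by simp
  qed
qed

lemma group_U: "group U"
proof (rule groupI)
  fix A assume A: "A \<in> carrier U"
  have inj: "inj_on (\<lambda>X. X \<star> A) (carrier U)"
    using U_right_cancel[OF _ _ A] by (auto intro: inj_onI)
  have "(\<lambda>X. X \<star> A) ` carrier U = carrier U"
    using U_mult_closed[OF _ A] by (intro endo_inj_surj[OF finite_U _ inj]) auto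
  then have "\<one>\<^bsub>U\<^esub> \<in> (\<lambda>X. X \<star> A) ` carrier U" using U_one_closed by simp
  then show "\<exists>X\<in>carrier U. X \<star> A = \<one>\<^bsub>U\<^esub>" by auto
qed (auto intro: U_mult_closed U_one_closed U_assoc U_l_one)

sublocale U: fin_group U
  by (intro fin_group.intro fin_group_axioms.intro group_U finite_U)

section \<open>The filtration by superdiagonals and its commutators\<close>

definition agree :: "nat \<Rightarrow> 'f mat \<Rightarrow> 'f mat \<Rightarrow> bool" where
  "agree k A B \<longleftrightarrow> (\<forall>i j. i \<le> j \<longrightarrow> j \<le> i + k \<longrightarrow> j < m \<longrightarrow> A $$ (i, j) = B $$ (i, j))"

lemma agree_sym: "agree k A B \<Longrightarrow> agree k B A"
  by (simp add: agree_def)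

text \<open>A product entry at distance \<open>j - i\<close> from the diagonal involves only entries
  of the factors at most that far away. So \<open>agree k\<close> is a congruence, and it stands in
  for equality modulo \<open>diag_filt (Suc k)\<close>.\<close>

lemma agree_mult:
  assumes A: "A \<in> carrier U" and A': "A' \<in> carrier U" and B: "B \<in> carrier U" and B': "B' \<in> carrier U"
    and AA': "agree k A A'" and BB': "agree k B B'"
  shows "agree k (A \<star> B) (A' \<star> B')"
  unfolding agree_def
proof (intro allI impI)
  fix i j assume ij: "i \<le> j" "j \<le> i + k" "j < m"
  then have i: "i < m" by simp
  show "(A \<star> B) $$ (i, j) = (A' \<star> B') $$ (i, j)"
    unfolding mult_entry_interval[OF A B i ij(3)] mult_entry_interval[OF A' B' i ij(3)]
  proof (rule finsum_cong')
    fix l assume l: "l \<in> {i..j}"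
    have "A $$ (i, l) = A' $$ (i, l)" "B $$ (l, j) = B' $$ (l, j)"
      using AA' BB' l ij by (auto simp: agree_def)
    then show "A $$ (i, l) \<otimes> B $$ (l, j) = A' $$ (i, l) \<otimes> B' $$ (l, j)" by simp
  qed (use ij i U_D(3)[OF A'] U_D(3)[OF B'] in auto)
qed

lemma agree_refl: "agree k A A" by (simp add: agree_def)

lemma agree_right_cancel:
  assumes A: "A \<in> carrier U" and B: "B \<in> carrier U" and C: "C \<in> carrier U"
    and eq: "agree k (A \<star> C) (B \<star> C)"
  shows "agree k A B"
  using agree_mult[OF _ _ _ _ eq agree_refl[of k "inv\<^bsub>U\<^esub> C"]] A B C by (simp add: U.m_assoc)

text \<open>Indexed like the lower central series: \<open>diag_filt 1\<close> is the whole group,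
  and the superdiagonal at distance \<open>k\<close> is the first one allowed to be nonzero.\<close>

definition diag_filt :: "nat \<Rightarrow> 'f mat set" where
  "diag_filt k = {A \<in> carrier U. \<forall>i j. i < j \<longrightarrow> j < i + k \<longrightarrow> j < m \<longrightarrow> A $$ (i, j) = \<zero>}"

lemma diag_filt_Suc: "diag_filt (Suc k) = {A \<in> carrier U. agree k A \<one>\<^bsub>U\<^esub>}"
proof -
  have "(\<forall>i j. i < j \<longrightarrow> j < i + Suc k \<longrightarrow> j < m \<longrightarrow> A $$ (i, j) = \<zero>) \<longleftrightarrow> agree k A \<one>\<^bsub>U\<^esub>"
    if A: "A \<in> carrier U" for A
  proof
    assume h: "\<forall>i j. i < j \<longrightarrow> j < i + Suc k \<longrightarrow> j < m \<longrightarrow> A $$ (i, j) = \<zero>"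
    show "agree k A \<one>\<^bsub>U\<^esub>"
      unfolding agree_def
    proof (intro allI impI)
      fix i j assume ij: "i \<le> j" "j \<le> i + k" "j < m"
      then show "A $$ (i, j) = \<one>\<^bsub>U\<^esub> $$ (i, j)"
        using h[rule_format, of i j] U_D(4)[OF A, of i] by (cases "i = j") (auto simp: one_entry)
    qed
  next
    assume h: "agree k A \<one>\<^bsub>U\<^esub>"
    show "\<forall>i j. i < j \<longrightarrow> j < i + Suc k \<longrightarrow> j < m \<longrightarrow> A $$ (i, j) = \<zero>"
    proof (intro allI impI)
      fix i j assume ij: "i < j" "j < i + Suc k" "j < m"
      then have "A $$ (i, j) = \<one>\<^bsub>U\<^esub> $$ (i, j)" using h by (simp add: agree_def)
      then show "A $$ (i, j) = \<zero>" using ij by (simp add: one_entry)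
    qed
  qed
  then show ?thesis by (auto simp: diag_filt_def)
qed

lemma diag_filt_carrier: "A \<in> diag_filt k \<Longrightarrow> A \<in> carrier U" by (simp add: diag_filt_def)

lemma diag_filt_subgroup: "subgroup (diag_filt (Suc k)) U"
proof (rule U.subgroupI)
  show "diag_filt (Suc k) \<subseteq> carrier U" by (auto simp: diag_filt_def)
  show "diag_filt (Suc k) \<noteq> {}" using U_one_closed agree_refl unfolding diag_filt_Suc by blast
next
  fix A assume "A \<in> diag_filt (Suc k)"
  then have A: "A \<in> carrier U" and ag: "agree k A \<one>\<^bsub>U\<^esub>" by (auto simp: diag_filt_Suc)
  have "agree k \<one>\<^bsub>U\<^esub> (inv\<^bsub>U\<^esub> A)"
    using agree_mult[OF A U_one_closed U.inv_closed[OF A] U.inv_closed[OF A] ag agree_refl] A by simp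
  then show "inv\<^bsub>U\<^esub> A \<in> diag_filt (Suc k)" using A by (simp add: diag_filt_Suc agree_sym)
next
  fix A B assume "A \<in> diag_filt (Suc k)" "B \<in> diag_filt (Suc k)"
  then have A: "A \<in> carrier U" "agree k A \<one>\<^bsub>U\<^esub>" and B: "B \<in> carrier U" "agree k B \<one>\<^bsub>U\<^esub>" by (auto simp: diag_filt_Suc)
  have "agree k (A \<star> B) (\<one>\<^bsub>U\<^esub> \<star> \<one>\<^bsub>U\<^esub>)"
    by (rule agree_mult[OF A(1) U_one_closed B(1) U_one_closed A(2) B(2)])
  then show "A \<star> B \<in> diag_filt (Suc k)" using A B by (simp add: diag_filt_Suc)
qed

lemma commutator_agree:
  assumes X: "X \<in> carrier U" and Y: "Y \<in> carrier U"
    and ag: "agree k (X \<star> Y) (Y \<star> X)"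
  shows "X \<star> Y \<star> inv\<^bsub>U\<^esub> X \<star> inv\<^bsub>U\<^esub> Y \<in> diag_filt (Suc k)"
proof -
  let ?C = "X \<star> Y \<star> inv\<^bsub>U\<^esub> X \<star> inv\<^bsub>U\<^esub> Y"
  have C: "?C \<in> carrier U" using X Y by simp
  have "?C \<star> (Y \<star> X) = X \<star> Y"
    using X Y by (simp add: U.m_assoc U.inv_solve_left')
  then have "agree k (?C \<star> (Y \<star> X)) (\<one>\<^bsub>U\<^esub> \<star> (Y \<star> X))" using ag X Y by simp
  then have "agree k ?C \<one>\<^bsub>U\<^esub>" using C X Y by (intro agree_right_cancel[of ?C _ "Y \<star> X"]) auto
  then show ?thesis using C by (simp add: diag_filt_Suc)
qed

lemma mult_entry_1:
  assumes A: "A \<in> carrier U" and B: "B \<in> carrier U" and i: "Suc i < m"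
  shows "(A \<star> B) $$ (i, Suc i) = A $$ (i, Suc i) \<oplus> B $$ (i, Suc i)"
proof -
  have ij: "i < m" "Suc i < m" using i by auto
  have "{i..Suc i} = {i, Suc i}" by auto
  then show ?thesis
    unfolding mult_entry_interval[OF A B ij]
    using U_D(3)[OF A ij] U_D(3)[OF B ij] U_D(4)[OF A ij(1)] U_D(4)[OF B ij(2)] by (simp add: a_comm)
qed

lemma mult_entry_2:
  assumes A: "A \<in> carrier U" and B: "B \<in> carrier U" and i: "Suc (Suc i) < m"
  shows "(A \<star> B) $$ (i, Suc (Suc i)) = A $$ (i, Suc (Suc i)) \<oplus> B $$ (i, Suc (Suc i)) \<oplus>
    A $$ (i, Suc i) \<otimes> B $$ (Suc i, Suc (Suc i))"
proof -
  have ij: "i < m" "Suc i < m" "Suc (Suc i) < m" using i by auto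
  have "{i..Suc (Suc i)} = {i, Suc i, Suc (Suc i)}" by auto
  then show ?thesis
    unfolding mult_entry_interval[OF A B ij(1,3)]
    using U_D(3)[OF A ij(1,2)] U_D(3)[OF A ij(1,3)] U_D(3)[OF B ij(1,3)] U_D(3)[OF B ij(2,3)]
      U_D(4)[OF A ij(1)] U_D(4)[OF B ij(3)] by (simp add: a_ac)
qed

lemma agree_1_commute:
  assumes X: "X \<in> carrier U" and Y: "Y \<in> carrier U"
  shows "agree 1 (X \<star> Y) (Y \<star> X)"
  unfolding agree_def
proof (intro allI impI)
  fix i j assume ij: "i \<le> j" "j \<le> i + 1" "j < m"
  then consider "j = i" | "j = Suc i" by linarith
  then show "(X \<star> Y) $$ (i, j) = (Y \<star> X) $$ (i, j)"
  proof cases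
    case 1
    then show ?thesis using ij U_D(4)[OF U_mult_closed[OF X Y]] U_D(4)[OF U_mult_closed[OF Y X]] by simp
  next
    case 2
    then show ?thesis
      using ij mult_entry_1[OF X Y, of i] mult_entry_1[OF Y X, of i] U_D(3)[OF X, of i j] U_D(3)[OF Y, of i j]
      by (simp add: a_comm)
  qed
qed

text \<open>The first superdiagonal of \<open>Y\<close> is zero, which kills the product terms of
  \<open>mult_entry_2\<close> in both orders.\<close>

lemma agree_2_commute:
  assumes X: "X \<in> carrier U" and Y: "Y \<in> diag_filt 2"
  shows "agree 2 (X \<star> Y) (Y \<star> X)"
  unfolding agree_def
proof (intro allI impI)
  have Yc: "Y \<in> carrier U" using Y by (rule diag_filt_carrier)
  have Y0: "Y $$ (i, Suc i) = \<zero>" if "Suc i < m" for i using Y that by (simp add: diag_filt_def)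
  fix i j assume ij: "i \<le> j" "j \<le> i + 2" "j < m"
  show "(X \<star> Y) $$ (i, j) = (Y \<star> X) $$ (i, j)"
  proof (cases "j \<le> i + 1")
    case True
    then show ?thesis using agree_1_commute[OF X Yc] ij by (simp add: agree_def)
  next
    case False
    then have j: "j = Suc (Suc i)" using ij by simp
    have lt: "i < m" "Suc i < m" "Suc (Suc i) < m" using ij j by auto
    show ?thesis
      using mult_entry_2[OF X Yc lt(3)] mult_entry_2[OF Yc X lt(3)] Y0[OF lt(2)] Y0[OF lt(3)]
        U_D(3)[OF X lt(1,3)] U_D(3)[OF X lt(1,2)] U_D(3)[OF X lt(2,3)] U_D(3)[OF Yc lt(1,3)]
      by (simp add: j a_comm)
  qed
qed

lemma diag_filt_antimono: "k \<le> l \<Longrightarrow> diag_filt l \<subseteq> diag_filt k"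
  by (auto simp: diag_filt_def)

lemma diag_filt_trivial:
  assumes "A \<in> diag_filt k" "m \<le> k"
  shows "A = \<one>\<^bsub>U\<^esub>"
proof (rule U_eqI)
  show "A \<in> carrier U" "\<one>\<^bsub>U\<^esub> \<in> carrier U" using assms diag_filt_carrier U_one_closed by auto
  fix i j assume ij: "i < j" "j < m"
  then have "j < i + k" using assms(2) by simp
  then show "A $$ (i, j) = \<one>\<^bsub>U\<^esub> $$ (i, j)" using assms(1) ij by (simp add: diag_filt_def one_entry)
qed

text \<open>With \<open>X\<close> having all superdiagonal entries \<open>1\<close> and \<open>Y\<close> supported on the \<open>p\<close>-th diagonal, the
  first nontrivial diagonal of the commutator is \<open>y (i + 1) - y i\<close>, which can be prescribed.\<close>

lemma approximate_by_commutator: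
  assumes M: "M \<in> diag_filt (Suc p)" and p: "p \<ge> 1"
  obtains X Y where "X \<in> carrier U" "Y \<in> diag_filt p" "agree (Suc p) (M \<star> (Y \<star> X)) (X \<star> Y)"
proof -
  have Mc: "M \<in> carrier U" using M by (rule diag_filt_carrier)
  \<comment> \<open>The requirement is \<open>y (i + 1) = y i + M(i, i + p + 1)\<close>. Its
    solution is a running sum, so no division occurs; entries outside the matrix count as zero to
    make \<open>y\<close> total.\<close>
  define y where "y = rec_nat \<zero> (\<lambda>i r. r \<oplus> (if i + Suc p < m then M $$ (i, i + Suc p) else \<zero>))"
  have y_Suc: "y (Suc i) = y i \<oplus> (if i + Suc p < m then M $$ (i, i + Suc p) else \<zero>)" for i
    by (simp add: y_def)
  have y: "y i \<in> carrier F" for i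
  proof (induction i)
    case (Suc i)
    then show ?case using U_D(3)[OF Mc, of i "i + Suc p"] by (auto simp: y_Suc)
  qed (simp add: y_def)
  define X where "X = mat m m (\<lambda>(i, j). if j = i \<or> j = Suc i then \<one> else \<zero>)"
  define Y where "Y = mat m m (\<lambda>(i, j). if j = i then \<one> else if j = i + p then y i else \<zero>)"
  have X_entry: "X $$ (i, j) = (if j = i \<or> j = Suc i then \<one> else \<zero>)" if "i < m" "j < m" for i j
    using that by (simp add: X_def)
  have Y_entry: "Y $$ (i, j) = (if j = i then \<one> else if j = i + p then y i else \<zero>)" if "i < m" "j < m" for i j
    using that by (simp add: Y_def)
  have X: "X \<in> carrier U" by (rule U_I) (auto simp: X_def)
  have Yc: "Y \<in> carrier U" using p y by (intro U_I) (auto simp: Y_def)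
  have Y: "Y \<in> diag_filt p" using Yc by (auto simp: diag_filt_def Y_entry)
  have W: "Y \<star> X \<in> carrier U" using X Yc by simp
  have XY: "(X \<star> Y) $$ (i, j) = Y $$ (i, j) \<oplus> Y $$ (Suc i, j)" if ij: "Suc i < m" "j < m" for i j
  proof -
    have i: "i < m" using ij by simp
    have "(X \<star> Y) $$ (i, j) = (\<Oplus>k\<in>{i, Suc i}. X $$ (i, k) \<otimes> Y $$ (k, j))"
      using ij i by (intro mult_entry_support[OF X Yc]) (auto simp: X_entry)
    then show ?thesis using ij i U_D(3)[OF Yc i ij(2)] U_D(3)[OF Yc ij] by (simp add: X_entry)
  qed
  have YX: "(Y \<star> X) $$ (i, Suc l) = Y $$ (i, l) \<oplus> Y $$ (i, Suc l)" if il: "i < m" "Suc l < m" for i l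
  proof -
    have l: "l < m" using il by simp
    have "(Y \<star> X) $$ (i, Suc l) = (\<Oplus>k\<in>{l, Suc l}. Y $$ (i, k) \<otimes> X $$ (k, Suc l))"
      using il l by (intro mult_entry_support[OF Yc X]) (auto simp: X_entry)
    then show ?thesis using il l U_D(3)[OF Yc il(1) l] U_D(3)[OF Yc il] by (simp add: X_entry)
  qed
  have M0: "M $$ (i, k) = \<zero>" if "i < k" "k < i + Suc p" "k < m" for i k
    using M that by (simp add: diag_filt_def)
  have M1: "M $$ (i, k) = \<zero>" if "k < i" "i < m" for i k
    using U_D(5)[OF Mc] that by simp
  have "agree (Suc p) (M \<star> (Y \<star> X)) (X \<star> Y)"
    unfolding agree_def
  proof (intro allI impI)
    fix i j assume ij: "i \<le> j" "j \<le> i + Suc p" "j < m"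
    let ?W = "Y \<star> X"
    show "(M \<star> ?W) $$ (i, j) = (X \<star> Y) $$ (i, j)"
    proof (cases "i = j")
      case True
      then show ?thesis
        using ij U_D(4)[OF U_mult_closed[OF Mc W]] U_D(4)[OF U_mult_closed[OF X Yc]] by simp
    next
      case False
      then have i: "i < m" "Suc i < m" using ij by auto
      obtain l where l: "j = Suc l" using False ij by (cases j) auto
      have lm: "l < m" using l ij by simp
      have Wij: "?W $$ (i, j) = Y $$ (i, l) \<oplus> Y $$ (i, j)" using YX[of i l] i ij l by simp
      note inF = U_D(3)[OF Yc i(1) lm] U_D(3)[OF Yc i(1) ij(3)] U_D(3)[OF Yc i(2) ij(3)] U_D(3)[OF W i(1) ij(3)]
      show ?thesis
      proof (cases "j = i + Suc p")
        case True
        have Mij: "M $$ (i, j) \<in> carrier F" using U_D(3)[OF Mc i(1) ij(3)] .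
        \<comment> \<open>At distance \<open>p + 1\<close> only the two ends contribute, since
          \<open>M\<close> vanishes strictly between them. The result is the entry of
          \<open>Y \<star> X\<close>, which is \<open>y i\<close>, plus that of \<open>M\<close>:
          the recurrence for \<open>y\<close>.\<close>
        have "(M \<star> ?W) $$ (i, j) = (\<Oplus>k\<in>{i, j}. M $$ (i, k) \<otimes> ?W $$ (k, j))"
        proof (rule mult_entry_support[OF Mc W i(1) ij(3)])
          fix k assume k: "k < m" "k \<notin> {i, j}"
          consider "k < i" | "i < k" "k < j" | "j < k" using k by fastforce
          then show "M $$ (i, k) = \<zero> \<or> ?W $$ (k, j) = \<zero>"
            using M1 M0[of i k] U_D(5)[OF W k(1), of j] k i True by cases auto
        qed (use i ij in auto)
        also have "\<dots> = ?W $$ (i, j) \<oplus> M $$ (i, j)"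
          using False inF Mij U_D(4)[OF Mc i(1)] U_D(4)[OF W ij(3)] by simp
        also have "\<dots> = (y i \<oplus> \<zero>) \<oplus> M $$ (i, j)"
          unfolding Wij using Y_entry[OF i(1) lm] Y_entry[OF i(1) ij(3)] True l p False by simp
        also have "\<dots> = \<zero> \<oplus> y (Suc i)"
          using True ij(3) y Mij by (simp add: y_Suc)
        also have "\<dots> = (X \<star> Y) $$ (i, j)"
          unfolding XY[OF i(2) ij(3)]
          using Y_entry[OF i(1) ij(3)] Y_entry[OF i(2) ij(3)] True p False by simp
        finally show ?thesis .
      next
        case False': False
        then have jlt: "j < i + Suc p" using ij by simp
        \<comment> \<open>Closer to the diagonal \<open>M\<close> looks like the identity and drops
          out; what is left is that \<open>X\<close> and \<open>Y\<close> commute there.\<close>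
        have "(M \<star> ?W) $$ (i, j) = (\<Oplus>k\<in>{i}. M $$ (i, k) \<otimes> ?W $$ (k, j))"
        proof (rule mult_entry_support[OF Mc W i(1) ij(3)])
          fix k assume k: "k < m" "k \<notin> {i}"
          consider "k < i" | "i < k" "k \<le> j" | "j < k" using k by fastforce
          then show "M $$ (i, k) = \<zero> \<or> ?W $$ (k, j) = \<zero>"
            using M1 M0[of i k] U_D(5)[OF W k(1), of j] k i jlt by cases auto
        qed (use i in auto)
        also have "\<dots> = ?W $$ (i, j)" using inF U_D(4)[OF Mc i(1)] by simp
        also have "\<dots> = Y $$ (i, j) \<oplus> Y $$ (i, l)" unfolding Wij using inF by (simp add: a_comm)
        also have "Y $$ (i, l) = Y $$ (Suc i, j)"
          using Y_entry[OF i(1) lm] Y_entry[OF i(2) ij(3)] l jlt by auto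
        also have "Y $$ (i, j) \<oplus> Y $$ (Suc i, j) = (X \<star> Y) $$ (i, j)"
          by (rule XY[OF i(2) ij(3), symmetric])
        finally show ?thesis .
      qed
    qed
  qed
  then show ?thesis using that X Y by blast
qed

text \<open>Descending induction along the filtration, which ends in the trivial group. Every
  \<open>M\<close> at level \<open>p + 1\<close> is a single commutator times an element of level
  \<open>p + 2\<close>, and the latter lies in \<open>S\<close> already. The claim is generalized to
  all \<open>p \<ge> p0\<close>; \<open>comm\<close> still covers the deeper levels because the
  filtration decreases.\<close>

lemma diag_filt_subset_commutators:
  assumes S: "subgroup S U" and p0: "p0 \<ge> 1"
    and comm: "\<And>X Y. X \<in> carrier U \<Longrightarrow> Y \<in> diag_filt p0 \<Longrightarrow> X \<star> Y \<star> inv\<^bsub>U\<^esub> X \<star> inv\<^bsub>U\<^esub> Y \<in> S"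
  shows "diag_filt (Suc p0) \<subseteq> S"
proof -
  have "diag_filt (Suc p) \<subseteq> S" if "p \<ge> p0" for p
    using that
  proof (induction "m - p" arbitrary: p rule: less_induct)
    case less
    show ?case
    proof (cases "m \<le> Suc p")
      case True
      then show ?thesis using diag_filt_trivial subgroup.one_closed[OF S] by blast
    next
      case False
      then have IH: "diag_filt (Suc (Suc p)) \<subseteq> S" using less.prems by (intro less.hyps) auto
      show ?thesis
      proof
        fix M assume M: "M \<in> diag_filt (Suc p)"
        have p: "p \<ge> 1" using less.prems p0 by simp
        obtain X Y where X: "X \<in> carrier U" and Y: "Y \<in> diag_filt p"
          and ag: "agree (Suc p) (M \<star> (Y \<star> X)) (X \<star> Y)"
          by (rule approximate_by_commutator[OF M p])
        have Mc: "M \<in> carrier U" and Yc: "Y \<in> carrier U" using M Y by (auto intro: diag_filt_carrier)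
        define C where "C = X \<star> Y \<star> inv\<^bsub>U\<^esub> X \<star> inv\<^bsub>U\<^esub> Y"
        have CS: "C \<in> S" unfolding C_def using comm[OF X] Y diag_filt_antimono[OF less.prems] by blast
        have Cc: "C \<in> carrier U" using X Yc by (simp add: C_def)
        have "C \<star> (Y \<star> X) = X \<star> Y"
          using X Yc by (simp add: C_def U.m_assoc U.inv_solve_left')
        then have "agree (Suc p) (M \<star> (Y \<star> X)) (C \<star> (Y \<star> X))" using ag by simp
        then have "agree (Suc p) M C"
          using X Yc by (intro agree_right_cancel[OF Mc Cc, of "Y \<star> X"]) auto
        then have "agree (Suc p) (M \<star> inv\<^bsub>U\<^esub> C) (C \<star> inv\<^bsub>U\<^esub> C)"
          using Cc by (intro agree_mult[OF Mc Cc _ _ _ agree_refl]) auto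
        then have "M \<star> inv\<^bsub>U\<^esub> C \<in> S" using IH Mc Cc by (auto simp: diag_filt_Suc)
        then have "M \<star> inv\<^bsub>U\<^esub> C \<star> C \<in> S" using CS by (rule subgroup.m_closed[OF S])
        then show "M \<in> S" using Mc Cc by (simp add: U.m_assoc)
      qed
    qed
  qed
  then show ?thesis by simp
qed

text \<open>\<open>comm\<close> bounds the commutators from above, and the descending induction
  applied to the generated subgroup gives the reverse inclusion. It is supplied for
  \<open>p = 1\<close> and \<open>p = 2\<close>, the two levels of a triple commutator.\<close>

lemma commutator_subgroup_diag_filt:
  assumes p: "p \<ge> 1"
    and comm: "\<And>X Y. X \<in> carrier U \<Longrightarrow> Y \<in> diag_filt p \<Longrightarrow> agree p (X \<star> Y) (Y \<star> X)"
  shows "commutator_subgroup U (carrier U) (diag_filt p) = diag_filt (Suc p)"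
proof
  let ?K = "\<Union>h\<in>carrier U. \<Union>k\<in>diag_filt p. {h \<star> k \<star> inv\<^bsub>U\<^esub> h \<star> inv\<^bsub>U\<^esub> k}"
  have K: "?K \<subseteq> diag_filt (Suc p)" using comm commutator_agree diag_filt_carrier by blast
  then show "commutator_subgroup U (carrier U) (diag_filt p) \<subseteq> diag_filt (Suc p)"
    unfolding commutator_subgroup_def by (rule U.generate_subgroup_incl[OF _ diag_filt_subgroup])
  have "subgroup (generate U ?K) U"
    using K diag_filt_carrier by (intro U.generate_is_subgroup) blast
  then show "diag_filt (Suc p) \<subseteq> commutator_subgroup U (carrier U) (diag_filt p)"
    unfolding commutator_subgroup_def
    by (rule diag_filt_subset_commutators[OF _ p]) (auto intro!: generate.incl)
qed

lemma diag_filt_1: "diag_filt 1 = carrier U"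
  by (auto simp: diag_filt_def)

lemma triple_commutator_subgroup:
  "commutator_subgroup U (carrier U) (commutator_subgroup U (carrier U) (carrier U)) = diag_filt 3"
proof -
  have "commutator_subgroup U (carrier U) (diag_filt 1) = diag_filt 2"
    using commutator_subgroup_diag_filt[of 1] agree_1_commute diag_filt_carrier by (simp add: numeral_2_eq_2)
  moreover have "commutator_subgroup U (carrier U) (diag_filt 2) = diag_filt 3"
    using commutator_subgroup_diag_filt[of 2] agree_2_commute by (simp add: numeral_3_eq_3)
  ultimately show ?thesis by (simp only: diag_filt_1)
qed

lemma diag_filt_3: "diag_filt 3 = {A \<in> carrier U. (\<forall>i. Suc i < m \<longrightarrow> A $$ (i, Suc i) = \<zero>) \<and>
    (\<forall>i. Suc (Suc i) < m \<longrightarrow> A $$ (i, Suc (Suc i)) = \<zero>)}"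
proof (intro equalityI subsetI)
  fix A assume "A \<in> diag_filt 3"
  then show "A \<in> {A \<in> carrier U. (\<forall>i. Suc i < m \<longrightarrow> A $$ (i, Suc i) = \<zero>) \<and>
      (\<forall>i. Suc (Suc i) < m \<longrightarrow> A $$ (i, Suc (Suc i)) = \<zero>)}"
    by (simp add: diag_filt_def)
next
  fix A assume A: "A \<in> {A \<in> carrier U. (\<forall>i. Suc i < m \<longrightarrow> A $$ (i, Suc i) = \<zero>) \<and>
      (\<forall>i. Suc (Suc i) < m \<longrightarrow> A $$ (i, Suc (Suc i)) = \<zero>)}"
  have "A $$ (i, j) = \<zero>" if "i < j" "j < i + 3" "j < m" for i j
  proof -
    have "j = Suc i \<or> j = Suc (Suc i)" using that by auto
    then show ?thesis using A \<open>j < m\<close> by auto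
  qed
  then show "A \<in> diag_filt 3" using A by (simp add: diag_filt_def)
qed

lemma heis_coords_U:
  assumes m: "m = Suc n"
    and \<theta>: "\<And>x y. x \<in> carrier F \<Longrightarrow> y \<in> carrier F \<Longrightarrow> \<theta> (x \<oplus> y) = \<theta> x * \<theta> y" "\<theta> \<zero> = 1"
      "\<exists>x\<in>carrier F. \<theta> x \<noteq> 1"
  shows "heis_coords U F n (\<lambda>i A. A $$ (i, Suc i)) (\<lambda>i A. A $$ (i, Suc (Suc i))) \<theta>"
proof (intro heis_coords.intro heis_coords_axioms.intro)
  show "fin_group U" by (rule U.fin_group_axioms)
  show "field F" by (rule field_axioms)
  show "finite (carrier F)" by (rule finite_field)
  show "A $$ (i, Suc i) \<in> carrier F" if "i < n" "A \<in> carrier U" for i A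
    using U_D(3)[OF that(2)] that(1) m by simp
  show "A $$ (i, Suc (Suc i)) \<in> carrier F" if "i < n - 1" "A \<in> carrier U" for i A
    using U_D(3)[OF that(2)] that(1) m by simp
  show "(A \<otimes>\<^bsub>U\<^esub> B) $$ (i, Suc i) = A $$ (i, Suc i) \<oplus> B $$ (i, Suc i)"
    if "i < n" "A \<in> carrier U" "B \<in> carrier U" for i A B
    using mult_entry_1[OF that(2,3)] that(1) m by simp
  show "(A \<otimes>\<^bsub>U\<^esub> B) $$ (i, Suc (Suc i)) = A $$ (i, Suc (Suc i)) \<oplus> B $$ (i, Suc (Suc i)) \<oplus>
      A $$ (i, Suc i) \<otimes> B $$ (Suc i, Suc (Suc i))"
    if "i < n - 1" "A \<in> carrier U" "B \<in> carrier U" for i A B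
    using mult_entry_2[OF that(2,3)] that(1) m by simp
  show "\<exists>A\<in>carrier U. (\<forall>i<n. A $$ (i, Suc i) = u i) \<and> (\<forall>i<n - 1. A $$ (i, Suc (Suc i)) = v i)"
    if u: "\<And>i. i < n \<Longrightarrow> u i \<in> carrier F" and v: "\<And>i. i < n - 1 \<Longrightarrow> v i \<in> carrier F" for u v
  proof -
    define A where "A = mat m m (\<lambda>(i, j). if j = i then \<one> else if j = Suc i then u i
      else if j = Suc (Suc i) then v i else \<zero>)"
    have "A \<in> carrier U" using u v m by (intro U_I) (auto simp: A_def)
    moreover have "\<forall>i<n. A $$ (i, Suc i) = u i" "\<forall>i<n - 1. A $$ (i, Suc (Suc i)) = v i"
      using m by (auto simp: A_def)
    ultimately show ?thesis by blast
  qed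
  show "commutator_subgroup U (carrier U) (commutator_subgroup U (carrier U) (carrier U)) =
      {A \<in> carrier U. (\<forall>i<n. A $$ (i, Suc i) = \<zero>) \<and> (\<forall>i<n - 1. A $$ (i, Suc (Suc i)) = \<zero>)}"
    unfolding triple_commutator_subgroup diag_filt_3 using m by (auto simp: less_diff_conv)
qed (use \<theta> in auto)

end

section \<open>From the unitriangular group to the counts\<close>

lemma (in field) exists_additive_character:
  assumes fin: "finite (carrier R)"
  obtains \<theta> :: "'a \<Rightarrow> complex" where
    "\<And>x y. x \<in> carrier R \<Longrightarrow> y \<in> carrier R \<Longrightarrow> \<theta> (x \<oplus> y) = \<theta> x * \<theta> y" "\<theta> \<zero> = 1"
    "\<exists>x\<in>carrier R. \<theta> x \<noteq> 1"
proof -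
  show ?thesis
    by (rule add.exists_nontrivial_linear_character[of \<one>]) (use fin that in auto)
qed

lemma heisenberg_counts:
  fixes F :: "('a, 'c) ring_scheme"
  assumes F: "field F" and fin: "finite (carrier F)" and q: "card (carrier F) > 1"
  shows "finite (heisenberg_characters (unitriangular_group (n + 1) F))"
    and "card (heisenberg_characters (unitriangular_group (n + 1) F)) = field.radical_total F n"
    and "card {\<chi> \<in> heisenberg_characters (unitriangular_group (n + 1) F).
           character_degree (unitriangular_group (n + 1) F) \<chi> = of_nat (card (carrier F) ^ e)} =
         card (carrier F) ^ (n - 2 * e) * field.form_count F n e"
proof -
  let ?q = "card (carrier F)"
  interpret field F by (rule F)
  interpret unitriangular F "Suc n" by unfold_locales (rule fin)
  obtain \<theta> :: "'a \<Rightarrow> complex" where \<theta>: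
    "\<And>x y. x \<in> carrier F \<Longrightarrow> y \<in> carrier F \<Longrightarrow> \<theta> (x \<oplus>\<^bsub>F\<^esub> y) = \<theta> x * \<theta> y" "\<theta> \<zero>\<^bsub>F\<^esub> = 1"
    "\<exists>x\<in>carrier F. \<theta> x \<noteq> 1"
    using exists_additive_character[OF fin] by blast
  interpret heis_coords "unitriangular_group (Suc n) F" F n "\<lambda>i A. A $$ (i, Suc i)" "\<lambda>i A. A $$ (i, Suc (Suc i))" \<theta>
    by (rule heis_coords_U[OF refl \<theta>])
  show "finite (heisenberg_characters (unitriangular_group (n + 1) F))"
    using finite_heisenberg_characters by simp
  show "card (heisenberg_characters (unitriangular_group (n + 1) F)) = radical_total n"
    using card_heisenberg_characters by (simp add: radical_total_def)
  \<comment> \<open>Since \<open>q > 1\<close>, exponents of \<open>q\<close> can be compared;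
    \<open>half_rank_le\<close> guarantees that the subtraction does not truncate.\<close>
  have rank: "(?q ^ e)^2 * card (path_radical F n z) = ?q ^ n \<longleftrightarrow> half_rank F n z = e"
    if z: "z \<in> {..<n - 1} \<rightarrow>\<^sub>E carrier F" for z
  proof -
    have "card (path_radical F n z) = ?q ^ (n - 2 * half_rank F n z)"
      using z by (intro card_path_radical[OF fin]) auto
    then have "(?q ^ e)^2 * card (path_radical F n z) = ?q ^ (2 * e + (n - 2 * half_rank F n z))"
      by (simp add: power_add power_mult[symmetric] mult.commute)
    then have "(?q ^ e)^2 * card (path_radical F n z) = ?q ^ n \<longleftrightarrow> 2 * e + (n - 2 * half_rank F n z) = n"
      using q by simp
    then show ?thesis using half_rank_le[of F n z] by auto
  qed
  have "card {\<chi> \<in> heisenberg_characters (unitriangular_group (Suc n) F).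
      character_degree (unitriangular_group (Suc n) F) \<chi> = of_nat (?q ^ e)} =
    (\<Sum>z | z \<in> {..<n - 1} \<rightarrow>\<^sub>E carrier F \<and> (?q ^ e)^2 * card (path_radical F n z) = ?q ^ n.
      card (path_radical F n z))"
    by (rule card_heisenberg_characters_degree)
  also have "{z. z \<in> {..<n - 1} \<rightarrow>\<^sub>E carrier F \<and> (?q ^ e)^2 * card (path_radical F n z) = ?q ^ n} =
      {z. z \<in> {..<n - 1} \<rightarrow>\<^sub>E carrier F \<and> half_rank F n z = e}"
    using rank by blast
  also have "(\<Sum>z\<in>\<dots>. card (path_radical F n z)) = ?q ^ (n - 2 * e) * form_count n e"
    by (rule sum_path_radical_rank[OF fin])
  finally show "card {\<chi> \<in> heisenberg_characters (unitriangular_group (n + 1) F).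
      character_degree (unitriangular_group (n + 1) F) \<chi> = of_nat (?q ^ e)} =
    ?q ^ (n - 2 * e) * form_count n e" by simp
qed

text \<open>The exponent \<open>n - e - 1\<close> is negative for \<open>e \<ge> n\<close>, hence
  the integer power. Both sides vanish once \<open>2 * e > n\<close>; for smaller \<open>e\<close>
  the exponent is a natural number because \<open>n \<ge> 1\<close>.\<close>

lemma (in field) form_count_real:
  assumes fin: "finite (carrier R)" and n: "n \<ge> 1" and q: "card (carrier R) > 1"
  defines "q \<equiv> real (card (carrier R))"
  shows "real (card (carrier R) ^ (n - 2 * e) * form_count n e) =
    q powi (int n - int e - 1) *
      (real (binom (int n - int e) (int e)) * (q - 1) ^ e +
       real (binom (int n - int e - 1) (int e)) * (q - 1) ^ (e + 1))"
proof -
  obtain t where t: "card (carrier R) = Suc t" using q by (cases "card (carrier R)") auto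
  have qt: "q = real t + 1" by (simp add: q_def t)
  have q0: "q > 0" by (simp add: qt)
  define B where "B = real ((n - e) choose e) * (q - 1) ^ e + real ((n - e - 1) choose e) * (q - 1) ^ (e + 1)"
  have b1: "binom (int n - int e) (int e) = (n - e) choose e"
    using n by (auto simp: binom_def nat_diff_distrib)
  \<comment> \<open>The truncated difference agrees with the integer one wherever the integer
    binomial is nonzero. The case \<open>n = e = 0\<close>, where truncation would turn 0 into
    \<open>0 choose 0 = 1\<close>, is excluded by \<open>n \<ge> 1\<close>.\<close>
  have b2: "binom (int n - int e - 1) (int e) = (n - e - 1) choose e"
  proof (cases "2 * e \<le> n - 1")
    case True
    then have eq: "int n - int e - 1 = int (n - e - 1)" using n by (cases n) (auto simp: of_nat_diff)
    show ?thesis unfolding eq by (simp add: binom_def binomial_eq_0)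
  next
    case False
    then have "n - e - 1 < e" using n by linarith
    then show ?thesis using False n by (auto simp: binom_def)
  qed
  have "real (Suc t * form_count n e) =
      real (Suc t ^ e * (((n - e) choose e) * t ^ e + ((n - e - 1) choose e) * t ^ (e + 1)))"
    unfolding form_count_closed_form[OF fin n t] ..
  then have closed: "q * real (form_count n e) = q ^ e * B"
    by (simp add: B_def qt algebra_simps)
  show ?thesis
    unfolding b1 b2 B_def[symmetric]
  proof (cases "2 * e \<le> n")
    case True
    \<comment> \<open>The closed form is available only for \<open>q * form_count n e\<close>, so
      the claim is first proved times \<open>q\<close> and the positive factor is cancelled.\<close>
    have "q * real (card (carrier R) ^ (n - 2 * e) * form_count n e) = q ^ (n - 2 * e) * (q ^ e * B)"
      unfolding closed[symmetric] by (simp add: q_def)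
    also have "\<dots> = q ^ (n - e) * B"
      using True by (simp add: power_add[symmetric] mult.assoc[symmetric])
    also have "q ^ (n - e) = q * q powi (int n - int e - 1)"
    proof -
      have eq: "int n - int e - 1 = int (n - e - 1)" and Suc: "n - e = Suc (n - e - 1)" using True n by auto
      show ?thesis unfolding eq power_int_of_nat by (subst Suc) (rule power_Suc)
    qed
    finally show "real (card (carrier R) ^ (n - 2 * e) * form_count n e) = q powi (int n - int e - 1) * B"
      using q0 by simp
  next
    case False
    then have "n - e < e" "n - e - 1 < e" by auto
    then have "B = 0" by (simp add: B_def binomial_eq_0)
    then show "real (card (carrier R) ^ (n - 2 * e) * form_count n e) = q powi (int n - int e - 1) * B"
      using form_count_eq_0[of n e] False by simp
  qed
qed

theorem theorem1p2:
  fixes n :: nat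
  assumes "n \<ge> 1"
  shows
    "(\<forall>(F :: 'a ring) (q :: nat).
        primepow q \<and> field F \<and> card (carrier F) = q \<longrightarrow>
        finite (heisenberg_characters (unitriangular_group (n + 1) F)) \<and>
        (\<forall>e :: nat.
           real (card {\<chi> \<in> heisenberg_characters (unitriangular_group (n + 1) F).
                   character_degree (unitriangular_group (n + 1) F) \<chi> = of_nat (q ^ e)}) =
           real q powi (int n - int e - 1) *
             (real (binom (int n - int e) (int e)) * (real q - 1) ^ e +
              real (binom (int n - int e - 1) (int e)) * (real q - 1) ^ (e + 1)))) \<and>
     (\<exists>P :: int poly.
        (\<forall>i. Polynomial.coeff P i \<ge> 0) \<and>
        Polynomial.degree P = n \<and>
        Polynomial.lead_coeff P = int (fib n) \<and>
        (\<forall>(F :: 'a ring) (q :: nat).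
           primepow q \<and> field F \<and> card (carrier F) = q \<longrightarrow>
           int (card (heisenberg_characters (unitriangular_group (n + 1) F))) =
             poly P (int q - 1)))"
proof (intro conjI exI[of _ "heis_poly n"] allI impI; (elim conjE)?)
  fix F :: "'a ring" and q :: nat
  assume pq: "primepow q" and F: "field F" and q: "card (carrier F) = q"
  have q1: "card (carrier F) > 1" using primepow_gt_Suc_0[OF pq] q by simp
  \<comment> \<open>An infinite carrier would have cardinality 0, whereas a prime power exceeds
    1.\<close>
  then have fin: "finite (carrier F)" by (metis card.infinite not_one_less_zero)
  note counts = heisenberg_counts[OF F fin q1, where n = n]
  show "finite (heisenberg_characters (unitriangular_group (n + 1) F))" by (rule counts(1))
  show "real (card {\<chi> \<in> heisenberg_characters (unitriangular_group (n + 1) F).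
                   character_degree (unitriangular_group (n + 1) F) \<chi> = of_nat (q ^ e)}) =
           real q powi (int n - int e - 1) *
             (real (binom (int n - int e) (int e)) * (real q - 1) ^ e +
              real (binom (int n - int e - 1) (int e)) * (real q - 1) ^ (e + 1))" for e
    using counts(3)[of e] field.form_count_real[OF F fin assms q1, of e] by (simp only: q)
  show "int (card (heisenberg_characters (unitriangular_group (n + 1) F))) = poly (heis_poly n) (int q - 1)"
    using field.radical_total_poly[OF F fin assms] counts(2) q by simp
next
  show "coeff (heis_poly n) i \<ge> 0" for i by (rule coeff_heis_poly_nonneg)
  show "degree (heis_poly n) = n" by (rule degree_heis_poly[OF assms])
  then show "lead_coeff (heis_poly n) = int (fib n)" using heis_poly_lead[OF assms] by simp
qed

end
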